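(* Let $(Z_n)_{n\ge 0}$ be a Markov-additive process on $\mathbb{Z}^d\times\{1,\dots,p\}$ which is irreducible, aperiodic, has finite exponential moments, and is non-centered (its global drift $m$ is non-zero). Then there exist a continuous function $c:\mathbb{S}^{d-1}\to\mathbb{R}^d$, for each $i,j\in\{1,\dots,p\}$ a continuous function $\chi_{i,j}:\mathbb{S}^{d-1}\to\mathbb{R}$, and positive constants $C_1,C_2$ such that $C_1\le \chi_{i,j}\le C_2$ and $$G\big((0,i),(x,j)\big)\sim \chi_{i,j}\!\left(\frac{x}{\|x\|}\right)\|x\|^{-\frac{d-1}{2}}\, e^{-c\left(\frac{x}{\|x\|}\right)\cdot x}\qquad\text{as } \|x\|\to+\infty,\ x\in\mathbb{Z}^d.$$
   Context: Fix integers $d,p\ge 1$. A Markov-additive process on $\mathbb{Z}^d\times\{1,\dots,p\}$ is a Markov chain $(Z_n)_{n\ge0}=(A_n,M_n)_{n\ge0}$ such that $\mathbb{P}_{(x,i)}((A_1,M_1)=(x',i'))=\mathbb{P}_{(0,i)}((A_1,M_1)=(x'-x,i'))$ for all $x,x'\in\mathbb{Z}^d$, $i,i'\in\{1,\dots,p\}$. Its jump matrix is the $p\times p$ matrix of sub-probability measures $\mu_{i,j}(x)=\mathbb{P}_{(0,i)}((A_1,M_1)=(x,j))$ on $\mathbb{Z}^d$. Aperiodic means: for every state $(x,i)$, $\gcd\{n\ge1:\mathbb{P}_{(x,i)}(Z_n=(x,i))>0\}=1$. Finite exponential moments means $\sum_{x\in\mathbb{Z}^d}e^{\alpha\|x\|}\mu_{i,j}(x)<\infty$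 for all $i,j$ and all $\alpha>0$. The matrix $\big(\sum_x\mu_{i,j}(x)\big)_{i,j}$ is the transition matrix of the chain $(M_n)$, which under these assumptions has a unique stationary distribution $\pi=(\pi_1,\dots,\pi_p)$. The local drifts are $m_{i,j}=\sum_x x\,\mu_{i,j}(x)\in\mathbb{R}^d$ and the global drift is $m=\sum_{i,j}\pi_i m_{i,j}$. The Green function is $G((z,i),(x,j))=\sum_{n\ge0}\mathbb{P}_{(z,i)}(Z_n=(x,j))$. *)

theory Defs
  imports "HOL-Analysis.Analysis"
begin

text \<open>A Markov-additive process on Z^d x {1..p} is given by its jump matrix
  mu i j :: int^'d => real (i, j in {1..p}).  States are pairs (x, i).\<close>

type_synonym 'd jumps = "nat \<Rightarrow> nat \<Rightarrow> int ^ 'd \<Rightarrow> real"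

definition vreal :: "int ^ 'd \<Rightarrow> real ^ 'd" where
  "vreal x = (\<chi> k. real_of_int (x $ k))"

definition is_MAP :: "nat \<Rightarrow> ('d::finite) jumps \<Rightarrow> bool" where
  "is_MAP p mu \<longleftrightarrow> p \<ge> 1 \<and>
     (\<forall>i j x. mu i j x \<ge> 0) \<and>
     (\<forall>i\<in>{1..p}. \<forall>j\<in>{1..p}. mu i j summable_on UNIV) \<and>
     (\<forall>i\<in>{1..p}. (\<Sum>j\<in>{1..p}. infsum (mu i j) UNIV) = 1)"

primrec trans_n :: "nat \<Rightarrow> ('d::finite) jumps \<Rightarrow> nat \<Rightarrow> ((int ^ 'd) \<times> nat) \<Rightarrow> ((int ^ 'd) \<times> nat) \<Rightarrow> real" where
  "trans_n p mu 0 a b = (if a = b then 1 else 0)"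
| "trans_n p mu (Suc n) a b =
     (\<Sum>k\<in>{1..p}. infsum (\<lambda>z. mu (snd a) k z * trans_n p mu n (fst a + z, k) b) UNIV)"

definition states :: "nat \<Rightarrow> ((int ^ 'd) \<times> nat) set" where
  "states p = (UNIV :: (int ^ 'd) set) \<times> {1..p}"

definition MAP_irreducible :: "nat \<Rightarrow> ('d::finite) jumps \<Rightarrow> bool" where
  "MAP_irreducible p mu \<longleftrightarrow>
     (\<forall>a\<in>states p. \<forall>b\<in>states p. \<exists>n. trans_n p mu n a b > 0)"

definition MAP_aperiodic :: "nat \<Rightarrow> ('d::finite) jumps \<Rightarrow> bool" where
  "MAP_aperiodic p mu \<longleftrightarrow>
     (\<forall>a\<in>states p. Gcd {n::nat. n \<ge> 1 \<and> trans_n p mu n a a > 0} = 1)"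

definition finite_exp_moments :: "nat \<Rightarrow> ('d::finite) jumps \<Rightarrow> bool" where
  "finite_exp_moments p mu \<longleftrightarrow>
     (\<forall>i\<in>{1..p}. \<forall>j\<in>{1..p}. \<forall>\<alpha>>0.
        (\<lambda>x. exp (\<alpha> * norm (vreal x)) * mu i j x) summable_on UNIV)"

definition mod_trans :: "('d::finite) jumps \<Rightarrow> nat \<Rightarrow> nat \<Rightarrow> real" where
  "mod_trans mu i j = infsum (mu i j) UNIV"

definition stat_dist :: "nat \<Rightarrow> ('d::finite) jumps \<Rightarrow> nat \<Rightarrow> real" where
  "stat_dist p mu = (THE \<pi>. (\<forall>i\<in>{1..p}. \<pi> i \<ge> 0) \<and> (\<forall>i. i \<notin> {1..p} \<longrightarrow> \<pi> i = 0)
      \<and> (\<Sum>i\<in>{1..p}. \<pi> i) = 1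
      \<and> (\<forall>j\<in>{1..p}. (\<Sum>i\<in>{1..p}. \<pi> i * mod_trans mu i j) = \<pi> j))"

definition local_drift :: "('d::finite) jumps \<Rightarrow> nat \<Rightarrow> nat \<Rightarrow> real ^ 'd" where
  "local_drift mu i j = infsum (\<lambda>x. mu i j x *\<^sub>R vreal x) UNIV"

definition global_drift :: "nat \<Rightarrow> ('d::finite) jumps \<Rightarrow> real ^ 'd" where
  "global_drift p mu = (\<Sum>i\<in>{1..p}. \<Sum>j\<in>{1..p}. stat_dist p mu i *\<^sub>R local_drift mu i j)"

definition green :: "nat \<Rightarrow> ('d::finite) jumps \<Rightarrow> ((int ^ 'd) \<times> nat) \<Rightarrow> ((int ^ 'd) \<times> nat) \<Rightarrow> real" where
  "green p mu a b = (\<Sum>n. trans_n p mu n a b)"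

end

theory Submission
  imports Defs "HOL-Probability.Probability"
begin

text \<open>
  Fix a modulating state \<open>s\<close>. The positions at the successive visits to \<open>s\<close> form a random walk on the
  lattice, and the Green function of the process is the Green function of this excursion walk convolved
  with the expected visits during one excursion. So it suffices to treat walks with jump measure \<open>\<nu>\<close>
  whose Laplace transform \<open>\<phi>\<close> has an open domain. Non-zero drift means that \<open>\<phi> < 1\<close> somewhere, so that
  \<open>D = {\<phi> \<le> 1}\<close> is a strictly convex body; it does not depend on \<open>s\<close>, because \<open>\<phi> < 1\<close> says that the
  tilted Green function is summable. The exponent \<open>c u\<close> is the point of \<open>D\<close> maximising \<open>u \<bullet> \<alpha>\<close>: tilting by it
  gives a probability measure with mean in direction \<open>u\<close>.

  For \<open>x = t *\<^sub>R mean\<close> the tilted Green function, multiplied by \<open>t\<close> to the power \<open>(d - 1) / 2\<close>, is the integral over \<open>r\<close> of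
  \<open>sqrt t ^ d\<close> times the \<open>n\<close>-step mass at \<open>x\<close>, where \<open>n = \<lfloor>t + r * sqrt t\<rfloor>\<close>. Fourier inversion gives the limit
  for each \<open>r\<close>, and tilting further along the mean gives an integrable bound in \<open>r\<close>, so dominated convergence
  applies. Working along arbitrary sequences with converging directions makes the asymptotics
  uniform and the limit continuous.
\<close>

section \<open>Exponentially tilted transforms on the integer lattice\<close>

text \<open>Each starting state \<open>i\<close> is treated with base state \<open>s = i\<close>, so
  one exponent must come out of \<open>p\<close> different walks; hence \<open>D\<close> has to be
  described without reference to \<open>s\<close>. Scalar excursion walks replace the perturbation
  theory of a Perron eigenvalue by renewal identities.

  The price is that the excursion law need not inherit all exponential moments of \<open>mu\<close>,
  while tilting at a point of \<open>D\<close> needs room around that point. The room comes from two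
  facts: the set of convergence is open, by a strictly superharmonic vector whose inequalities
  survive a small change of the tilt, and \<open>D\<close> is closed, by a Fatou argument, so it
  never runs into the boundary of that set.

  An excursion walk may be periodic. Its lazy version has transform \<open>(1 + \<phi>) / 2\<close>,
  and \<open>1 / (1 - (1 + \<phi>) / 2) = 2 / (1 - \<phi>)\<close>, so the Green function merely
  doubles.

  The power \<open>(d - 1) / 2\<close> counts scales: near the relevant time \<open>t\<close> the
  tilted \<open>n\<close>-step mass is of order \<open>t\<close> to the power
  \<open>- d / 2\<close>, and about \<open>sqrt t\<close> values of \<open>n\<close>
  contribute.\<close>

lemma vreal_add: "vreal (x + y) = vreal x + vreal y"
  and vreal_diff: "vreal (x - y) = vreal x - vreal y"
  and vreal_0 [simp]: "vreal 0 = 0"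
  by (simp_all add: vreal_def vec_eq_iff)

lemma vreal_eq_0_iff [simp]: "vreal x = 0 \<longleftrightarrow> x = 0"
  by (simp add: vreal_def vec_eq_iff)

lemma vreal_nth [simp]: "vreal x $ k = real_of_int (x $ k)"
  by (simp add: vreal_def)

text \<open>An absolutely summable family is an integrable function for the counting measure, so
  this is Lebesgue's theorem. The bound is asked only eventually because a moving tilt is near its
  limit only for large indices.\<close>

lemma infsum_dominated_convergence:
  fixes f :: "nat \<Rightarrow> 'a \<Rightarrow> 'b::{banach, second_countable_topology}"
  assumes lim: "\<And>x. (\<lambda>k. f k x) \<longlonglongrightarrow> g x"
    and bound: "eventually (\<lambda>k. \<forall>x. norm (f k x) \<le> w x) sequentially"
    and w: "w summable_on UNIV"
  shows "(\<lambda>k. infsum (f k) UNIV) \<longlonglongrightarrow> infsum g UNIV"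
proof -
  from bound obtain N where "\<And>k x. k \<ge> N \<Longrightarrow> norm (f k x) \<le> w x"
    by (auto simp: eventually_sequentially)
  then have N: "\<And>k x. norm (f (k + N) x) \<le> w x" by simp
  have w_nn: "0 \<le> w x" for x
    using N[of 0 x] norm_ge_zero order_trans by blast
  have w_int: "integrable (count_space UNIV) w"
    using abs_summable_equivalent[of w UNIV] w summable_on_iff_abs_summable_on_real[of w UNIV]
    by (simp add: Infinite_Set_Sum.abs_summable_on_def)
  have conv: "infsum h UNIV = integral\<^sup>L (count_space UNIV) h" if "\<And>x. norm (h x) \<le> w x" for h :: "'a \<Rightarrow> 'b"
  proof -
    have "integrable (count_space UNIV) h"
      by (rule Bochner_Integration.integrable_bound[OF w_int]) (use that w_nn in auto)
    then have "Infinite_Set_Sum.abs_summable_on h UNIV"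
      by (simp add: Infinite_Set_Sum.abs_summable_on_def)
    from infsetsum_infsum[OF this] show ?thesis
      by (simp add: infsetsum_def)
  qed
  have g: "norm (g x) \<le> w x" for x
    by (rule LIMSEQ_le_const2[OF tendsto_norm[OF LIMSEQ_ignore_initial_segment[OF lim, of N]]])
      (use N in auto)
  have "(\<lambda>k. integral\<^sup>L (count_space UNIV) (f (k + N))) \<longlonglongrightarrow> integral\<^sup>L (count_space UNIV) g"
    by (rule integral_dominated_convergence[where w = w])
      (use w_int N LIMSEQ_ignore_initial_segment[OF lim, of N] in auto)
  then have "(\<lambda>k. infsum (f (k + N)) UNIV) \<longlonglongrightarrow> infsum g UNIV"
    using conv[OF g] conv[OF N] by simp
  then show ?thesis
    by (rule LIMSEQ_offset)
qed

section \<open>Tilts, transforms and convolution\<close>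

definition tilt :: "real ^ 'd \<Rightarrow> int ^ 'd \<Rightarrow> real" where
  "tilt \<alpha> x = exp (\<alpha> \<bullet> vreal x)"

definition tilt_summable :: "(int ^ 'd \<Rightarrow> real) \<Rightarrow> real ^ 'd \<Rightarrow> bool" where
  "tilt_summable f \<alpha> \<longleftrightarrow> (\<lambda>x. f x * tilt \<alpha> x) summable_on UNIV"

definition laplace :: "(int ^ 'd \<Rightarrow> real) \<Rightarrow> real ^ 'd \<Rightarrow> real" where
  "laplace f \<alpha> = (\<Sum>\<^sub>\<infinity>x. f x * tilt \<alpha> x)"

definition fourier :: "(int ^ 'd \<Rightarrow> real) \<Rightarrow> real ^ 'd \<Rightarrow> real ^ 'd \<Rightarrow> complex" where
  "fourier f \<alpha> \<theta> = (\<Sum>\<^sub>\<infinity>x. of_real (f x * tilt \<alpha> x) * cis (\<theta> \<bullet> vreal x))"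

definition conv :: "(int ^ 'd \<Rightarrow> real) \<Rightarrow> (int ^ 'd \<Rightarrow> real) \<Rightarrow> int ^ 'd \<Rightarrow> real" where
  "conv f g x = (\<Sum>\<^sub>\<infinity>y. f y * g (x - y))"

lemma tilt_pos [simp]: "tilt \<alpha> x > 0" and tilt_nonneg [simp]: "tilt \<alpha> x \<ge> 0"
  and tilt_neq_0 [simp]: "tilt \<alpha> x \<noteq> 0"
  by (simp_all add: tilt_def)

lemma tilt_add_right: "tilt \<alpha> (x + y) = tilt \<alpha> x * tilt \<alpha> y"
  by (simp add: tilt_def vreal_add inner_add_right exp_add)

lemma tilt_add_left: "tilt (\<alpha> + \<beta>) x = tilt \<alpha> x * tilt \<beta> x"
  by (simp add: tilt_def inner_add_left exp_add)

lemma tilt_0 [simp]: "tilt \<alpha> 0 = 1" "tilt 0 x = 1"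
  by (simp_all add: tilt_def)

lemma fourier_abs_summable:
  assumes "tilt_summable f \<alpha>"
  shows "(\<lambda>x. norm (complex_of_real (f x * tilt \<alpha> x) * cis (\<theta> \<bullet> vreal x))) summable_on UNIV"
  using assms summable_on_iff_abs_summable_on_real[of "\<lambda>x. f x * tilt \<alpha> x"]
  by (simp add: tilt_summable_def norm_mult del: of_real_mult)

lemma fourier_summable:
  assumes "tilt_summable f \<alpha>"
  shows "(\<lambda>x. complex_of_real (f x * tilt \<alpha> x) * cis (\<theta> \<bullet> vreal x)) summable_on UNIV"
  using abs_summable_summable[OF fourier_abs_summable[OF assms]] .

lemma infsum_of_real: "f summable_on A \<Longrightarrow> (\<Sum>\<^sub>\<infinity>x\<in>A. complex_of_real (f x)) = of_real (infsum f A)"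
  by (rule infsumI, rule has_sum_of_real, rule has_sum_infsum)

lemma fourier_0: "tilt_summable f \<alpha> \<Longrightarrow> fourier f \<alpha> 0 = of_real (laplace f \<alpha>)"
  unfolding fourier_def laplace_def tilt_summable_def
  by (simp del: of_real_mult add: infsum_of_real)

lemma laplace_nonneg: "(\<And>x. f x \<ge> 0) \<Longrightarrow> laplace f \<alpha> \<ge> 0"
  unfolding laplace_def by (intro infsum_nonneg) auto

lemma norm_fourier_le:
  assumes "\<And>x. f x \<ge> 0" "tilt_summable f \<alpha>"
  shows "norm (fourier f \<alpha> \<theta>) \<le> laplace f \<alpha>"
proof -
  have "norm (fourier f \<alpha> \<theta>) \<le> (\<Sum>\<^sub>\<infinity>x. norm (complex_of_real (f x * tilt \<alpha> x) * cis (\<theta> \<bullet> vreal x)))"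
    unfolding fourier_def by (rule norm_infsum_bound[OF fourier_abs_summable[OF assms(2)]])
  also have "\<dots> = laplace f \<alpha>"
    unfolding laplace_def using assms(1) by (intro infsum_cong) (simp add: norm_mult)
  finally show ?thesis .
qed

lemma tilt_term_le_laplace:
  assumes "\<And>x. f x \<ge> 0" "tilt_summable f \<alpha>"
  shows "f x * tilt \<alpha> x \<le> laplace f \<alpha>"
proof -
  have "(\<Sum>\<^sub>\<infinity>y\<in>{x}. f y * tilt \<alpha> y) \<le> laplace f \<alpha>"
    unfolding laplace_def using assms by (intro infsum_mono2) (auto simp: tilt_summable_def)
  then show ?thesis by simp
qed

lemma tilt_summable_mono:
  assumes "tilt_summable g \<alpha>" "\<And>x. 0 \<le> f x" "\<And>x. f x \<le> g x"
  shows "tilt_summable f \<alpha>"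
  unfolding tilt_summable_def
  by (rule summable_on_comparison_test[OF assms(1)[unfolded tilt_summable_def]])
    (simp_all add: assms mult_right_mono)

lemma tilt_summable_cmult: "tilt_summable f \<alpha> \<Longrightarrow> tilt_summable (\<lambda>x. c * f x) \<alpha>"
  unfolding tilt_summable_def using summable_on_cmult_right[of "\<lambda>x. f x * tilt \<alpha> x" UNIV c]
  by (simp add: mult.assoc)

lemma fourier_cmult: "fourier (\<lambda>x. c * f x) \<alpha> \<theta> = of_real c * fourier f \<alpha> \<theta>"
  unfolding fourier_def by (subst infsum_cmult_right'[symmetric]) (simp add: mult.assoc)

lemma tilt_summable_add: "tilt_summable f \<alpha> \<Longrightarrow> tilt_summable g \<alpha> \<Longrightarrow> tilt_summable (\<lambda>x. f x + g x) \<alpha>"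
  unfolding tilt_summable_def using summable_on_add[of "\<lambda>x. f x * tilt \<alpha> x" UNIV "\<lambda>x. g x * tilt \<alpha> x"]
  by (simp add: algebra_simps)

lemma fourier_add:
  "tilt_summable f \<alpha> \<Longrightarrow> tilt_summable g \<alpha> \<Longrightarrow>
    fourier (\<lambda>x. f x + g x) \<alpha> \<theta> = fourier f \<alpha> \<theta> + fourier g \<alpha> \<theta>"
  unfolding fourier_def
  by (subst infsum_add[OF fourier_summable fourier_summable, symmetric]) (auto simp: ring_distribs)

lemma tilt_summable_sum:
  "finite K \<Longrightarrow> (\<And>k. k \<in> K \<Longrightarrow> tilt_summable (f k) \<alpha>) \<Longrightarrow> tilt_summable (\<lambda>x. \<Sum>k\<in>K. f k x) \<alpha>"
proof (induction K rule: finite_induct)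
  case empty
  then show ?case by (simp add: tilt_summable_def)
next
  case (insert k K)
  then show ?case using tilt_summable_add[of "f k" \<alpha> "\<lambda>x. \<Sum>k\<in>K. f k x"] by simp
qed

lemma fourier_sum:
  assumes "finite K" "\<And>k. k \<in> K \<Longrightarrow> tilt_summable (f k) \<alpha>"
  shows "fourier (\<lambda>x. \<Sum>k\<in>K. f k x) \<alpha> \<theta> = (\<Sum>k\<in>K. fourier (f k) \<alpha> \<theta>)"
  using assms
proof (induction K rule: finite_induct)
  case empty
  then show ?case by (simp add: fourier_def)
next
  case (insert k K)
  then have "fourier (\<lambda>x. f k x + (\<Sum>k\<in>K. f k x)) \<alpha> \<theta> = fourier (f k) \<alpha> \<theta> + (\<Sum>k\<in>K. fourier (f k) \<alpha> \<theta>)"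
    by (subst fourier_add) (auto intro!: tilt_summable_sum)
  then show ?case using insert by simp
qed

lemma summable_on_mult_Times:
  fixes f :: "'a \<Rightarrow> real" and g :: "'b \<Rightarrow> real"
  assumes "f summable_on A" "g summable_on B" "\<And>x. f x \<ge> 0" "\<And>y. g y \<ge> 0"
  shows "(\<lambda>(x, y). f x * g y) summable_on A \<times> B"
proof (rule summable_on_SigmaI[where g = "\<lambda>x. f x * infsum g B"])
  show "((\<lambda>y. case (x, y) of (x, y) \<Rightarrow> f x * g y) has_sum f x * infsum g B) B" for x
    using has_sum_cmult_right[OF has_sum_infsum[OF assms(2)], of "f x"] by simp
  show "(\<lambda>x. f x * infsum g B) summable_on A"
    using assms(1) by (rule summable_on_cmult_left)
qed (use assms in auto)

text \<open>The shear \<open>(x, y)\<close> to \<open>(y, x - y)\<close> turns the summand of the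
  tilted convolution into a product, whose summability on the product set is known; everything else
  is Fubini.\<close>

lemma
  assumes f: "\<And>x. f x \<ge> 0" and g: "\<And>x. g x \<ge> 0"
    and sf: "tilt_summable f \<alpha>" and sg: "tilt_summable g \<alpha>"
  shows tilt_summable_conv: "tilt_summable (conv f g) \<alpha>"
    and fourier_conv: "fourier (conv f g) \<alpha> \<theta> = fourier f \<alpha> \<theta> * fourier g \<alpha> \<theta>"
    and conv_summable: "(\<lambda>y. f y * g (x - y)) summable_on UNIV"
proof -
  let ?F = "\<lambda>x. f x * tilt \<alpha> x" and ?G = "\<lambda>x. g x * tilt \<alpha> x"
  let ?c = "\<lambda>x. cis (\<theta> \<bullet> vreal x)"
  have FG: "(\<lambda>(y, z). ?F y * ?G z) summable_on UNIV \<times> UNIV"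
    using sf sg f g by (intro summable_on_mult_Times) (auto simp: tilt_summable_def)
  have bij: "bij_betw (\<lambda>(x, y). (y, x - y)) (UNIV \<times> UNIV) (UNIV \<times> (UNIV :: (int^'a) set))"
    by (rule bij_betwI[where g = "\<lambda>(y, z). (y + z, y)"]) auto
  have eq: "?F y * ?G (x - y) = f y * g (x - y) * tilt \<alpha> x" for x y
    using tilt_add_right[of \<alpha> y "x - y"] by simp
  have S: "(\<lambda>(x, y). f y * g (x - y) * tilt \<alpha> x) summable_on UNIV \<times> UNIV"
    using FG summable_on_reindex_bij_betw[OF bij, of "\<lambda>(y, z). ?F y * ?G z"]
    by (simp add: case_prod_unfold eq)
  have S1: "(\<lambda>y. f y * g (x - y) * tilt \<alpha> x) summable_on UNIV" for x
    using summable_on_SigmaD1[OF S, of x] by simp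
  show S2: "(\<lambda>y. f y * g (x - y)) summable_on UNIV" for x
    using summable_on_cmult_left[OF S1[of x], of "1 / tilt \<alpha> x"] by simp
  have c1: "conv f g x * tilt \<alpha> x = (\<Sum>\<^sub>\<infinity>y. f y * g (x - y) * tilt \<alpha> x)" for x
    unfolding conv_def by (rule infsum_cmult_left'[symmetric])
  show "tilt_summable (conv f g) \<alpha>"
    using summable_on_Sigma_banach[OF S] by (simp add: tilt_summable_def c1)
  have nS: "(\<lambda>(x, y). complex_of_real (f y * g (x - y) * tilt \<alpha> x) * ?c x) summable_on UNIV \<times> UNIV"
    by (rule abs_summable_summable, rule Infinite_Sum.abs_summable_on_comparison_test'[OF S])
      (use f g in \<open>auto simp: norm_mult\<close>)
  have "fourier (conv f g) \<alpha> \<theta> = (\<Sum>\<^sub>\<infinity>x. \<Sum>\<^sub>\<infinity>y. complex_of_real (f y * g (x - y) * tilt \<alpha> x) * ?c x)"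
    unfolding fourier_def c1
    by (intro infsum_cong) (simp only: infsum_of_real[OF S1, symmetric] infsum_cmult_left'[symmetric])
  also have "\<dots> = (\<Sum>\<^sub>\<infinity>(x, y)\<in>UNIV \<times> UNIV. complex_of_real (f y * g (x - y) * tilt \<alpha> x) * ?c x)"
    by (rule infsum_Sigma'_banach[OF nS])
  also have "\<dots> = (\<Sum>\<^sub>\<infinity>u\<in>UNIV \<times> UNIV. (\<lambda>(y, z). (complex_of_real (?F y) * ?c y) * (complex_of_real (?G z) * ?c z))
      ((\<lambda>(x, y). (y, x - y)) u))"
  proof (intro infsum_cong, clarify)
    fix x y :: "int ^ 'a"
    have "?c x = ?c y * ?c (x - y)"
      by (simp add: cis_mult vreal_diff inner_diff_right)
    then show "complex_of_real (f y * g (x - y) * tilt \<alpha> x) * ?c x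
       = complex_of_real (?F y) * ?c y * (complex_of_real (?G (x - y)) * ?c (x - y))"
      unfolding eq[symmetric] by simp
  qed
  also have "\<dots> = (\<Sum>\<^sub>\<infinity>(y, z)\<in>UNIV \<times> UNIV. (complex_of_real (?F y) * ?c y) * (complex_of_real (?G z) * ?c z))"
    by (rule infsum_reindex_bij_betw[OF bij])
  also have "\<dots> = (\<Sum>\<^sub>\<infinity>y. \<Sum>\<^sub>\<infinity>z. (complex_of_real (?F y) * ?c y) * (complex_of_real (?G z) * ?c z))"
    by (rule infsum_Sigma'_banach[symmetric], rule abs_summable_summable, rule Infinite_Sum.abs_summable_on_comparison_test'[OF FG])
      (use f g in \<open>auto simp: norm_mult\<close>)
  also have "\<dots> = fourier f \<alpha> \<theta> * fourier g \<alpha> \<theta>"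
    unfolding fourier_def by (simp only: infsum_cmult_left' infsum_cmult_right')
  finally show "fourier (conv f g) \<alpha> \<theta> = fourier f \<alpha> \<theta> * fourier g \<alpha> \<theta>" .
qed

lemma laplace_conv:
  assumes "\<And>x. f x \<ge> 0" "\<And>x. g x \<ge> 0" "tilt_summable f \<alpha>" "tilt_summable g \<alpha>"
  shows "laplace (conv f g) \<alpha> = laplace f \<alpha> * laplace g \<alpha>"
  using fourier_conv[OF assms, of 0] tilt_summable_conv[OF assms]
  by (simp add: fourier_0 assms flip: of_real_mult)

lemma conv_nonneg: "(\<And>x. f x \<ge> 0) \<Longrightarrow> (\<And>x. g x \<ge> 0) \<Longrightarrow> conv f g x \<ge> 0"
  unfolding conv_def by (intro infsum_nonneg) auto

lemma conv_ge_term: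
  assumes "\<And>x. f x \<ge> 0" "\<And>x. g x \<ge> 0" "(\<lambda>y. f y * g (x - y)) summable_on UNIV"
  shows "f y * g (x - y) \<le> conv f g x"
proof -
  have "(\<Sum>\<^sub>\<infinity>y\<in>{y}. f y * g (x - y)) \<le> conv f g x"
    unfolding conv_def using assms by (intro infsum_mono2) auto
  then show ?thesis by simp
qed

text \<open>Fubini over pairs of an index and a lattice point. Summability of the total tilted
  masses gives summability of the double family, and from it all three claims.\<close>

lemma
  fixes f :: "nat \<Rightarrow> int ^ 'd \<Rightarrow> real"
  assumes f: "\<And>n x. f n x \<ge> 0" and s: "\<And>n. tilt_summable (f n) \<alpha>"
    and S: "summable (\<lambda>n. laplace (f n) \<alpha>)"
  shows tilt_summable_suminf: "tilt_summable (\<lambda>x. \<Sum>n. f n x) \<alpha>"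
    and fourier_suminf: "(\<lambda>n. fourier (f n) \<alpha> \<theta>) sums fourier (\<lambda>x. \<Sum>n. f n x) \<alpha> \<theta>"
    and summable_of_laplace: "summable (\<lambda>n. f n x)"
proof -
  have T: "(\<lambda>(n, x). f n x * tilt \<alpha> x) summable_on UNIV \<times> UNIV"
  proof (rule summable_on_SigmaI[where g = "\<lambda>n. laplace (f n) \<alpha>"])
    show "((\<lambda>y. case (n, y) of (n, x) \<Rightarrow> f n x * tilt \<alpha> x) has_sum laplace (f n) \<alpha>) UNIV" for n
      using has_sum_infsum[OF s[of n, unfolded tilt_summable_def]] by (simp add: laplace_def)
    show "(\<lambda>n. laplace (f n) \<alpha>) summable_on UNIV"
      using S by (intro summable_nonneg_imp_summable_on laplace_nonneg f)
  qed (use f in auto)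
  have T': "(\<lambda>(x, n). f n x * tilt \<alpha> x) summable_on UNIV \<times> UNIV"
    using T[THEN summable_on_swap[THEN iffD1]] by simp
  have T1: "(\<lambda>n. f n x * tilt \<alpha> x) summable_on UNIV" for x
    using summable_on_SigmaD1[OF T', of x] by simp
  have sm: "summable (\<lambda>n. f n x * tilt \<alpha> x)" for x
    using T1[of x] f by (subst (asm) summable_on_UNIV_nonneg_real_iff) auto
  show sm': "summable (\<lambda>n. f n x)" for x
    using summable_mult2[OF sm[of x], of "1 / tilt \<alpha> x"] by simp
  have eq: "(\<Sum>n. f n x) * tilt \<alpha> x = (\<Sum>\<^sub>\<infinity>n. f n x * tilt \<alpha> x)" for x
    using suminf_mult2[OF sm'[of x], of "tilt \<alpha> x"] 
      sums_nonneg_imp_has_sum[OF summable_sums[OF sm[of x]]] f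
    by (simp add: infsumI)
  show "tilt_summable (\<lambda>x. \<Sum>n. f n x) \<alpha>"
    using summable_on_Sigma_banach[OF T'] by (simp add: tilt_summable_def eq)
  have nT: "(\<lambda>(x, n). complex_of_real (f n x * tilt \<alpha> x) * cis (\<theta> \<bullet> vreal x)) summable_on UNIV \<times> UNIV"
    by (rule abs_summable_summable, rule Infinite_Sum.abs_summable_on_comparison_test'[OF T'])
      (use f in \<open>auto simp: norm_mult\<close>)
  have nT': "(\<lambda>(n, x). complex_of_real (f n x * tilt \<alpha> x) * cis (\<theta> \<bullet> vreal x)) summable_on UNIV \<times> UNIV"
    using nT[THEN summable_on_swap[THEN iffD1]] by simp
  have "fourier (\<lambda>x. \<Sum>n. f n x) \<alpha> \<theta> = (\<Sum>\<^sub>\<infinity>x. \<Sum>\<^sub>\<infinity>n. complex_of_real (f n x * tilt \<alpha> x) * cis (\<theta> \<bullet> vreal x))"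
    unfolding fourier_def eq
    by (intro infsum_cong) (simp only: infsum_of_real[OF T1, symmetric] infsum_cmult_left'[symmetric])
  also have "\<dots> = (\<Sum>\<^sub>\<infinity>n. fourier (f n) \<alpha> \<theta>)"
    unfolding fourier_def by (rule infsum_swap_banach[OF nT])
  finally have "((\<lambda>n. fourier (f n) \<alpha> \<theta>) has_sum fourier (\<lambda>x. \<Sum>n. f n x) \<alpha> \<theta>) UNIV"
    using summable_on_Sigma_banach[OF nT'] by (simp add: fourier_def)
  then show "(\<lambda>n. fourier (f n) \<alpha> \<theta>) sums fourier (\<lambda>x. \<Sum>n. f n x) \<alpha> \<theta>"
    by (rule has_sum_imp_sums)
qed

section \<open>Fourier inversion\<close>

definition torus :: "(real ^ 'd) set" where
  "torus = cbox (\<chi> k. - pi) (\<chi> k. pi)"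

lemma mem_torus: "\<theta> \<in> torus \<longleftrightarrow> (\<forall>k. \<bar>\<theta> $ k\<bar> \<le> pi)"
  by (auto simp: torus_def mem_box_cart abs_le_iff) (metis minus_le_iff)+

lemma torus_measurable [measurable]: "torus \<in> sets borel"
  by (simp add: torus_def)

lemma lborel_integral_prod:
  fixes f :: "'a::euclidean_space \<Rightarrow> real \<Rightarrow> complex"
  assumes "\<And>b. b \<in> Basis \<Longrightarrow> integrable lborel (f b)"
  shows "(\<integral>x. (\<Prod>b\<in>Basis. f b (x \<bullet> b)) \<partial>lborel) = (\<Prod>b\<in>Basis. \<integral>t. f b t \<partial>lborel)"
proof -
  interpret product_sigma_finite "\<lambda>_::'a. lborel :: real measure" by standard
  have [measurable]: "f b \<in> borel_measurable borel" if "b \<in> Basis" for b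
    using assms[OF that] by simp
  have "(\<integral>x. (\<Prod>b\<in>Basis. f b (x \<bullet> b)) \<partial>lborel)
      = (\<integral>x. (\<Prod>b\<in>Basis. f b (x \<bullet> b)) \<partial>distr (\<Pi>\<^sub>M b\<in>Basis. lborel) borel (\<lambda>g. \<Sum>b\<in>Basis. g b *\<^sub>R b))"
    by (simp flip: lborel_eq)
  also have "\<dots> = (\<integral>g. (\<Prod>b\<in>Basis. f b (g b)) \<partial>(\<Pi>\<^sub>M b\<in>(Basis::'a set). lborel))"
    by (subst integral_distr) (auto intro!: Bochner_Integration.integral_cong prod.cong)
  also have "\<dots> = (\<Prod>b\<in>Basis. \<integral>t. f b t \<partial>lborel)"
    using assms by (intro product_integral_prod) auto
  finally show ?thesis .
qed

lemma lborel_integrable_prod: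
  fixes f :: "'a::euclidean_space \<Rightarrow> real \<Rightarrow> real"
  assumes "\<And>b. b \<in> Basis \<Longrightarrow> integrable lborel (f b)"
  shows "integrable lborel (\<lambda>x. \<Prod>b\<in>Basis. f b (x \<bullet> b))"
proof -
  interpret product_sigma_finite "\<lambda>_::'a. lborel :: real measure" by standard
  have [measurable]: "f b \<in> borel_measurable borel" if "b \<in> Basis" for b
    using assms[OF that] by simp
  have "integrable (\<Pi>\<^sub>M b\<in>(Basis::'a set). lborel) (\<lambda>g. \<Prod>b\<in>Basis. f b (g b))"
    using assms by (intro product_integrable_prod) auto
  also have "(\<lambda>g. \<Prod>b\<in>Basis. f b (g b)) = (\<lambda>g. \<Prod>b\<in>Basis. f b ((\<Sum>b\<in>Basis. g b *\<^sub>R b) \<bullet> b))"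
    by (auto intro!: prod.cong)
  finally have "integrable (distr (\<Pi>\<^sub>M b\<in>(Basis::'a set). lborel) borel (\<lambda>g. \<Sum>b\<in>Basis. g b *\<^sub>R b)) (\<lambda>x. \<Prod>b\<in>Basis. f b (x \<bullet> b))"
    by (subst integrable_distr_eq) auto
  then show ?thesis
    by (simp flip: lborel_eq)
qed

lemma cis_measurable [measurable]: "cis \<in> borel_measurable borel"
  by (intro borel_measurable_continuous_onI continuous_intros)

lemma integral_cis_int:
  "(\<integral>t. indicator {-pi..pi} t *\<^sub>R cis (t * of_int n) \<partial>lborel) = (if n = 0 then of_real (2 * pi) else 0)"
proof (cases "n = 0")
  case True
  then show ?thesis
    by (simp add: scaleR_conv_of_real)
next
  case False
  have "(\<integral>t. indicator {-pi..pi} t *\<^sub>R cis (t * of_int n) \<partial>lborel)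
      = (- \<i> / of_int n) * cis (pi * of_int n) - (- \<i> / of_int n) * cis (- pi * of_int n)"
  proof (rule integral_FTC_atLeastAtMost)
    fix t :: real
    have "((\<lambda>t. (- \<i> / of_int n) * cis (t * of_int n)) has_vector_derivative
        (- \<i> / of_int n) * (of_int n * (\<i> * cis (t * of_int n)))) (at t within {-pi..pi})"
      by (auto intro!: derivative_eq_intros simp: has_vector_derivative_def scaleR_conv_of_real algebra_simps)
    then show "((\<lambda>t. (- \<i> / of_int n) * cis (t * of_int n)) has_vector_derivative cis (t * of_int n)) (at t within {-pi..pi})"
      using False by simp
  qed (auto intro!: continuous_intros)
  also have "cis (- pi * of_int n) = cis (pi * of_int n)"
    by (auto simp: complex_eq_iff sin_zero_iff_int2 mult.commute[of pi])
  finally show ?thesis using False by simp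
qed

lemma integral_torus_cis:
  fixes y :: "int ^ 'd"
  shows "(\<integral>\<theta>. indicator torus \<theta> *\<^sub>R cis (\<theta> \<bullet> vreal y) \<partial>lborel) = (if y = 0 then of_real ((2 * pi) ^ CARD('d)) else 0)"
proof -
  \<comment> \<open>The floor changes nothing, since the coordinates of \<open>vreal y\<close> are
    integers; it supplies the integer that \<open>integral_cis_int\<close> expects when the product
    runs over \<open>Basis\<close>.\<close>
  have eq: "indicator torus \<theta> *\<^sub>R cis (\<theta> \<bullet> vreal y) =
     (\<Prod>b\<in>Basis. indicator {-pi..pi} (\<theta> \<bullet> b) *\<^sub>R cis ((\<theta> \<bullet> b) * of_int \<lfloor>vreal y \<bullet> b\<rfloor>))" for \<theta> :: "real ^ 'd"
  proof -
    have fl: "of_int \<lfloor>vreal y \<bullet> b\<rfloor> = vreal y \<bullet> b" if "b \<in> Basis" for b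
      using that by (auto simp: Basis_vec_def inner_axis)
    have "(\<Prod>b\<in>Basis. cis ((\<theta> \<bullet> b) * of_int \<lfloor>vreal y \<bullet> b\<rfloor>)) = (\<Prod>b\<in>Basis. cis ((\<theta> \<bullet> b) * (vreal y \<bullet> b)))"
      by (intro prod.cong refl) (simp only: fl)
    also have "\<dots> = cis (\<Sum>b\<in>Basis. (\<theta> \<bullet> b) * (vreal y \<bullet> b))"
      by (simp add: cis_conv_exp exp_sum sum_distrib_left)
    also have "\<dots> = cis (\<theta> \<bullet> vreal y)"
      by (simp only: euclidean_inner[symmetric])
    finally have "(\<Prod>b\<in>Basis. cis ((\<theta> \<bullet> b) * of_int \<lfloor>vreal y \<bullet> b\<rfloor>)) = cis (\<theta> \<bullet> vreal y)" .
    moreover have "(indicator torus \<theta> :: real) = (\<Prod>b\<in>Basis. indicator {-pi..pi} (\<theta> \<bullet> b))"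
    proof -
      have "(\<Prod>b\<in>(Basis::(real^'d) set). indicator {-pi..pi} (\<theta> \<bullet> b) :: real) = (if \<forall>b\<in>(Basis::(real^'d) set). \<theta> \<bullet> b \<in> {-pi..pi} then 1 else 0)"
        by (auto simp: indicator_def)
      also have "(\<forall>b\<in>(Basis::(real^'d) set). \<theta> \<bullet> b \<in> {-pi..pi}) \<longleftrightarrow> \<theta> \<in> torus"
        by (auto simp: mem_torus Basis_vec_def inner_axis abs_le_iff minus_le_iff)
      finally show ?thesis by (simp add: indicator_def)
    qed
    ultimately show ?thesis
      by (simp add: scaleR_conv_of_real prod.distrib of_real_prod)
  qed
  have int: "integrable lborel (\<lambda>t. indicator {-pi..pi} t *\<^sub>R cis (t * of_int n))" for n :: int
    by (rule borel_integrable_compact[of "{-pi..pi}", simplified]) (auto intro!: continuous_intros)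
  have "(\<integral>\<theta>. indicator torus \<theta> *\<^sub>R cis (\<theta> \<bullet> vreal y) \<partial>lborel)
      = (\<Prod>b\<in>(Basis::(real^'d) set). if \<lfloor>vreal y \<bullet> b\<rfloor> = 0 then of_real (2 * pi) else 0)"
    unfolding eq by (subst lborel_integral_prod[OF int]) (simp only: integral_cis_int)
  also have "\<dots> = (if y = 0 then of_real ((2 * pi) ^ CARD('d)) else 0)"
  proof (cases "y = 0")
    case False
    then obtain k where "y $ k \<noteq> 0" by (auto simp: vec_eq_iff)
    then have "\<lfloor>vreal y \<bullet> axis k 1\<rfloor> \<noteq> 0" "axis k 1 \<in> (Basis :: (real^'d) set)"
      by (auto simp: inner_axis axis_in_Basis_iff)
    then have "\<exists>b\<in>(Basis::(real^'d) set). (if \<lfloor>vreal y \<bullet> b\<rfloor> = 0 then complex_of_real (2 * pi) else 0) = 0"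
      by (intro bexI[of _ "axis k 1"]) auto
    then show ?thesis using False by (subst prod_zero) auto
  qed simp
  finally show ?thesis .
qed

lemma continuous_fourier:
  assumes "\<And>x. f x \<ge> 0" "tilt_summable f \<alpha>"
  shows "continuous_on A (fourier f \<alpha>)"
  unfolding continuous_on_sequentially fourier_def comp_def
  by (intro allI ballI impI infsum_dominated_convergence[where w = "\<lambda>x. f x * tilt \<alpha> x"])
    (use assms in \<open>auto intro!: tendsto_intros simp: norm_mult tilt_summable_def\<close>)

lemma fourier_measurable [measurable]:
  assumes "\<And>x. f x \<ge> 0" "tilt_summable f \<alpha>"
  shows "fourier f \<alpha> \<in> borel_measurable borel"
  using continuous_fourier[OF assms, of UNIV] by (rule borel_measurable_continuous_onI)

text \<open>Fubini and the orthogonality of characters on the torus, applied to the function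
  \<open>f\<close> times its tilt.\<close>

theorem fourier_inversion:
  fixes f :: "int ^ 'd \<Rightarrow> real"
  assumes f: "\<And>x. f x \<ge> 0" and s: "tilt_summable f \<alpha>"
  shows "of_real ((2 * pi) ^ CARD('d) * (f x * tilt \<alpha> x)) =
    (\<integral>\<theta>. indicator torus \<theta> *\<^sub>R (cis (- (\<theta> \<bullet> vreal x)) * fourier f \<alpha> \<theta>) \<partial>lborel)"
proof -
  let ?t = "\<lambda>y \<theta>. indicator torus \<theta> *\<^sub>R (complex_of_real (f y * tilt \<alpha> y) * cis (\<theta> \<bullet> vreal (y - x)))"
  interpret sigma_finite_measure "count_space (UNIV :: (int ^ 'd) set)"
    by (rule sigma_finite_measure_count_space)
  interpret pair_sigma_finite "count_space (UNIV :: (int ^ 'd) set)" "lborel :: (real ^ 'd) measure"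
    by standard
  have sumf: "integrable (count_space UNIV) (\<lambda>y. f y * tilt \<alpha> y)"
    using s abs_summable_equivalent[of "\<lambda>y. f y * tilt \<alpha> y" UNIV]
    summable_on_iff_abs_summable_on_real[of "\<lambda>y. f y * tilt \<alpha> y" UNIV]
    by (simp add: Infinite_Set_Sum.abs_summable_on_def tilt_summable_def)
  have torus_int: "integrable lborel (indicator torus :: real ^ 'd \<Rightarrow> real)"
    unfolding torus_def
    using emeasure_lborel_cbox_finite[of "(\<chi> k. - pi) :: real ^ 'd" "\<chi> k. pi"]
    by (intro integrable_real_indicator) (simp_all only: infinity_ennreal_def sets_lborel borel_closed closed_cbox)
  have tint: "integrable lborel (?t y)" for y
  proof (rule Bochner_Integration.integrable_bound[OF integrable_mult_left[OF torus_int, of "f y * tilt \<alpha> y"]])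
    show "?t y \<in> borel_measurable lborel"
      by measurable
  qed (use f in \<open>auto simp: norm_mult\<close>)
  have "integrable (count_space UNIV \<Otimes>\<^sub>M lborel) (case_prod ?t)"
  proof (rule Fubini_integrable)
    show "case_prod ?t \<in> borel_measurable (count_space UNIV \<Otimes>\<^sub>M lborel)"
      by (rule measurable_pair_measure_countable1) auto
    have "(\<lambda>y. \<integral>\<theta>. norm (case (y, \<theta>) of (y, \<theta>) \<Rightarrow> ?t y \<theta>) \<partial>lborel) = (\<lambda>y. f y * tilt \<alpha> y * measure lborel (torus :: (real^'d) set))"
      using f by (auto simp: norm_mult)
    then show "integrable (count_space UNIV) (\<lambda>y. \<integral>\<theta>. norm (case (y, \<theta>) of (y, \<theta>) \<Rightarrow> ?t y \<theta>) \<partial>lborel)"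
      using sumf by simp
    show "AE y in count_space UNIV. integrable lborel (\<lambda>\<theta>. case (y, \<theta>) of (y, \<theta>) \<Rightarrow> ?t y \<theta>)"
      using tint by simp
  qed
  from Fubini_integral[OF this]
  have "(\<integral>\<theta>. (\<integral>y. ?t y \<theta> \<partial>count_space UNIV) \<partial>lborel) = (\<integral>y. (\<integral>\<theta>. ?t y \<theta> \<partial>lborel) \<partial>count_space UNIV)"
    by simp
  also have "(\<lambda>\<theta>. \<integral>y. ?t y \<theta> \<partial>count_space UNIV) = (\<lambda>\<theta>. indicator torus \<theta> *\<^sub>R (cis (- (\<theta> \<bullet> vreal x)) * fourier f \<alpha> \<theta>))"
  proof
    fix \<theta> :: "real ^ 'd"
    have "Infinite_Set_Sum.abs_summable_on (\<lambda>y. complex_of_real (f y * tilt \<alpha> y) * cis (\<theta> \<bullet> vreal y)) UNIV"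
      using fourier_abs_summable[OF s] abs_summable_equivalent by blast
    from infsetsum_infsum[OF this]
    have "fourier f \<alpha> \<theta> = (\<integral>y. complex_of_real (f y * tilt \<alpha> y) * cis (\<theta> \<bullet> vreal y) \<partial>count_space UNIV)"
      by (simp add: fourier_def infsetsum_def)
    moreover have "cis (\<theta> \<bullet> vreal (y - x)) = cis (- (\<theta> \<bullet> vreal x)) * cis (\<theta> \<bullet> vreal y)" for y
      by (simp add: cis_mult vreal_diff inner_diff_right)
    ultimately show "(\<integral>y. ?t y \<theta> \<partial>count_space UNIV) = indicator torus \<theta> *\<^sub>R (cis (- (\<theta> \<bullet> vreal x)) * fourier f \<alpha> \<theta>)"
      by (simp add: mult.left_commute[of _ "cis _"])
  qed
  also have "(\<integral>y. (\<integral>\<theta>. ?t y \<theta> \<partial>lborel) \<partial>count_space UNIV)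
      = (\<integral>y. (if y = x then of_real ((2 * pi) ^ CARD('d) * (f x * tilt \<alpha> x)) else 0) \<partial>count_space UNIV)"
  proof (rule Bochner_Integration.integral_cong[OF refl])
    fix y
    have "(\<integral>\<theta>. ?t y \<theta> \<partial>lborel) = of_real (f y * tilt \<alpha> y) * (\<integral>\<theta>. indicator torus \<theta> *\<^sub>R cis (\<theta> \<bullet> vreal (y - x)) \<partial>lborel)"
      by (subst integral_mult_right_zero[symmetric]) (simp add: mult_scaleR_right)
    then show "(\<integral>\<theta>. ?t y \<theta> \<partial>lborel) = (if y = x then of_real ((2 * pi) ^ CARD('d) * (f x * tilt \<alpha> x)) else 0)"
      by (simp add: integral_torus_cis mult.commute)
  qed
  also have "\<dots> = (\<integral>y. indicator {x} y *\<^sub>R complex_of_real ((2 * pi) ^ CARD('d) * (f x * tilt \<alpha> x)) \<partial>count_space UNIV)"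
    by (intro Bochner_Integration.integral_cong) (auto simp: indicator_def)
  also have "\<dots> = of_real ((2 * pi) ^ CARD('d) * (f x * tilt \<alpha> x))"
    by (subst integral_scaleR_left) (auto simp: scaleR_conv_of_real)
  finally show ?thesis by simp
qed

text \<open>Agreement at one single tilt is enough. This is how the Green function of the process is
  identified with that of the excursion walk.\<close>

lemma fourier_eq_imp_eq:
  assumes "\<And>x. f x \<ge> 0" "tilt_summable f \<alpha>" "\<And>x. g x \<ge> 0" "tilt_summable g \<alpha>"
    and "\<And>\<theta>. fourier f \<alpha> \<theta> = fourier g \<alpha> \<theta>"
  shows "f x = g x"
proof -
  have "complex_of_real ((2 * pi) ^ CARD('a) * (f x * tilt \<alpha> x)) = of_real ((2 * pi) ^ CARD('a) * (g x * tilt \<alpha> x))"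
    unfolding fourier_inversion[OF assms(1,2)] fourier_inversion[OF assms(3,4)] assms(5) ..
  then show ?thesis
    unfolding of_real_eq_iff by simp
qed

section \<open>Exponential domination and continuity in the tilt\<close>

definition exp_dominated :: "(int ^ 'd \<Rightarrow> real) \<Rightarrow> real ^ 'd \<Rightarrow> real \<Rightarrow> bool" where
  "exp_dominated f \<alpha> \<delta> \<longleftrightarrow> (\<lambda>x. f x * tilt \<alpha> x * exp (\<delta> * norm (vreal x))) summable_on UNIV"

text \<open>By Cauchy-Schwarz. Hence the family summed in \<open>exp_dominated\<close> is a common
  majorant for all tilts within distance \<open>\<delta>\<close> of \<open>\<alpha>\<close>.\<close>

lemma tilt_le_exp_norm: "norm (\<beta> - \<alpha>) \<le> \<delta> \<Longrightarrow> tilt \<beta> x \<le> tilt \<alpha> x * exp (\<delta> * norm (vreal x))"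
proof -
  assume "norm (\<beta> - \<alpha>) \<le> \<delta>"
  then have "(\<beta> - \<alpha>) \<bullet> vreal x \<le> \<delta> * norm (vreal x)"
    using norm_cauchy_schwarz[of "\<beta> - \<alpha>" "vreal x"] by (meson dual_order.trans mult_right_mono norm_ge_zero)
  then show ?thesis
    by (simp add: tilt_def exp_add[symmetric] inner_diff_left)
qed

lemma exp_dominated_mono:
  assumes "\<And>x. f x \<ge> 0" "exp_dominated f \<alpha> \<delta>" "norm (\<beta> - \<alpha>) + \<epsilon> \<le> \<delta>"
  shows "exp_dominated f \<beta> \<epsilon>"
  unfolding exp_dominated_def
proof (rule summable_on_comparison_test[OF assms(2)[unfolded exp_dominated_def]])
  fix x
  have "tilt \<beta> x * exp (\<epsilon> * norm (vreal x)) \<le> tilt \<alpha> x * exp ((\<delta> - \<epsilon>) * norm (vreal x)) * exp (\<epsilon> * norm (vreal x))"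
    using assms(3) by (intro mult_right_mono tilt_le_exp_norm) auto
  also have "\<dots> = tilt \<alpha> x * exp (\<delta> * norm (vreal x))"
    by (simp add: exp_add[symmetric] algebra_simps)
  finally show "f x * tilt \<beta> x * exp (\<epsilon> * norm (vreal x)) \<le> f x * tilt \<alpha> x * exp (\<delta> * norm (vreal x))"
    using assms(1)[of x] by (simp add: mult.assoc mult_left_mono)
qed (use assms in auto)

lemma exp_dominated_0: "exp_dominated f \<alpha> 0 \<longleftrightarrow> tilt_summable f \<alpha>"
  by (simp add: exp_dominated_def tilt_summable_def)

lemma exp_dominated_tilt_summable:
  "(\<And>x. f x \<ge> 0) \<Longrightarrow> exp_dominated f \<alpha> \<delta> \<Longrightarrow> norm (\<beta> - \<alpha>) \<le> \<delta> \<Longrightarrow> tilt_summable f \<beta>"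
  using exp_dominated_mono[of f \<alpha> \<delta> \<beta> 0] by (simp add: exp_dominated_0)

text \<open>The finitely many tilts at distance \<open>\<eta>\<close> along the coordinate axes
  already dominate a small exponential of the norm, because the norm is at most the dimension times
  the largest coordinate. That factor is the reason for dividing \<open>\<eta>\<close> by the
  dimension.\<close>

lemma exp_dominatedI:
  fixes f :: "int ^ 'd \<Rightarrow> real"
  assumes f: "\<And>x. f x \<ge> 0" and "\<delta> > 0" and s: "\<And>\<beta>. norm (\<beta> - \<alpha>) < \<delta> \<Longrightarrow> tilt_summable f \<beta>"
  shows "\<exists>\<epsilon>>0. exp_dominated f \<alpha> \<epsilon>"
proof -
  define \<eta> where "\<eta> = \<delta> / 2"
  define \<epsilon> where "\<epsilon> = \<eta> / real CARD('d)"
  have pos: "\<eta> > 0" "\<epsilon> > 0" "\<eta> < \<delta>"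
    using \<open>\<delta> > 0\<close> by (auto simp: \<eta>_def \<epsilon>_def)
  let ?g = "\<lambda>x. \<Sum>k\<in>UNIV. f x * tilt (\<alpha> + axis k \<eta>) x + f x * tilt (\<alpha> - axis k \<eta>) x"
  have "tilt_summable f (\<alpha> + axis k \<eta>)" "tilt_summable f (\<alpha> - axis k \<eta>)" for k
    using pos by (auto intro!: s simp: norm_eq_sqrt_inner inner_axis_axis)
  then have "(\<lambda>x. f x * tilt (\<alpha> + axis k \<eta>) x + f x * tilt (\<alpha> - axis k \<eta>) x) summable_on UNIV" for k
    by (auto simp: tilt_summable_def intro!: summable_on_add)
  then have "?g summable_on UNIV"
  proof -
    assume *: "\<And>k. (\<lambda>x. f x * tilt (\<alpha> + axis k \<eta>) x + f x * tilt (\<alpha> - axis k \<eta>) x) summable_on UNIV"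
    have "(\<lambda>x. \<Sum>k\<in>K. f x * tilt (\<alpha> + axis k \<eta>) x + f x * tilt (\<alpha> - axis k \<eta>) x) summable_on UNIV" if "finite K" for K
      using that by (induction K rule: finite_induct) (auto intro!: summable_on_add[OF *])
    then show ?thesis by simp
  qed
  then have "exp_dominated f \<alpha> \<epsilon>"
    unfolding exp_dominated_def
  proof (rule summable_on_comparison_test)
    fix x :: "int ^ 'd"
    obtain k where k: "\<And>l. \<bar>vreal x $ l\<bar> \<le> \<bar>vreal x $ k\<bar>"
      using Max_in[of "range (\<lambda>l. \<bar>vreal x $ l\<bar>)"] Max_ge[of "range (\<lambda>l. \<bar>vreal x $ l\<bar>)"]
      by (metis (mono_tags, lifting) UNIV_not_empty empty_is_image finite finite_imageI imageE rangeI)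
    have "norm (vreal x) \<le> (\<Sum>l\<in>UNIV. \<bar>vreal x $ l\<bar>)"
      by (rule norm_le_l1_cart)
    also have "\<dots> \<le> real CARD('d) * \<bar>vreal x $ k\<bar>"
      using sum_bounded_above[of UNIV "\<lambda>l. \<bar>vreal x $ l\<bar>", OF k] by simp
    finally have "\<epsilon> * norm (vreal x) \<le> \<eta> * \<bar>vreal x $ k\<bar>"
      using pos by (simp add: \<epsilon>_def field_simps)
    then have "exp (\<epsilon> * norm (vreal x)) \<le> exp (\<eta> * \<bar>vreal x $ k\<bar>)"
      by simp
    also have "\<dots> \<le> exp (\<eta> * vreal x $ k) + exp (- (\<eta> * vreal x $ k))"
      by (cases "vreal x $ k \<ge> 0") (auto simp: abs_if)
    finally have "f x * tilt \<alpha> x * exp (\<epsilon> * norm (vreal x)) \<le>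
       f x * tilt \<alpha> x * (exp (\<eta> * vreal x $ k) + exp (- (\<eta> * vreal x $ k)))"
      using f by (intro mult_left_mono) auto
    also have "\<dots> = f x * tilt (\<alpha> + axis k \<eta>) x + f x * tilt (\<alpha> - axis k \<eta>) x"
      by (simp add: tilt_def inner_add_left inner_diff_left inner_axis' exp_add exp_diff exp_minus field_simps)
    also have "\<dots> \<le> ?g x"
      using f by (intro member_le_sum) auto
    finally show "f x * tilt \<alpha> x * exp (\<epsilon> * norm (vreal x)) \<le> ?g x" .
  qed (use f in auto)
  then show ?thesis using pos by blast
qed

text \<open>The margin \<open>\<delta>\<close> is split evenly: one half pays for the moving tilt,
  the other for the growth of \<open>q\<close>.\<close>

lemma exp_dominated_tendsto:
  fixes q :: "nat \<Rightarrow> int ^ 'd \<Rightarrow> 'b::{banach, second_countable_topology}"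
  assumes f: "\<And>x. f x \<ge> 0" and dom: "exp_dominated f \<alpha> \<delta>" and "\<delta> > 0"
    and a: "a \<longlonglongrightarrow> \<alpha>" and q: "\<And>x. (\<lambda>k. q k x) \<longlonglongrightarrow> r x"
    and bound: "eventually (\<lambda>k. \<forall>x. norm (q k x) \<le> C * exp (\<delta> / 2 * norm (vreal x))) sequentially"
  shows "(\<lambda>k. \<Sum>\<^sub>\<infinity>x. (f x * tilt (a k) x) *\<^sub>R q k x) \<longlonglongrightarrow> (\<Sum>\<^sub>\<infinity>x. (f x * tilt \<alpha> x) *\<^sub>R r x)"
proof (rule infsum_dominated_convergence)
  show "(\<lambda>k. (f x * tilt (a k) x) *\<^sub>R q k x) \<longlonglongrightarrow> (f x * tilt \<alpha> x) *\<^sub>R r x" for x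
    unfolding tilt_def by (intro tendsto_intros a q)
  have "eventually (\<lambda>k. norm (a k - \<alpha>) \<le> \<delta> / 2) sequentially"
    using tendstoD[OF a, of "\<delta> / 2"] \<open>\<delta> > 0\<close> by (auto simp: dist_norm elim!: eventually_mono)
  with bound show "eventually (\<lambda>k. \<forall>x. norm ((f x * tilt (a k) x) *\<^sub>R q k x) \<le> C * (f x * tilt \<alpha> x * exp (\<delta> * norm (vreal x)))) sequentially"
  proof eventually_elim
    case (elim k)
    show ?case
    proof
      fix x
      have "norm ((f x * tilt (a k) x) *\<^sub>R q k x) = f x * (tilt (a k) x * norm (q k x))"
        using f by (simp add: abs_mult)
      also have "\<dots> \<le> f x * ((tilt \<alpha> x * exp (\<delta> / 2 * norm (vreal x))) * (C * exp (\<delta> / 2 * norm (vreal x))))"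
        using f elim by (intro mult_left_mono mult_mono tilt_le_exp_norm) auto
      also have "exp (\<delta> / 2 * norm (vreal x)) * exp (\<delta> / 2 * norm (vreal x)) = exp (\<delta> * norm (vreal x))"
        by (simp add: exp_add[symmetric])
      then have "f x * ((tilt \<alpha> x * exp (\<delta> / 2 * norm (vreal x))) * (C * exp (\<delta> / 2 * norm (vreal x)))) = C * (f x * tilt \<alpha> x * exp (\<delta> * norm (vreal x)))"
        by (simp add: mult.assoc mult.left_commute)
      finally show "norm ((f x * tilt (a k) x) *\<^sub>R q k x) \<le> C * (f x * tilt \<alpha> x * exp (\<delta> * norm (vreal x)))" .
    qed
  qed
  show "(\<lambda>x. C * (f x * tilt \<alpha> x * exp (\<delta> * norm (vreal x)))) summable_on UNIV"
    using dom unfolding exp_dominated_def by (rule summable_on_cmult_right)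
qed

lemma tendsto_fourier:
  assumes f: "\<And>x. f x \<ge> 0" and dom: "exp_dominated f \<alpha> \<delta>" and "\<delta> > 0"
    and a: "a \<longlonglongrightarrow> \<alpha>" and t: "t \<longlonglongrightarrow> \<theta>"
  shows "(\<lambda>k. fourier f (a k) (t k)) \<longlonglongrightarrow> fourier f \<alpha> \<theta>"
  unfolding fourier_def scaleR_conv_of_real[symmetric]
  by (rule exp_dominated_tendsto[OF f dom \<open>\<delta> > 0\<close> a, where C = 1])
    (use \<open>\<delta> > 0\<close> in \<open>auto intro!: tendsto_intros t always_eventually\<close>)

lemma tendsto_laplace:
  assumes f: "\<And>x. f x \<ge> 0" and dom: "exp_dominated f \<alpha> \<delta>" and "\<delta> > 0" and a: "a \<longlonglongrightarrow> \<alpha>"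
  shows "(\<lambda>k. laplace f (a k)) \<longlonglongrightarrow> laplace f \<alpha>"
  using exp_dominated_tendsto[OF f dom \<open>\<delta> > 0\<close> a, where C = 1 and q = "\<lambda>_ _. 1::real" and r = "\<lambda>_. 1"] \<open>\<delta> > 0\<close>
  by (simp add: laplace_def)

text \<open>One term of the exponential series. It trades polynomial factors for a small part of an
  exponential margin.\<close>

lemma power_le_exp:
  fixes s \<delta> :: real
  assumes "s \<ge> 0" "\<delta> > 0"
  shows "s ^ k \<le> fact k / \<delta> ^ k * exp (\<delta> * s)"
proof -
  have "(\<delta> * s) ^ k / fact k \<le> exp (\<delta> * s)"
    using sum_le_suminf[OF summable_exp_generic[of "\<delta> * s"], of "{k}"] assms
      sums_unique[OF exp_converges[of "\<delta> * s"]]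
    by (simp add: divide_inverse mult.commute)
  then show ?thesis
    using assms by (simp add: field_simps power_mult_distrib)
qed

section \<open>The sublevel set of the Laplace transform\<close>

lemma infsum_pos_imp_term_pos:
  fixes f :: "'a \<Rightarrow> real"
  assumes "infsum f A > 0"
  shows "\<exists>x\<in>A. f x > 0"
proof (rule ccontr)
  assume "\<not> ?thesis"
  then have "infsum (\<lambda>x. - f x) A \<ge> 0" by (intro infsum_nonneg) (auto simp: not_less)
  then have "infsum f A \<le> 0" by (simp add: infsum_uminus)
  with assms show False by simp
qed

lemma conv_pos_imp:
  assumes "\<And>x. f x \<ge> 0" "\<And>x. g x \<ge> 0" "conv f g x > 0"
  shows "\<exists>y. f y > 0 \<and> g (x - y) > 0"
  using infsum_pos_imp_term_pos[OF assms(3)[unfolded conv_def]] assms(1,2)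
  by (metis less_le mult_zero_left mult_zero_right order.strict_iff_order)

lemma exp_le_quadratic: "exp y \<le> 1 + y + y\<^sup>2 * exp \<bar>y\<bar>" for y :: real
proof -
  obtain t where t: "\<bar>t\<bar> \<le> \<bar>y\<bar>" "exp y = (\<Sum>m<2. y ^ m / fact m) + exp t / fact 2 * y ^ 2"
    using Maclaurin_exp_le[of y 2] by blast
  have "exp t \<le> exp \<bar>y\<bar>"
    using t(1) by simp
  then have "exp t / 2 \<le> exp \<bar>y\<bar>"
    using exp_gt_zero[of t] by linarith
  then have "exp t / 2 * y\<^sup>2 \<le> exp \<bar>y\<bar> * y\<^sup>2"
    by (intro mult_right_mono) auto
  then show ?thesis
    using t(2) by (simp add: numeral_2_eq_2 mult.commute)
qed

definition point :: "int ^ 'd \<Rightarrow> real" where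
  "point x = (if x = 0 then 1 else 0)"

lemma point_nonneg [simp]: "point x \<ge> 0"
  by (simp add: point_def)

lemma tilt_summable_point [simp]: "tilt_summable point \<alpha>"
  unfolding tilt_summable_def point_def
  by (rule summable_on_cong_neutral[THEN iffD1, OF _ _ _ summable_on_finite[of "{0}"]]) auto

lemma fourier_point [simp]: "fourier point \<alpha> \<theta> = 1"
proof -
  have "fourier point \<alpha> \<theta> = (\<Sum>\<^sub>\<infinity>x\<in>{0}. complex_of_real (point x * tilt \<alpha> x) * cis (\<theta> \<bullet> vreal x))"
    unfolding fourier_def by (intro infsum_cong_neutral) (auto simp: point_def)
  then show ?thesis by (simp add: point_def)
qed

lemma laplace_point [simp]: "laplace point \<alpha> = 1"
  using fourier_0[of point \<alpha>] by simp

lemma vreal_axis [simp]: "vreal (axis k z) = axis k (real_of_int z)"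
  by (simp add: vec_eq_iff axis_def)

section \<open>Convolution powers and lattice walks\<close>

locale nonneg_kernel =
  fixes \<nu> :: "int ^ 'd \<Rightarrow> real"
  assumes nu_nonneg [simp]: "\<nu> x \<ge> 0"
begin

lemma step_nonneg: "(\<And>x. f x \<ge> 0) \<Longrightarrow> (conv \<nu> ^^ n) f x \<ge> 0"
  by (induction n arbitrary: x) (auto intro!: conv_nonneg)

lemma
  assumes "\<And>x. f x \<ge> 0" "tilt_summable \<nu> \<alpha>" "tilt_summable f \<alpha>"
  shows tilt_summable_step: "tilt_summable ((conv \<nu> ^^ n) f) \<alpha>"
    and fourier_step: "fourier ((conv \<nu> ^^ n) f) \<alpha> \<theta> = fourier \<nu> \<alpha> \<theta> ^ n * fourier f \<alpha> \<theta>"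
proof (induction n)
  case 0
  { case 1 show ?case using assms by simp }
  { case 2 show ?case by simp }
next
  case (Suc n)
  { case 1 show ?case using Suc assms by (auto intro!: tilt_summable_conv step_nonneg) }
  { case 2 show ?case using Suc assms by (simp add: fourier_conv step_nonneg) }
qed

lemma laplace_step:
  assumes "\<And>x. f x \<ge> 0" "tilt_summable \<nu> \<alpha>" "tilt_summable f \<alpha>"
  shows "laplace ((conv \<nu> ^^ n) f) \<alpha> = laplace \<nu> \<alpha> ^ n * laplace f \<alpha>"
  using fourier_step[OF assms, of n 0] tilt_summable_step[OF assms, of n] assms
  by (simp add: fourier_0 flip: of_real_mult of_real_power)

end

text \<open>The kernel need not have mass one; only tilts matter. The function \<open>b\<close> is
  the weight convolved onto the walk, later the expected visits during an excursion.
  \<open>nu_dominated\<close> says that every point of convergence has a margin, \<open>nu_0\<close>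
  excludes periodicity, and \<open>drift\<close> states transience in tilted form.\<close>

locale lattice_walk = nonneg_kernel \<nu> for \<nu> :: "int ^ 'd \<Rightarrow> real" +
  fixes b :: "int ^ 'd \<Rightarrow> real"
  assumes b_nonneg [simp]: "b x \<ge> 0" and b_pos: "\<exists>x. b x > 0"
    and nu_dominated: "tilt_summable \<nu> \<alpha> \<Longrightarrow> \<exists>\<delta>>0. exp_dominated \<nu> \<alpha> \<delta>"
    and b_dominated: "tilt_summable \<nu> \<alpha> \<Longrightarrow> \<exists>\<delta>>0. exp_dominated b \<alpha> \<delta>"
    and nu_0: "\<nu> 0 > 0"
    and reach: "\<exists>n. (conv \<nu> ^^ n) point y > 0"
    and drift: "\<exists>\<alpha>. tilt_summable \<nu> \<alpha> \<and> laplace \<nu> \<alpha> < 1"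
begin

text \<open>Since \<open>\<nu> 0 > 0\<close> the walk may stand still, so a positive value stays
  positive at all later times.\<close>

lemma step_lazy:
  assumes "\<And>x. f x \<ge> 0" "\<And>\<alpha>. tilt_summable \<nu> \<alpha> \<Longrightarrow> tilt_summable f \<alpha>" "(conv \<nu> ^^ n) f y > 0"
  shows "(conv \<nu> ^^ (n + k)) f y > 0"
proof (induction k)
  case (Suc k)
  obtain \<alpha> where \<alpha>: "tilt_summable \<nu> \<alpha>" using drift by blast
  let ?g = "(conv \<nu> ^^ (n + k)) f"
  have "0 < \<nu> 0 * ?g (y - 0)"
    using Suc nu_0 by simp
  also have "\<dots> \<le> conv \<nu> ?g y"
    using assms(1,2) \<alpha>
    by (intro conv_ge_term conv_summable[where \<alpha> = \<alpha>]) (auto intro!: step_nonneg tilt_summable_step)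
  finally show ?case by simp
qed (use assms in auto)

text \<open>If the support lay in a hyperplane through 0, so would every point the walk reaches, yet
  it reaches all unit vectors. This is what makes the Laplace transform strictly convex.\<close>

lemma support_spans:
  assumes "\<gamma> \<noteq> 0"
  shows "\<exists>x. \<nu> x > 0 \<and> \<gamma> \<bullet> vreal x \<noteq> 0"
proof (rule ccontr)
  assume "\<not> ?thesis"
  then have *: "\<nu> x > 0 \<Longrightarrow> \<gamma> \<bullet> vreal x = 0" for x by blast
  have **: "(conv \<nu> ^^ n) point y > 0 \<Longrightarrow> \<gamma> \<bullet> vreal y = 0" for n y
  proof (induction n arbitrary: y)
    case 0
    then show ?case by (simp add: point_def split: if_splits)
  next
    case (Suc n)
    then obtain z where z: "\<nu> z > 0" "(conv \<nu> ^^ n) point (y - z) > 0"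
      using conv_pos_imp[of \<nu> "(conv \<nu> ^^ n) point" y] step_nonneg[of point] by auto
    then show ?case using *[OF z(1)] Suc.IH[OF z(2)] by (simp add: vreal_diff inner_diff_right)
  qed
  have "\<gamma> $ k = 0" for k
  proof -
    obtain n where "(conv \<nu> ^^ n) point (axis k 1) > 0" using reach by blast
    from **[OF this] show ?thesis by (simp add: inner_axis)
  qed
  with assms show False by (simp add: vec_eq_iff)
qed

section \<open>Geometry of the sublevel set\<close>

definition D :: "(real ^ 'd) set" where
  "D = {\<alpha>. tilt_summable \<nu> \<alpha> \<and> laplace \<nu> \<alpha> \<le> 1}"

text \<open>Formally the gradient of \<open>laplace \<nu>\<close> at \<open>\<alpha>\<close>; where
  the transform equals 1 it is the expectation of the tilted probability.\<close>

definition mean :: "real ^ 'd \<Rightarrow> real ^ 'd" where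
  "mean \<alpha> = (\<Sum>\<^sub>\<infinity>x. (\<nu> x * tilt \<alpha> x) *\<^sub>R vreal x)"

lemma mean_summable:
  assumes "tilt_summable \<nu> \<alpha>"
  shows "(\<lambda>x. (\<nu> x * tilt \<alpha> x) *\<^sub>R vreal x) summable_on UNIV"
proof -
  obtain \<delta> where d: "\<delta> > 0" "exp_dominated \<nu> \<alpha> \<delta>" using nu_dominated[OF assms] by blast
  show ?thesis
  proof (rule abs_summable_summable, rule Infinite_Sum.abs_summable_on_comparison_test')
    show "(\<lambda>x. 1 / \<delta> * (\<nu> x * tilt \<alpha> x * exp (\<delta> * norm (vreal x)))) summable_on UNIV"
      using d(2) unfolding exp_dominated_def by (rule summable_on_cmult_right)
    fix x
    have "\<nu> x * tilt \<alpha> x * norm (vreal x) \<le> \<nu> x * tilt \<alpha> x * (1 / \<delta> * exp (\<delta> * norm (vreal x)))"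
      using power_le_exp[of "norm (vreal x)" \<delta> 1] d(1) by (intro mult_left_mono) auto
    then show "norm ((\<nu> x * tilt \<alpha> x) *\<^sub>R vreal x) \<le> 1 / \<delta> * (\<nu> x * tilt \<alpha> x * exp (\<delta> * norm (vreal x)))"
      by (simp add: abs_mult)
  qed
qed

lemma inner_mean:
  assumes "tilt_summable \<nu> \<alpha>"
  shows "((\<lambda>x. \<nu> x * tilt \<alpha> x * (\<beta> \<bullet> vreal x)) has_sum (\<beta> \<bullet> mean \<alpha>)) UNIV"
  using has_sum_bounded_linear[OF bounded_linear_inner_right has_sum_infsum[OF mean_summable[OF assms]], of \<beta>]
  by (simp add: mean_def)

text \<open>Sum the inequality \<open>1 + y \<le> exp y\<close> against the tilted kernel; no
  differentiability enters.\<close>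

lemma laplace_tangent:
  assumes "tilt_summable \<nu> \<alpha>" "tilt_summable \<nu> (\<alpha> + \<beta>)"
  shows "laplace \<nu> \<alpha> + \<beta> \<bullet> mean \<alpha> \<le> laplace \<nu> (\<alpha> + \<beta>)"
proof (rule has_sum_mono[OF has_sum_add[OF _ inner_mean[OF assms(1)]]])
  show "((\<lambda>x. \<nu> x * tilt \<alpha> x) has_sum laplace \<nu> \<alpha>) UNIV" "((\<lambda>x. \<nu> x * tilt (\<alpha> + \<beta>) x) has_sum laplace \<nu> (\<alpha> + \<beta>)) UNIV"
    using assms unfolding laplace_def tilt_summable_def by (auto intro: has_sum_infsum)
  fix x
  have "\<nu> x * tilt \<alpha> x * (1 + \<beta> \<bullet> vreal x) \<le> \<nu> x * tilt \<alpha> x * exp (\<beta> \<bullet> vreal x)"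
    by (intro mult_left_mono) auto
  then show "\<nu> x * tilt \<alpha> x + \<nu> x * tilt \<alpha> x * (\<beta> \<bullet> vreal x) \<le> \<nu> x * tilt (\<alpha> + \<beta>) x"
    by (simp add: tilt_add_left ring_distribs mult.assoc) (simp add: tilt_def)
qed

text \<open>The constant \<open>K\<close> serves all \<open>\<alpha>\<close> near
  \<open>\<alpha>0\<close>. The margin \<open>3 * \<delta>\<close> is used up by three factors:
  moving \<open>\<alpha>\<close>, the exponential in the remainder, and the absorption of the square
  of the norm.\<close>

lemma laplace_taylor:
  assumes dom: "exp_dominated \<nu> \<alpha>0 (3 * \<delta>)" and "\<delta> > 0"
  shows "\<exists>K>0. \<forall>\<alpha> \<beta>. norm (\<alpha> - \<alpha>0) \<le> \<delta> \<longrightarrow> norm \<beta> \<le> \<delta> \<longrightarrow>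
    laplace \<nu> (\<alpha> + \<beta>) \<le> laplace \<nu> \<alpha> + \<beta> \<bullet> mean \<alpha> + K * (norm \<beta>)\<^sup>2"
proof -
  let ?w = "\<lambda>x. \<nu> x * tilt \<alpha>0 x * exp (3 * \<delta> * norm (vreal x))"
  define W where "W = infsum ?w UNIV"
  have W: "(?w has_sum W) UNIV"
    using dom unfolding exp_dominated_def W_def by (rule has_sum_infsum)
  have "W \<ge> 0" unfolding W_def by (intro infsum_nonneg) auto
  define K where "K = 2 / \<delta>\<^sup>2 * W + 1"
  have "K > 0" using \<open>W \<ge> 0\<close> by (simp add: K_def add_nonneg_pos)
  moreover have "laplace \<nu> (\<alpha> + \<beta>) \<le> laplace \<nu> \<alpha> + \<beta> \<bullet> mean \<alpha> + K * (norm \<beta>)\<^sup>2"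
    if \<alpha>: "norm (\<alpha> - \<alpha>0) \<le> \<delta>" and \<beta>: "norm \<beta> \<le> \<delta>" for \<alpha> \<beta>
  proof -
    have s1: "tilt_summable \<nu> \<alpha>"
      by (rule exp_dominated_tilt_summable[OF _ dom]) (use \<alpha> \<open>\<delta> > 0\<close> in auto)
    have "norm (\<alpha> + \<beta> - \<alpha>0) \<le> norm (\<alpha> - \<alpha>0) + norm \<beta>"
      by (metis add_diff_eq add.commute diff_add_eq norm_triangle_ineq)
    then have s2: "tilt_summable \<nu> (\<alpha> + \<beta>)"
      by (intro exp_dominated_tilt_summable[OF _ dom]) (use \<alpha> \<beta> \<open>\<delta> > 0\<close> in auto)
    have "laplace \<nu> (\<alpha> + \<beta>) \<le> laplace \<nu> \<alpha> + \<beta> \<bullet> mean \<alpha> + (2 / \<delta>\<^sup>2 * (norm \<beta>)\<^sup>2) * W"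
    proof (rule has_sum_mono[OF _ has_sum_add[OF has_sum_add[OF _ inner_mean[OF s1]] has_sum_cmult_right[OF W]]])
      show "((\<lambda>x. \<nu> x * tilt \<alpha> x) has_sum laplace \<nu> \<alpha>) UNIV" "((\<lambda>x. \<nu> x * tilt (\<alpha> + \<beta>) x) has_sum laplace \<nu> (\<alpha> + \<beta>)) UNIV"
        using s1 s2 unfolding laplace_def tilt_summable_def by (auto intro: has_sum_infsum)
      fix x
      let ?y = "\<beta> \<bullet> vreal x" and ?n = "norm (vreal x)"
      have y: "\<bar>?y\<bar> \<le> norm \<beta> * ?n" by (rule Cauchy_Schwarz_ineq2)
      also have "\<dots> \<le> \<delta> * ?n" using \<beta> by (intro mult_right_mono) auto
      finally have y2: "exp \<bar>?y\<bar> \<le> exp (\<delta> * ?n)" by simp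
      have "?y\<^sup>2 = \<bar>?y\<bar>\<^sup>2" by simp
      also have "\<dots> \<le> (norm \<beta> * ?n)\<^sup>2" using y by (intro power_mono) auto
      also have "\<dots> = (norm \<beta>)\<^sup>2 * ?n\<^sup>2" by (simp add: power_mult_distrib)
      also have "\<dots> \<le> (norm \<beta>)\<^sup>2 * (2 / \<delta>\<^sup>2 * exp (\<delta> * ?n))"
        using power_le_exp[of ?n \<delta> 2] \<open>\<delta> > 0\<close> by (intro mult_left_mono) auto
      finally have y3: "?y\<^sup>2 \<le> (norm \<beta>)\<^sup>2 * (2 / \<delta>\<^sup>2 * exp (\<delta> * ?n))" .
      have "tilt \<alpha> x * (?y\<^sup>2 * exp \<bar>?y\<bar>) \<le> (tilt \<alpha>0 x * exp (\<delta> * ?n)) * ((norm \<beta>)\<^sup>2 * (2 / \<delta>\<^sup>2 * exp (\<delta> * ?n)) * exp (\<delta> * ?n))"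
        using \<alpha> y2 y3 by (intro mult_mono tilt_le_exp_norm) auto
      also have "\<dots> = (2 / \<delta>\<^sup>2 * (norm \<beta>)\<^sup>2) * (tilt \<alpha>0 x * (exp (\<delta> * ?n) * exp (\<delta> * ?n) * exp (\<delta> * ?n)))"
        by (simp add: mult_ac)
      also have "exp (\<delta> * ?n) * exp (\<delta> * ?n) * exp (\<delta> * ?n) = exp (3 * \<delta> * ?n)"
        by (simp add: exp_add[symmetric])
      finally have "\<nu> x * (tilt \<alpha> x * (?y\<^sup>2 * exp \<bar>?y\<bar>)) \<le> \<nu> x * ((2 / \<delta>\<^sup>2 * (norm \<beta>)\<^sup>2) * (tilt \<alpha>0 x * exp (3 * \<delta> * ?n)))"
        by (intro mult_left_mono) auto
      moreover have "\<nu> x * tilt \<alpha> x * exp ?y \<le> \<nu> x * tilt \<alpha> x * (1 + ?y + ?y\<^sup>2 * exp \<bar>?y\<bar>)"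
        by (intro mult_left_mono exp_le_quadratic) auto
      moreover have "\<nu> x * tilt (\<alpha> + \<beta>) x = \<nu> x * tilt \<alpha> x * exp ?y"
        by (simp add: tilt_def inner_add_left exp_add)
      moreover have "\<nu> x * tilt \<alpha> x * (1 + ?y + ?y\<^sup>2 * exp \<bar>?y\<bar>) =
          \<nu> x * tilt \<alpha> x + \<nu> x * tilt \<alpha> x * ?y + \<nu> x * (tilt \<alpha> x * (?y\<^sup>2 * exp \<bar>?y\<bar>))"
        by (simp add: algebra_simps)
      moreover have "\<nu> x * ((2 / \<delta>\<^sup>2 * (norm \<beta>)\<^sup>2) * (tilt \<alpha>0 x * exp (3 * \<delta> * ?n))) = 2 / \<delta>\<^sup>2 * (norm \<beta>)\<^sup>2 * ?w x"
        by (simp only: mult_ac)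
      ultimately show "\<nu> x * tilt (\<alpha> + \<beta>) x \<le> \<nu> x * tilt \<alpha> x + \<nu> x * tilt \<alpha> x * ?y + 2 / \<delta>\<^sup>2 * (norm \<beta>)\<^sup>2 * ?w x"
        by linarith
    qed
    also have "\<dots> \<le> laplace \<nu> \<alpha> + \<beta> \<bullet> mean \<alpha> + K * (norm \<beta>)\<^sup>2"
      by (simp add: K_def algebra_simps)
    finally show ?thesis .
  qed
  ultimately show ?thesis by blast
qed

lemma dominated_at:
  assumes "tilt_summable \<nu> \<alpha>"
  obtains \<delta> where "\<delta> > 0" "exp_dominated \<nu> \<alpha> (3 * \<delta>)" "exp_dominated b \<alpha> (3 * \<delta>)"
proof -
  obtain d1 d2 where d: "d1 > 0" "exp_dominated \<nu> \<alpha> d1" "d2 > 0" "exp_dominated b \<alpha> d2"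
    using nu_dominated[OF assms] b_dominated[OF assms] by blast
  define d where "d = min d1 d2 / 3"
  have "d > 0" using d by (simp add: d_def)
  moreover have "exp_dominated \<nu> \<alpha> (3 * d)"
    by (rule exp_dominated_mono[OF _ d(2)]) (auto simp: d_def)
  moreover have "exp_dominated b \<alpha> (3 * d)"
    by (rule exp_dominated_mono[OF _ d(4)]) (auto simp: d_def)
  ultimately show ?thesis using that by blast
qed

lemma b_summable: "tilt_summable \<nu> \<alpha> \<Longrightarrow> tilt_summable b \<alpha>"
  by (erule dominated_at) (rule exp_dominated_tilt_summable[where f = b], auto)

text \<open>Either there is slack in \<open>laplace \<nu> c < 1\<close>, or the first-order decrease
  along \<open>v\<close> beats the quadratic error; in both cases a short step along
  \<open>v\<close> stays in \<open>D\<close>.\<close>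

lemma D_direction:
  assumes c: "c \<in> D" and v: "laplace \<nu> c < 1 \<or> v \<bullet> mean c < 0"
  shows "\<exists>\<epsilon>>0. c + \<epsilon> *\<^sub>R v \<in> D"
proof -
  have s: "tilt_summable \<nu> c" "laplace \<nu> c \<le> 1" using c by (auto simp: D_def)
  obtain \<delta> where d: "\<delta> > 0" "exp_dominated \<nu> c (3 * \<delta>)" using dominated_at[OF s(1)] by blast
  from laplace_taylor[OF d(2,1)] obtain K where
    K: "K > 0" "\<And>\<beta>. norm \<beta> \<le> \<delta> \<Longrightarrow> laplace \<nu> (c + \<beta>) \<le> laplace \<nu> c + \<beta> \<bullet> mean c + K * (norm \<beta>)\<^sup>2"
    using d(1) by (metis diff_self norm_zero less_le_not_le)
  have l1: "((\<lambda>\<epsilon>. \<epsilon> * norm v) \<longlongrightarrow> 0 * norm v) (at_right 0)"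
    by (intro tendsto_intros)
  have e1: "eventually (\<lambda>\<epsilon>. \<epsilon> * norm v < \<delta>) (at_right 0)"
    using order_tendstoD(2)[OF l1, of \<delta>] d(1) by simp
  have e2: "eventually (\<lambda>\<epsilon>. laplace \<nu> c + \<epsilon> * (v \<bullet> mean c) + K * (\<epsilon> * norm v)\<^sup>2 \<le> 1) (at_right 0)"
  proof (cases "laplace \<nu> c < 1")
    case True
    have "((\<lambda>\<epsilon>. laplace \<nu> c + \<epsilon> * (v \<bullet> mean c) + K * (\<epsilon> * norm v)\<^sup>2) \<longlongrightarrow> laplace \<nu> c + 0 * (v \<bullet> mean c) + K * (0 * norm v)\<^sup>2) (at_right 0)"
      by (intro tendsto_intros)
    from order_tendstoD(2)[OF this, of 1] True show ?thesis by (auto elim!: eventually_mono)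
  next
    case False
    with v have v: "v \<bullet> mean c < 0" by simp
    have "((\<lambda>\<epsilon>. (v \<bullet> mean c) + K * \<epsilon> * (norm v)\<^sup>2) \<longlongrightarrow> (v \<bullet> mean c) + K * 0 * (norm v)\<^sup>2) (at_right 0)"
      by (intro tendsto_intros)
    from order_tendstoD(2)[OF this, of 0] v
    have "eventually (\<lambda>\<epsilon>. (v \<bullet> mean c) + K * \<epsilon> * (norm v)\<^sup>2 < 0) (at_right 0)" by simp
    with eventually_at_right_less[of 0] show ?thesis
    proof eventually_elim
      case (elim \<epsilon>)
      then have "\<epsilon> * ((v \<bullet> mean c) + K * \<epsilon> * (norm v)\<^sup>2) \<le> 0"
        by (simp add: mult_nonneg_nonpos)
      then show ?case using s(2) by (simp add: algebra_simps power2_eq_square)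
    qed
  qed
  from e1 e2 eventually_at_right_less[of 0]
  have "eventually (\<lambda>\<epsilon>. \<epsilon> > 0 \<and> c + \<epsilon> *\<^sub>R v \<in> D) (at_right (0::real))"
  proof eventually_elim
    case (elim \<epsilon>)
    then have n: "norm (\<epsilon> *\<^sub>R v) \<le> \<delta>" by simp
    have "tilt_summable \<nu> (c + \<epsilon> *\<^sub>R v)"
      by (rule exp_dominated_tilt_summable[OF _ d(2)]) (use n d(1) in auto)
    moreover have "laplace \<nu> (c + \<epsilon> *\<^sub>R v) \<le> 1"
      using K(2)[OF n] elim by simp
    ultimately show ?case using elim by (simp add: D_def)
  qed
  then show ?thesis
    using eventually_happens'[of "at_right (0::real)"] by auto
qed

text \<open>If \<open>n\<close> steps reach \<open>y\<close> with mass \<open>q\<close>, then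
  \<open>q * tilt \<alpha> y\<close> is at most the \<open>n\<close>-th power of the transform,
  hence at most 1 on \<open>D\<close>. This bounds \<open>\<alpha> \<bullet> vreal y\<close> from
  above; the positive and negative unit vectors confine \<open>\<alpha>\<close> to a box.\<close>

lemma D_bounded: "bounded D"
proof -
  have B: "\<exists>C. \<forall>\<alpha>\<in>D. \<alpha> \<bullet> vreal y \<le> C" for y
  proof -
    obtain n where n: "(conv \<nu> ^^ n) point y > 0" using reach by blast
    let ?p = "(conv \<nu> ^^ n) point y"
    have "\<alpha> \<bullet> vreal y \<le> - ln ?p" if "\<alpha> \<in> D" for \<alpha>
    proof -
      have s: "tilt_summable \<nu> \<alpha>" "laplace \<nu> \<alpha> \<le> 1" using that by (auto simp: D_def)
      have "?p * tilt \<alpha> y \<le> laplace ((conv \<nu> ^^ n) point) \<alpha>"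
        by (intro tilt_term_le_laplace step_nonneg tilt_summable_step s) auto
      also have "\<dots> \<le> 1"
        using s by (subst laplace_step) (auto intro!: power_le_one laplace_nonneg)
      finally have "ln (?p * tilt \<alpha> y) \<le> 0"
        using n by simp
      then show ?thesis using n by (simp add: ln_mult tilt_def)
    qed
    then show ?thesis by blast
  qed
  obtain C where C: "\<And>y \<alpha>. \<alpha> \<in> D \<Longrightarrow> \<alpha> \<bullet> vreal y \<le> C y"
    using B by metis
  have "D \<subseteq> cbox (\<chi> k. - C (axis k (-1))) (\<chi> k. C (axis k 1))"
  proof
    fix \<alpha> assume "\<alpha> \<in> D"
    from C[OF this, of "axis _ 1"] C[OF this, of "axis _ (-1)"]
    show "\<alpha> \<in> cbox (\<chi> k. - C (axis k (-1))) (\<chi> k. C (axis k 1))"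
      by (auto simp: mem_box_cart inner_axis minus_le_iff)
  qed
  then show ?thesis using bounded_cbox bounded_subset by blast
qed

text \<open>Finite partial sums stay at most 1 in the limit, as in Fatou's lemma, so the limit is
  again a point of convergence and \<open>D\<close> does not lose points at the edge of the
  domain.\<close>

lemma D_closed: "closed D"
  unfolding closed_sequential_limits
proof safe
  fix a \<alpha> assume a: "\<forall>k. a k \<in> D" "a \<longlonglongrightarrow> \<alpha>"
  have F: "(\<Sum>x\<in>F. \<nu> x * tilt \<alpha> x) \<le> 1" if "finite F" for F
  proof (rule LIMSEQ_le_const2)
    show "(\<lambda>k. \<Sum>x\<in>F. \<nu> x * tilt (a k) x) \<longlonglongrightarrow> (\<Sum>x\<in>F. \<nu> x * tilt \<alpha> x)"
      unfolding tilt_def by (intro tendsto_intros a)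
    have "(\<Sum>x\<in>F. \<nu> x * tilt (a k) x) \<le> laplace \<nu> (a k)" for k
      unfolding laplace_def using a that by (intro finite_sum_le_infsum) (auto simp: D_def tilt_summable_def)
    then show "\<exists>N. \<forall>k\<ge>N. (\<Sum>x\<in>F. \<nu> x * tilt (a k) x) \<le> 1"
      using a(1) by (auto simp: D_def intro: order_trans)
  qed
  have s: "tilt_summable \<nu> \<alpha>"
    unfolding tilt_summable_def
    by (rule nonneg_bdd_above_summable_on) (auto intro!: bdd_aboveI2[where M = 1] F)
  moreover have "laplace \<nu> \<alpha> \<le> 1"
    unfolding laplace_def using s F by (intro infsum_le_finite_sums) (auto simp: tilt_summable_def)
  ultimately show "\<alpha> \<in> D" by (simp add: D_def)
qed

lemma D_compact: "compact D"
  using D_bounded D_closed compact_eq_bounded_closed by blast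

lemma tilt_convex:
  assumes "0 \<le> s" "s \<le> 1"
  shows "tilt ((1 - s) *\<^sub>R \<alpha> + s *\<^sub>R \<beta>) x \<le> (1 - s) * tilt \<alpha> x + s * tilt \<beta> x"
  using convex_onD[OF exp_convex, where t = s and x = "\<alpha> \<bullet> vreal x" and y = "\<beta> \<bullet> vreal x"] assms
  by (simp add: tilt_def inner_add_left)

lemma
  assumes "0 \<le> s" "s \<le> 1" "tilt_summable \<nu> \<alpha>" "tilt_summable \<nu> \<beta>"
  shows convex_tilt_summable: "tilt_summable \<nu> ((1 - s) *\<^sub>R \<alpha> + s *\<^sub>R \<beta>)"
    and laplace_convex: "laplace \<nu> ((1 - s) *\<^sub>R \<alpha> + s *\<^sub>R \<beta>) \<le> (1 - s) * laplace \<nu> \<alpha> + s * laplace \<nu> \<beta>"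
proof -
  have S: "((\<lambda>x. (1 - s) * (\<nu> x * tilt \<alpha> x) + s * (\<nu> x * tilt \<beta> x)) has_sum (1 - s) * laplace \<nu> \<alpha> + s * laplace \<nu> \<beta>) UNIV"
    unfolding laplace_def using assms(3,4)
    by (intro has_sum_add has_sum_cmult_right has_sum_infsum) (auto simp: tilt_summable_def)
  have le: "\<nu> x * tilt ((1 - s) *\<^sub>R \<alpha> + s *\<^sub>R \<beta>) x \<le> (1 - s) * (\<nu> x * tilt \<alpha> x) + s * (\<nu> x * tilt \<beta> x)" for x
    using mult_left_mono[OF tilt_convex[OF assms(1,2), of \<alpha> \<beta> x] nu_nonneg[of x]] by (simp add: algebra_simps)
  show s: "tilt_summable \<nu> ((1 - s) *\<^sub>R \<alpha> + s *\<^sub>R \<beta>)"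
    unfolding tilt_summable_def
    by (rule summable_on_comparison_test[OF has_sum_imp_summable[OF S]]) (use le in auto)
  show "laplace \<nu> ((1 - s) *\<^sub>R \<alpha> + s *\<^sub>R \<beta>) \<le> (1 - s) * laplace \<nu> \<alpha> + s * laplace \<nu> \<beta>"
    using s unfolding laplace_def[of \<nu> "(1 - s) *\<^sub>R \<alpha> + s *\<^sub>R \<beta>"] tilt_summable_def
    by (intro has_sum_mono[OF has_sum_infsum S]) (use le in auto)
qed

text \<open>By convexity each point of \<open>D\<close> can be pushed slightly towards a point with
  transform below 1. The strict set on the right is the one that can be compared between base
  states.\<close>

lemma D_eq_closure: "D = closure {\<alpha>. tilt_summable \<nu> \<alpha> \<and> laplace \<nu> \<alpha> < 1}"
proof
  show "closure {\<alpha>. tilt_summable \<nu> \<alpha> \<and> laplace \<nu> \<alpha> < 1} \<subseteq> D"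
    by (rule closure_minimal[OF _ D_closed]) (auto simp: D_def)
  show "D \<subseteq> closure {\<alpha>. tilt_summable \<nu> \<alpha> \<and> laplace \<nu> \<alpha> < 1}"
  proof
    fix c assume c: "c \<in> D"
    obtain \<alpha> where \<alpha>: "tilt_summable \<nu> \<alpha>" "laplace \<nu> \<alpha> < 1" using drift by blast
    define s where "s k = inverse (real (Suc k))" for k
    have s: "0 < s k" "s k \<le> 1" for k by (auto simp: s_def divide_simps)
    have "(\<lambda>k. (1 - s k) *\<^sub>R c + s k *\<^sub>R \<alpha>) \<longlonglongrightarrow> (1 - 0) *\<^sub>R c + 0 *\<^sub>R \<alpha>"
      unfolding s_def by (intro tendsto_intros LIMSEQ_inverse_real_of_nat)
    moreover have "tilt_summable \<nu> ((1 - s k) *\<^sub>R c + s k *\<^sub>R \<alpha>) \<and> laplace \<nu> ((1 - s k) *\<^sub>R c + s k *\<^sub>R \<alpha>) < 1" for k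
    proof
      show "tilt_summable \<nu> ((1 - s k) *\<^sub>R c + s k *\<^sub>R \<alpha>)"
        using c \<alpha> s[of k] by (intro convex_tilt_summable) (auto simp: D_def)
      have "laplace \<nu> ((1 - s k) *\<^sub>R c + s k *\<^sub>R \<alpha>) \<le> (1 - s k) * laplace \<nu> c + s k * laplace \<nu> \<alpha>"
        using c \<alpha> s[of k] by (intro laplace_convex) (auto simp: D_def)
      also have "\<dots> < (1 - s k) * 1 + s k * 1"
        using c \<alpha> s[of k] by (intro add_le_less_mono mult_left_mono mult_strict_left_mono) (auto simp: D_def)
      finally show "laplace \<nu> ((1 - s k) *\<^sub>R c + s k *\<^sub>R \<alpha>) < 1" by simp
    qed
    ultimately show "c \<in> closure {\<alpha>. tilt_summable \<nu> \<alpha> \<and> laplace \<nu> \<alpha> < 1}"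
      unfolding closure_sequential by (intro exI[of _ "\<lambda>k. (1 - s k) *\<^sub>R c + s k *\<^sub>R \<alpha>"]) simp
  qed
qed

text \<open>The gap between the mean of two exponentials and the exponential at the midpoint is half
  the square of \<open>exp (a / 2) - exp (b / 2)\<close>, and by \<open>support_spans\<close> it is
  positive at some charged point.\<close>

lemma D_strictly_convex:
  assumes "\<alpha> \<in> D" "\<beta> \<in> D" "\<alpha> \<noteq> \<beta>"
  shows "tilt_summable \<nu> ((1/2) *\<^sub>R \<alpha> + (1/2) *\<^sub>R \<beta>) \<and> laplace \<nu> ((1/2) *\<^sub>R \<alpha> + (1/2) *\<^sub>R \<beta>) < 1"
proof
  let ?m = "(1/2) *\<^sub>R \<alpha> + (1/2) *\<^sub>R \<beta>"
  have s: "tilt_summable \<nu> \<alpha>" "tilt_summable \<nu> \<beta>" "laplace \<nu> \<alpha> \<le> 1" "laplace \<nu> \<beta> \<le> 1"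
    using assms by (auto simp: D_def)
  show sm: "tilt_summable \<nu> ?m"
    using convex_tilt_summable[of "1/2" \<alpha> \<beta>] s by simp
  obtain x where x: "\<nu> x > 0" "(\<alpha> - \<beta>) \<bullet> vreal x \<noteq> 0"
    using support_spans[of "\<alpha> - \<beta>"] assms(3) by auto
  define g where "g y = \<nu> y * (tilt \<alpha> y / 2 + tilt \<beta> y / 2 - tilt ?m y)" for y
  have eq: "tilt \<alpha> y / 2 + tilt \<beta> y / 2 - tilt ?m y = (exp (\<alpha> \<bullet> vreal y / 2) - exp (\<beta> \<bullet> vreal y / 2))\<^sup>2 / 2" for y
  proof -
    have "tilt \<alpha> y = exp (\<alpha> \<bullet> vreal y / 2) ^ 2" "tilt \<beta> y = exp (\<beta> \<bullet> vreal y / 2) ^ 2"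
      by (simp_all add: tilt_def flip: exp_of_nat_mult)
    moreover have "tilt ?m y = exp (\<alpha> \<bullet> vreal y / 2) * exp (\<beta> \<bullet> vreal y / 2)"
      by (simp add: tilt_def inner_add_left flip: exp_add)
    ultimately show ?thesis by (simp add: power2_eq_square field_simps)
  qed
  have g: "(g has_sum laplace \<nu> \<alpha> / 2 + laplace \<nu> \<beta> / 2 - laplace \<nu> ?m) UNIV"
  proof -
    have "((\<lambda>y. (\<nu> y * tilt \<alpha> y) * (1 / 2) + (\<nu> y * tilt \<beta> y) * (1 / 2) + (\<nu> y * tilt ?m y) * (-1)) has_sum
       laplace \<nu> \<alpha> * (1 / 2) + laplace \<nu> \<beta> * (1 / 2) + laplace \<nu> ?m * (-1)) UNIV"
      unfolding laplace_def using s sm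
      by (intro has_sum_add has_sum_cmult_left has_sum_infsum) (auto simp: tilt_summable_def)
    then show ?thesis by (simp add: g_def[abs_def] algebra_simps)
  qed
  have "0 < g x"
    using x by (auto simp: g_def eq inner_diff_left intro!: mult_pos_pos)
  also have "g x = infsum g {x}" by simp
  also have "\<dots> \<le> infsum g UNIV"
    using has_sum_imp_summable[OF g] by (intro infsum_mono2) (auto simp: g_def eq)
  also have "\<dots> = laplace \<nu> \<alpha> / 2 + laplace \<nu> \<beta> / 2 - laplace \<nu> ?m"
    using g by (rule infsumI)
  finally show "laplace \<nu> ?m < 1" using s by linarith
qed

section \<open>Support points of the sublevel set\<close>

definition maximizer :: "real ^ 'd \<Rightarrow> real ^ 'd \<Rightarrow> bool" where
  "maximizer u c \<longleftrightarrow> c \<in> D \<and> (\<forall>\<beta>\<in>D. \<beta> \<bullet> u \<le> c \<bullet> u)"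

lemma maximizer_exists: "\<exists>c. maximizer u c"
proof -
  have "D \<noteq> {}" using drift by (force simp: D_def)
  moreover have "continuous_on D (\<lambda>\<alpha>. \<alpha> \<bullet> u)" by (intro continuous_intros)
  ultimately show ?thesis
    using continuous_attains_sup[OF D_compact] by (auto simp: maximizer_def)
qed

text \<open>At a point with transform below 1 there is room to move along \<open>u\<close>, which
  increases the linear functional.\<close>

lemma maximizer_boundary:
  assumes "maximizer u c" "u \<noteq> 0"
  shows "laplace \<nu> c = 1"
proof (rule ccontr)
  assume "laplace \<nu> c \<noteq> 1"
  then have "laplace \<nu> c < 1" using assms by (auto simp: maximizer_def D_def)
  then obtain \<epsilon> where "\<epsilon> > 0" "c + \<epsilon> *\<^sub>R u \<in> D"
    using D_direction assms by (metis maximizer_def)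
  then have "(c + \<epsilon> *\<^sub>R u) \<bullet> u \<le> c \<bullet> u" using assms by (auto simp: maximizer_def)
  then show False using \<open>\<epsilon> > 0\<close> assms(2) by (simp add: inner_add_left mult_le_0_iff flip: not_less)
qed

text \<open>The midpoint of two maximizers would again be a maximizer, with transform below 1,
  against \<open>maximizer_boundary\<close>.\<close>

lemma maximizer_unique:
  assumes "maximizer u c" "maximizer u c'" "u \<noteq> 0"
  shows "c = c'"
proof (rule ccontr)
  assume "c \<noteq> c'"
  let ?m = "(1/2) *\<^sub>R c + (1/2) *\<^sub>R c'"
  have *: "tilt_summable \<nu> ?m" "laplace \<nu> ?m < 1"
    using D_strictly_convex[of c c'] \<open>c \<noteq> c'\<close> assms by (auto simp: maximizer_def)
  have "c \<bullet> u = c' \<bullet> u"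
    using assms by (intro antisym) (auto simp: maximizer_def)
  then have "?m \<bullet> u = c \<bullet> u" by (simp add: inner_add_left)
  then have "maximizer u ?m" using * assms by (auto simp: maximizer_def D_def)
  from maximizer_boundary[OF this assms(3)] * show False by simp
qed

text \<open>The Lagrange condition: at the maximum, the gradient of the constraint is a positive
  multiple of \<open>u\<close>. It does not vanish because the tangent inequality must reach a point
  with transform below 1.\<close>

lemma maximizer_mean:
  assumes "maximizer u c" "norm u = 1"
  shows "mean c \<noteq> 0" "mean c = norm (mean c) *\<^sub>R u"
proof -
  let ?g = "mean c"
  have c: "c \<in> D" "tilt_summable \<nu> c" "laplace \<nu> c = 1"
    using assms maximizer_boundary[OF assms(1)] by (force simp: maximizer_def D_def)+
  obtain \<alpha> where \<alpha>: "tilt_summable \<nu> \<alpha>" "laplace \<nu> \<alpha> < 1" using drift by blast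
  have "(\<alpha> - c) \<bullet> ?g < 0"
    using laplace_tangent[of c "\<alpha> - c"] c \<alpha> by simp
  then show g: "?g \<noteq> 0" by auto
  have key: "u \<bullet> v \<le> 0" if v: "v \<bullet> ?g < 0" for v
  proof -
    obtain \<epsilon> where "\<epsilon> > 0" "c + \<epsilon> *\<^sub>R v \<in> D" using D_direction[OF c(1), of v] v by blast
    then have "(c + \<epsilon> *\<^sub>R v) \<bullet> u \<le> c \<bullet> u" using assms by (auto simp: maximizer_def)
    then show ?thesis using \<open>\<epsilon> > 0\<close> by (simp add: inner_add_left mult_le_0_iff inner_commute[of u])
  qed
  \<comment> \<open>\<open>w\<close> is the part of \<open>u\<close> orthogonal to the gradient; the
    aim is to show that it is 0.\<close>
  define l where "l = (u \<bullet> ?g) / (?g \<bullet> ?g)"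
  define w where "w = u - l *\<^sub>R ?g"
  have gg: "?g \<bullet> ?g > 0" using g by simp
  have wg: "w \<bullet> ?g = 0" using gg by (simp add: w_def l_def inner_diff_left)
  have uw: "u \<bullet> w = w \<bullet> w"
  proof -
    have "u = w + l *\<^sub>R ?g" by (simp add: w_def)
    then have "u \<bullet> w = (w + l *\<^sub>R ?g) \<bullet> w" by simp
    then show ?thesis using wg by (simp add: inner_add_left inner_commute[of ?g])
  qed
  \<comment> \<open>The direction \<open>w - \<epsilon> *\<^sub>R ?g\<close> points strictly into
    the sublevel set, so \<open>key\<close> applies; letting \<open>\<epsilon>\<close> tend to 0
    kills \<open>w\<close>.\<close>
  have "w \<bullet> w \<le> \<epsilon> * (u \<bullet> ?g)" if "\<epsilon> > 0" for \<epsilon>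
    using key[of "w - \<epsilon> *\<^sub>R ?g"] that gg wg uw by (simp add: inner_diff_left inner_diff_right)
  then have "eventually (\<lambda>\<epsilon>. w \<bullet> w \<le> \<epsilon> * (u \<bullet> ?g)) (at_right 0)"
    by (intro eventually_mono[OF eventually_at_right_less[of 0]])
  moreover have "((\<lambda>\<epsilon>. \<epsilon> * (u \<bullet> ?g)) \<longlongrightarrow> 0 * (u \<bullet> ?g)) (at_right 0)"
    by (intro tendsto_intros)
  ultimately have "w \<bullet> w \<le> 0"
    by (metis mult_zero_left tendsto_lowerbound trivial_limit_at_right_real)
  then have "w = 0" using inner_gt_zero_iff[of w] by linarith
  then have ul: "u = l *\<^sub>R ?g" by (simp add: w_def)
  have "u \<bullet> (- ?g) \<le> 0" using gg by (intro key) simp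
  then have "l \<ge> 0" using gg by (simp add: l_def)
  have "\<bar>l\<bar> * norm ?g = 1" using assms(2) ul by (metis norm_scaleR)
  then have "l = 1 / norm ?g" using \<open>l \<ge> 0\<close> g by (simp add: field_simps)
  then show "?g = norm ?g *\<^sub>R u" using ul g by simp
qed

text \<open>Compactness and uniqueness: every subsequential limit of the maximizers is a maximizer
  for the limit direction, and there is only one.\<close>

lemma maximizer_tendsto:
  assumes u: "v \<longlonglongrightarrow> u" "u \<noteq> 0" and m: "\<And>k. maximizer (v k) (a k)" "maximizer u c"
  shows "a \<longlonglongrightarrow> c"
proof (rule ccontr)
  assume "\<not> a \<longlonglongrightarrow> c"
  then obtain \<epsilon> where \<epsilon>: "\<epsilon> > 0" "\<exists>\<^sub>F k in sequentially. dist (a k) c \<ge> \<epsilon>"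
    by (auto simp: tendsto_iff not_eventually not_less)
  then obtain r where r: "strict_mono r" "\<And>k::nat. dist (a (r k)) c \<ge> \<epsilon>"
    using infinite_enumerate[of "{k. dist (a k) c \<ge> \<epsilon>}"]
    by (auto simp: cofinite_eq_sequentially[symmetric] frequently_cofinite)
  have "\<And>k. a (r k) \<in> D" using m by (auto simp: maximizer_def)
  then obtain l s where s: "l \<in> D" "strict_mono s" "((a \<circ> r) \<circ> s) \<longlonglongrightarrow> l"
    using D_compact unfolding compact_def by (metis comp_apply)
  have "maximizer u l"
    unfolding maximizer_def
  proof (intro conjI ballI s)
    fix \<beta> assume "\<beta> \<in> D"
    have v: "(v \<circ> (r \<circ> s)) \<longlonglongrightarrow> u"
      using LIMSEQ_subseq_LIMSEQ[OF u(1) strict_mono_o[OF r(1) s(2)]] .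
    show "\<beta> \<bullet> u \<le> l \<bullet> u"
    proof (rule LIMSEQ_le)
      show "(\<lambda>k. \<beta> \<bullet> (v \<circ> (r \<circ> s)) k) \<longlonglongrightarrow> \<beta> \<bullet> u" by (intro tendsto_intros v)
      show "(\<lambda>k. ((a \<circ> r) \<circ> s) k \<bullet> (v \<circ> (r \<circ> s)) k) \<longlonglongrightarrow> l \<bullet> u" by (intro tendsto_intros v s)
      show "\<exists>N. \<forall>k\<ge>N. \<beta> \<bullet> (v \<circ> (r \<circ> s)) k \<le> ((a \<circ> r) \<circ> s) k \<bullet> (v \<circ> (r \<circ> s)) k"
        using m(1) \<open>\<beta> \<in> D\<close> by (auto simp: maximizer_def)
    qed
  qed
  then have "l = c" using maximizer_unique m(2) u(2) by blast
  then have "(\<lambda>k. dist (((a \<circ> r) \<circ> s) k) c) \<longlonglongrightarrow> 0"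
    using s(3) tendsto_dist_iff by blast
  moreover have "\<epsilon> \<le> dist (((a \<circ> r) \<circ> s) k) c" for k using r(2) by simp
  ultimately have "\<epsilon> \<le> 0" by (intro LIMSEQ_le_const) auto
  with \<epsilon> show False by simp
qed

end

section \<open>Uniform decay of the Fourier transform\<close>

text \<open>By Taylor at order four, using that \<open>pi\<close> is below 3.2: then
  \<open>t\<^sup>2\<close> is at most 10.24, and \<open>1 / 2 - 10.24 / 24\<close> still exceeds
  \<open>1 / 20\<close>.\<close>

lemma one_minus_cos_ge:
  fixes t :: real
  assumes "\<bar>t\<bar> \<le> pi"
  shows "1 - cos t \<ge> t\<^sup>2 / 20"
proof -
  obtain s where s: "cos t = (\<Sum>m<4. cos_coeff m * t ^ m) + cos (s + 1/2 * real 4 * pi) / fact 4 * t ^ 4"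
    using Maclaurin_cos_expansion[of t 4] by blast
  have "{..<4} = {0, 1, 2, 3::nat}" by auto
  then have "(\<Sum>m<4. cos_coeff m * t ^ m) = 1 - t\<^sup>2 / 2"
    by (simp add: cos_coeff_def)
  moreover have "cos (s + 1/2 * real 4 * pi) / fact 4 * t ^ 4 \<le> 1 / fact 4 * t ^ 4"
    by (intro mult_right_mono divide_right_mono) auto
  moreover have "(fact 4 :: real) = 24" by (simp add: fact_numeral)
  ultimately have le: "cos t \<le> 1 - t\<^sup>2 / 2 + t ^ 4 / 24"
    using s by simp
  have "t\<^sup>2 \<le> (32 / 10)\<^sup>2"
    using assms pi_less_4 pi_approx by (intro abs_le_square_iff[THEN iffD1]) auto
  then have "t\<^sup>2 * t\<^sup>2 \<le> t\<^sup>2 * (32 / 10)\<^sup>2"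
    by (intro mult_left_mono) auto
  then have "t ^ 4 \<le> t\<^sup>2 * (1024 / 100)"
    by (simp add: power2_eq_square power4_eq_xxxx)
  then show ?thesis using le zero_le_power2[of t] by linarith
qed

text \<open>The squared norm is exactly
  \<open>(a + b)\<^sup>2 - 2 * a * b * (1 - cos \<tau>)\<close>. Taking the root gains at least
  \<open>a * b / (a + b)\<close> times \<open>1 - cos \<tau>\<close>, and this factor is at least
  half the minimum.\<close>

lemma norm_add_cis_le:
  fixes a b \<tau> :: real
  assumes "a > 0" "b > 0"
  shows "norm (of_real a + of_real b * cis \<tau>) \<le> a + b - min a b / 2 * (1 - cos \<tau>)"
proof (rule power2_le_imp_le)
  define q where "q = a * b / (a + b)"
  have q: "min a b / 2 \<le> q" "q * (a + b) = a * b" "q \<ge> 0"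
    using assms by (auto simp: q_def field_simps min_def)
  define d where "d = 1 - cos \<tau>"
  have d: "0 \<le> d" "d \<le> 2" using cos_le_one[of \<tau>] cos_ge_minus_one[of \<tau>] by (auto simp: d_def)
  have "min a b / 2 * d \<le> min a b / 2 * 2" using d assms by (intro mult_left_mono) auto
  then show nn: "0 \<le> a + b - min a b / 2 * (1 - cos \<tau>)" using assms unfolding d_def[symmetric] by linarith
  have "(norm (of_real a + of_real b * cis \<tau>))\<^sup>2 = (a + b * cos \<tau>)\<^sup>2 + (b * sin \<tau>)\<^sup>2"
    by (simp add: cmod_power2)
  also have "\<dots> = a\<^sup>2 + 2 * a * b * cos \<tau> + b\<^sup>2 * ((cos \<tau>)\<^sup>2 + (sin \<tau>)\<^sup>2)"
    by (simp only: power_mult_distrib power2_sum ring_distribs mult_ac)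
  also have "\<dots> = (a + b)\<^sup>2 - 2 * (a * b) * d"
    unfolding sin_cos_squared_add2 by (simp add: d_def algebra_simps power2_eq_square)
  also have "\<dots> \<le> (a + b)\<^sup>2 - 2 * (a + b) * (min a b / 2 * d) + (min a b / 2 * d)\<^sup>2"
  proof -
    have "(a + b) * (min a b / 2 * d) \<le> (a + b) * (q * d)"
      using q d assms by (intro mult_left_mono mult_right_mono) auto
    also have "\<dots> = a * b * d" using q(2) by (simp add: mult_ac)
    finally show ?thesis using zero_le_power2[of "min a b / 2 * d"] by linarith
  qed
  also have "\<dots> = (a + b - min a b / 2 * (1 - cos \<tau>))\<^sup>2"
    unfolding d_def[symmetric] by (simp add: power2_diff)
  finally show "(norm (of_real a + of_real b * cis \<tau>))\<^sup>2 \<le> (a + b - min a b / 2 * (1 - cos \<tau>))\<^sup>2" .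
qed

text \<open>Only the interference between the points 0 and \<open>e\<close> is kept; the rest of
  \<open>f\<close> is estimated by the triangle inequality.\<close>

lemma norm_fourier_two_points:
  fixes f :: "int ^ 'd \<Rightarrow> real"
  assumes f: "\<And>x. f x \<ge> 0" and s: "tilt_summable f \<alpha>" and e: "e \<noteq> 0" and pos: "f 0 > 0" "f e > 0"
  shows "norm (fourier f \<alpha> \<theta>) \<le> laplace f \<alpha> - min (f 0) (f e * tilt \<alpha> e) / 2 * (1 - cos (\<theta> \<bullet> vreal e))"
proof -
  define g where "g x = (if x \<in> {0, e} then f x else 0)" for x
  define h where "h x = (if x \<in> {0, e} then 0 else f x)" for x
  have gh: "f = (\<lambda>x. g x + h x)" by (auto simp: g_def h_def)
  have sg: "tilt_summable g \<alpha>" and sh: "tilt_summable h \<alpha>"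
    by (rule tilt_summable_mono[OF s]; use f in \<open>auto simp: g_def h_def\<close>)+
  have Fg: "fourier g \<alpha> t = of_real (f 0) + of_real (f e * tilt \<alpha> e) * cis (t \<bullet> vreal e)" for t
  proof -
    have "fourier g \<alpha> t = (\<Sum>\<^sub>\<infinity>x\<in>{0, e}. complex_of_real (g x * tilt \<alpha> x) * cis (t \<bullet> vreal x))"
      unfolding fourier_def by (intro infsum_cong_neutral) (auto simp: g_def)
    then show ?thesis using e by (simp add: g_def)
  qed
  have "complex_of_real (laplace g \<alpha>) = of_real (f 0 + f e * tilt \<alpha> e)"
    using fourier_0[OF sg] Fg[of 0] by simp
  then have Lg: "laplace g \<alpha> = f 0 + f e * tilt \<alpha> e" by (simp only: of_real_eq_iff)
  have "complex_of_real (laplace f \<alpha>) = of_real (laplace g \<alpha> + laplace h \<alpha>)"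
    using fourier_add[OF sg sh, of 0] fourier_0[OF s] fourier_0[OF sg] fourier_0[OF sh]
    unfolding gh[symmetric] by simp
  then have L: "laplace f \<alpha> = laplace g \<alpha> + laplace h \<alpha>" by (simp only: of_real_eq_iff)
  have "norm (fourier f \<alpha> \<theta>) \<le> norm (fourier g \<alpha> \<theta>) + norm (fourier h \<alpha> \<theta>)"
    by (subst gh) (simp only: fourier_add[OF sg sh] norm_triangle_ineq)
  also have "norm (fourier h \<alpha> \<theta>) \<le> laplace h \<alpha>"
    using f sh by (intro norm_fourier_le) (auto simp: h_def)
  also have "norm (fourier g \<alpha> \<theta>) \<le> f 0 + f e * tilt \<alpha> e - min (f 0) (f e * tilt \<alpha> e) / 2 * (1 - cos (\<theta> \<bullet> vreal e))"
    unfolding Fg using pos by (intro norm_add_cis_le) auto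
  finally show ?thesis using L Lg by simp
qed

lemma integrable_gaussian:
  fixes \<kappa> :: real
  assumes "\<kappa> > 0"
  shows "integrable lborel (\<lambda>\<eta>::'a::euclidean_space. exp (- \<kappa> * (norm \<eta>)\<^sup>2))"
proof -
  define \<sigma> where "\<sigma> = 1 / sqrt (2 * \<kappa>)"
  have \<sigma>: "\<sigma> > 0" "2 * \<sigma>\<^sup>2 = 1 / \<kappa>"
    using assms by (auto simp: \<sigma>_def power_divide)
  have "integrable lborel (\<lambda>t. sqrt (2 * pi * \<sigma>\<^sup>2) * normal_density 0 \<sigma> t)"
    using \<sigma> by (intro integrable_mult_right integrable_normal_density)
  also have "(\<lambda>t. sqrt (2 * pi * \<sigma>\<^sup>2) * normal_density 0 \<sigma> t) = (\<lambda>t. exp (- \<kappa> * t\<^sup>2))"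
    using \<sigma> assms by (auto simp: normal_density_def field_simps)
  finally have "integrable lborel (\<lambda>x::'a. \<Prod>b\<in>Basis. exp (- \<kappa> * (x \<bullet> b)\<^sup>2))"
    by (intro lborel_integrable_prod)
  also have "(\<lambda>x::'a. \<Prod>b\<in>Basis. exp (- \<kappa> * (x \<bullet> b)\<^sup>2)) = (\<lambda>\<eta>. exp (- \<kappa> * (norm \<eta>)\<^sup>2))"
  proof
    fix x :: 'a
    have "(norm x)\<^sup>2 = (\<Sum>b\<in>Basis. (x \<bullet> b)\<^sup>2)"
      by (subst power2_norm_eq_inner, subst euclidean_inner) (simp add: power2_eq_square)
    then show "(\<Prod>b\<in>Basis. exp (- \<kappa> * (x \<bullet> b)\<^sup>2)) = exp (- \<kappa> * (norm x)\<^sup>2)"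
      by (simp add: exp_sum[symmetric] sum_distrib_left sum_negf)
  qed
  finally show ?thesis .
qed

lemma lborel_integral_scale:
  fixes f :: "'a::euclidean_space \<Rightarrow> 'b::{banach, second_countable_topology}"
  assumes [measurable]: "f \<in> borel_measurable borel" and "s > 0"
  shows "(\<integral>x. f (x /\<^sub>R s) \<partial>lborel) = s ^ DIM('a) *\<^sub>R (\<integral>x. f x \<partial>lborel)"
proof -
  have "(\<integral>x. f (x /\<^sub>R s) \<partial>lborel) = (\<integral>x. f (x /\<^sub>R s) \<partial>density (distr lborel borel (\<lambda>x. 0 + s *\<^sub>R x)) (\<lambda>_. ennreal (\<bar>s\<bar> ^ DIM('a))))"
    using lborel_affine[of s "0::'a"] \<open>s > 0\<close> by simp
  also have "\<dots> = (\<integral>x. (\<bar>s\<bar> ^ DIM('a)) *\<^sub>R f (x /\<^sub>R s) \<partial>distr lborel borel (\<lambda>x. 0 + s *\<^sub>R x))"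
    by (subst integral_density) auto
  also have "\<dots> = (\<integral>x. (\<bar>s\<bar> ^ DIM('a)) *\<^sub>R f ((0 + s *\<^sub>R x) /\<^sub>R s) \<partial>lborel)"
    by (subst integral_distr) auto
  also have "\<dots> = s ^ DIM('a) *\<^sub>R (\<integral>x. f x \<partial>lborel)"
    using \<open>s > 0\<close> by simp
  finally show ?thesis .
qed

lemma ex_max_coordinate:
  fixes \<theta> :: "real ^ 'd"
  shows "\<exists>k. (norm \<theta>)\<^sup>2 \<le> real CARD('d) * (\<theta> $ k)\<^sup>2"
proof -
  obtain k where k: "\<And>l. (\<theta> $ l)\<^sup>2 \<le> (\<theta> $ k)\<^sup>2"
    using Max_in[of "range (\<lambda>l. (\<theta> $ l)\<^sup>2)"] Max_ge[of "range (\<lambda>l. (\<theta> $ l)\<^sup>2)"]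
    by (metis (mono_tags, lifting) UNIV_not_empty empty_is_image finite finite_imageI imageE rangeI)
  have "(norm \<theta>)\<^sup>2 = (\<Sum>l\<in>UNIV. (\<theta> $ l)\<^sup>2)"
    by (simp add: norm_vec_def L2_set_def sum_nonneg)
  also have "\<dots> \<le> real CARD('d) * (\<theta> $ k)\<^sup>2"
    using sum_bounded_above[of UNIV "\<lambda>l. (\<theta> $ l)\<^sup>2", OF k] by simp
  finally show ?thesis by blast
qed

context lattice_walk
begin

text \<open>The times at which the finitely many targets are reached can be padded to a common one
  by standing still.\<close>

lemma reach_all:
  "\<exists>N>0. (conv \<nu> ^^ N) point 0 > 0 \<and> (\<forall>k. (conv \<nu> ^^ N) point (axis k 1) > 0)"
proof -
  obtain n where n: "\<And>y. (conv \<nu> ^^ n y) point y > 0" using reach by metis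
  define N where "N = Suc (n 0 + (\<Sum>k\<in>UNIV. n (axis k 1)))"
  have lazy: "(conv \<nu> ^^ N) point y > 0" if "n y \<le> N" for y
    using step_lazy[OF _ _ n[of y], of "N - n y"] that by simp
  have "n (axis k 1) \<le> N" for k
    using member_le_sum[of k UNIV "\<lambda>k. n (axis k 1)"] by (simp add: N_def)
  moreover have "N > 0" "n 0 \<le> N" by (auto simp: N_def)
  ultimately show ?thesis
    using lazy by blast
qed

lemma laplace_bounded_near:
  assumes f: "\<And>x. f x \<ge> 0" and "exp_dominated f \<alpha> \<delta>"
  shows "\<exists>W>0. \<forall>\<beta>. norm (\<beta> - \<alpha>) \<le> \<delta> \<longrightarrow> laplace f \<beta> \<le> W"
proof -
  define W where "W = (\<Sum>\<^sub>\<infinity>x. f x * tilt \<alpha> x * exp (\<delta> * norm (vreal x))) + 1"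
  have "(\<Sum>\<^sub>\<infinity>x. f x * tilt \<alpha> x * exp (\<delta> * norm (vreal x))) \<ge> 0" using f by (intro infsum_nonneg) auto
  then have "W > 0" by (simp add: W_def)
  moreover have "laplace f \<beta> \<le> W" if "norm (\<beta> - \<alpha>) \<le> \<delta>" for \<beta>
  proof -
    have "laplace f \<beta> \<le> (\<Sum>\<^sub>\<infinity>x. f x * tilt \<alpha> x * exp (\<delta> * norm (vreal x)))"
      unfolding laplace_def
    proof (rule infsum_mono)
      show "(\<lambda>x. f x * tilt \<beta> x) summable_on UNIV"
        using exp_dominated_tilt_summable[OF f assms(2) that] by (simp add: tilt_summable_def)
      show "f x * tilt \<beta> x \<le> f x * tilt \<alpha> x * exp (\<delta> * norm (vreal x))" for x
        unfolding mult.assoc by (intro mult_left_mono tilt_le_exp_norm that f)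
    qed (use assms(2) in \<open>simp add: exp_dominated_def\<close>)
    then show ?thesis by (simp add: W_def)
  qed
  ultimately show ?thesis by blast
qed

text \<open>One step of \<open>\<nu>\<close> may not charge the unit vectors, but \<open>N\<close>
  steps do, together with 0. The two-point bound is applied to the \<open>N\<close>-step kernel with
  the unit vector of the largest coordinate of \<open>\<theta>\<close>; then an \<open>N\<close>-th
  root is taken, which divides \<open>\<kappa>\<close> by \<open>N\<close>.\<close>

lemma fourier_decay:
  assumes "tilt_summable \<nu> \<alpha>0"
  shows "\<exists>\<kappa>>0. \<exists>\<delta>>0. \<forall>\<alpha>. norm (\<alpha> - \<alpha>0) \<le> \<delta> \<longrightarrow>
    tilt_summable \<nu> \<alpha> \<and> (\<forall>\<theta>\<in>torus. norm (fourier \<nu> \<alpha> \<theta>) \<le> laplace \<nu> \<alpha> * exp (- \<kappa> * (norm \<theta>)\<^sup>2))"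
proof -
  obtain d where d: "d > 0" "exp_dominated \<nu> \<alpha>0 (3 * d)" using dominated_at[OF assms] by blast
  define \<delta> where "\<delta> = min d 1"
  have \<delta>: "\<delta> > 0" "\<delta> \<le> 1" "\<delta> \<le> 3 * d" using d by (auto simp: \<delta>_def)
  obtain N where N: "N > 0" "(conv \<nu> ^^ N) point 0 > 0" "\<And>k. (conv \<nu> ^^ N) point (axis k 1) > 0"
    using reach_all by blast
  obtain W where W: "W > 0" "\<And>\<beta>. norm (\<beta> - \<alpha>0) \<le> 3 * d \<Longrightarrow> laplace \<nu> \<beta> \<le> W"
    using laplace_bounded_near[OF _ d(2)] by auto
  define f where "f = (conv \<nu> ^^ N) point"
  \<comment> \<open>A lower bound for the coefficient in \<open>norm_fourier_two_points\<close>,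
    uniform in the coordinate and in the tilts within distance 1 of
    \<open>\<alpha>0\<close>.\<close>
  define q where "q = min (f 0) (Min (range (\<lambda>k. f (axis k 1))) * exp (- (norm \<alpha>0 + 1))) / 2"
  have "q > 0"
    using N(2,3) by (auto simp: q_def f_def)
  \<comment> \<open>Chosen so that the gain
    \<open>q * (norm \<theta>)\<^sup>2 / (20 * real CARD('d))\<close> equals
    \<open>W ^ N * \<kappa> * (norm \<theta>)\<^sup>2\<close>, where \<open>W ^ N\<close> bounds the
    total mass of the \<open>N\<close>-step kernel; the gain becomes relative to that mass.\<close>
  define \<kappa> where "\<kappa> = q / (20 * real CARD('d) * W ^ N)"
  have "\<kappa> > 0" using \<open>q > 0\<close> W(1) by (simp add: \<kappa>_def)
  have "tilt_summable \<nu> \<alpha> \<and> (\<forall>\<theta>\<in>torus. norm (fourier \<nu> \<alpha> \<theta>) \<le> laplace \<nu> \<alpha> * exp (- (\<kappa> / N) * (norm \<theta>)\<^sup>2))"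
    if \<alpha>: "norm (\<alpha> - \<alpha>0) \<le> \<delta>" for \<alpha>
  proof
    show s: "tilt_summable \<nu> \<alpha>"
      by (rule exp_dominated_tilt_summable[OF _ d(2)]) (use \<alpha> \<delta> in auto)
    have Ls: "laplace \<nu> \<alpha> \<le> W" using W(2) \<alpha> \<delta> by simp
    have L0: "laplace \<nu> \<alpha> \<ge> 0" by (rule laplace_nonneg) simp
    have Lf: "laplace f \<alpha> = laplace \<nu> \<alpha> ^ N"
      unfolding f_def by (subst laplace_step) (auto simp: s)
    show "\<forall>\<theta>\<in>torus. norm (fourier \<nu> \<alpha> \<theta>) \<le> laplace \<nu> \<alpha> * exp (- (\<kappa> / N) * (norm \<theta>)\<^sup>2)"
    proof
      fix \<theta> :: "real ^ 'd" assume \<theta>: "\<theta> \<in> torus"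
      obtain k where k: "(norm \<theta>)\<^sup>2 \<le> real CARD('d) * (\<theta> $ k)\<^sup>2" using ex_max_coordinate by blast
      let ?e = "axis k 1 :: int ^ 'd"
      have "q \<le> min (f 0) (f ?e * tilt \<alpha> ?e) / 2"
      proof -
        have "\<bar>\<alpha> $ k\<bar> \<le> norm \<alpha>0 + 1"
          using component_le_norm_cart[of \<alpha> k] norm_triangle_ineq2[of \<alpha> \<alpha>0] \<alpha> \<delta> by linarith
        then have "exp (- (norm \<alpha>0 + 1)) \<le> tilt \<alpha> ?e"
          by (simp add: tilt_def inner_axis)
        then have "Min (range (\<lambda>k. f (axis k 1))) * exp (- (norm \<alpha>0 + 1)) \<le> f ?e * tilt \<alpha> ?e"
          using N(3) by (intro mult_mono) (auto simp: f_def intro: less_imp_le)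
        then show ?thesis by (auto simp: q_def)
      qed
      moreover have "1 - cos (\<theta> \<bullet> vreal ?e) \<ge> (\<theta> $ k)\<^sup>2 / 20"
        using one_minus_cos_ge[of "\<theta> $ k"] \<theta> by (simp add: mem_torus inner_axis)
      moreover have "(\<theta> $ k)\<^sup>2 / 20 \<ge> (norm \<theta>)\<^sup>2 / (20 * real CARD('d))"
        using k by (simp add: field_simps)
      ultimately have "q * ((norm \<theta>)\<^sup>2 / (20 * real CARD('d))) \<le> min (f 0) (f ?e * tilt \<alpha> ?e) / 2 * (1 - cos (\<theta> \<bullet> vreal ?e))"
        using \<open>q > 0\<close> by (intro mult_mono) auto
      moreover have "norm (fourier f \<alpha> \<theta>) \<le> laplace f \<alpha> - min (f 0) (f ?e * tilt \<alpha> ?e) / 2 * (1 - cos (\<theta> \<bullet> vreal ?e))"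
        using N s by (intro norm_fourier_two_points) (auto simp: f_def step_nonneg tilt_summable_step axis_eq_0_iff)
      ultimately have "norm (fourier f \<alpha> \<theta>) \<le> laplace f \<alpha> - q * ((norm \<theta>)\<^sup>2 / (20 * real CARD('d)))"
        by linarith
      also have "q * ((norm \<theta>)\<^sup>2 / (20 * real CARD('d))) = W ^ N * (\<kappa> * (norm \<theta>)\<^sup>2)"
        using W(1) by (simp add: \<kappa>_def)
      also have "laplace f \<alpha> - W ^ N * (\<kappa> * (norm \<theta>)\<^sup>2) \<le> laplace f \<alpha> - laplace f \<alpha> * (\<kappa> * (norm \<theta>)\<^sup>2)"
        unfolding Lf using \<open>\<kappa> > 0\<close> Ls L0 by (intro diff_left_mono mult_right_mono power_mono) auto
      also have "\<dots> = laplace f \<alpha> * (1 + (- (\<kappa> * (norm \<theta>)\<^sup>2)))" by (simp add: algebra_simps)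
      also have "\<dots> \<le> laplace f \<alpha> * exp (- (\<kappa> * (norm \<theta>)\<^sup>2))"
        using L0 by (intro mult_left_mono exp_ge_add_one_self) (simp add: Lf)
      also have "exp (- (\<kappa> * (norm \<theta>)\<^sup>2)) = exp (- (\<kappa> / N) * (norm \<theta>)\<^sup>2) ^ N"
        using N(1) by (simp flip: exp_of_nat_mult)
      also have "norm (fourier f \<alpha> \<theta>) = norm (fourier \<nu> \<alpha> \<theta>) ^ N"
        unfolding f_def by (subst fourier_step) (auto simp: s norm_power)
      finally have "norm (fourier \<nu> \<alpha> \<theta>) ^ N \<le> (laplace \<nu> \<alpha> * exp (- (\<kappa> / N) * (norm \<theta>)\<^sup>2)) ^ N"
        by (simp add: Lf power_mult_distrib)
      then show "norm (fourier \<nu> \<alpha> \<theta>) \<le> laplace \<nu> \<alpha> * exp (- (\<kappa> / N) * (norm \<theta>)\<^sup>2)"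
        using L0 N(1) by (subst (asm) power_mono_iff) auto
    qed
  qed
  then show ?thesis
    using \<open>\<kappa> > 0\<close> N(1) \<delta>(1) by (intro exI[of _ "\<kappa> / N"] conjI exI[of _ \<delta>]) auto
qed

section \<open>A uniform bound for the masses after \<open>n\<close> steps\<close>

abbreviation a :: "nat \<Rightarrow> int ^ 'd \<Rightarrow> real" where
  "a n \<equiv> (conv \<nu> ^^ n) b"

lemma a_nonneg [simp]: "a n x \<ge> 0"
  by (rule step_nonneg) simp

lemma a_inversion:
  assumes "tilt_summable \<nu> \<alpha>"
  shows "of_real ((2 * pi) ^ CARD('d) * (a n x * tilt \<alpha> x)) =
    (\<integral>\<theta>. indicator torus \<theta> *\<^sub>R (cis (- (\<theta> \<bullet> vreal x)) * (fourier \<nu> \<alpha> \<theta> ^ n * fourier b \<alpha> \<theta>)) \<partial>lborel)"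
  using fourier_inversion[of "a n" \<alpha> x] assms
  by (simp add: fourier_step tilt_summable_step b_summable)

lemma a_integrand_measurable:
  assumes "tilt_summable \<nu> \<alpha>"
  shows "(\<lambda>\<theta>. indicator torus \<theta> *\<^sub>R (cis (- (\<theta> \<bullet> vreal x)) * (fourier \<nu> \<alpha> \<theta> ^ n * fourier b \<alpha> \<theta>))) \<in> borel_measurable borel"
proof -
  note [measurable] = fourier_measurable[OF nu_nonneg assms] fourier_measurable[OF b_nonneg b_summable[OF assms]]
  show ?thesis by measurable
qed

text \<open>Inversion and Gaussian decay, rescaled by \<open>sqrt n\<close>. The factor
  \<open>laplace \<nu> \<alpha> ^ n\<close> is kept because the bound is used later at tilts where
  the transform is not 1.\<close>

lemma a_bound:
  assumes "tilt_summable \<nu> \<alpha>0"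
  shows "\<exists>C>0. \<exists>\<delta>>0. \<forall>\<alpha> n x. norm (\<alpha> - \<alpha>0) \<le> \<delta> \<longrightarrow>
    a n x * tilt \<alpha> x \<le> C * laplace \<nu> \<alpha> ^ n * max 1 (real n) powr (- real CARD('d) / 2)"
proof -
  obtain \<kappa> d1 where k: "\<kappa> > 0" "d1 > 0" "\<And>\<alpha>. norm (\<alpha> - \<alpha>0) \<le> d1 \<Longrightarrow> tilt_summable \<nu> \<alpha>"
    "\<And>\<alpha> \<theta>. norm (\<alpha> - \<alpha>0) \<le> d1 \<Longrightarrow> \<theta> \<in> torus \<Longrightarrow> norm (fourier \<nu> \<alpha> \<theta>) \<le> laplace \<nu> \<alpha> * exp (- \<kappa> * (norm \<theta>)\<^sup>2)"
    using fourier_decay[OF assms] by blast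
  obtain d2 where d2: "d2 > 0" "exp_dominated b \<alpha>0 (3 * d2)" using dominated_at[OF assms] by blast
  obtain B where B: "B > 0" "\<And>\<beta>. norm (\<beta> - \<alpha>0) \<le> 3 * d2 \<Longrightarrow> laplace b \<beta> \<le> B"
    using laplace_bounded_near[OF _ d2(2)] by auto
  define \<delta> where "\<delta> = min d1 (3 * d2)"
  define I where "I = integral\<^sup>L lborel (\<lambda>\<eta>::real^'d. exp (- \<kappa> * (norm \<eta>)\<^sup>2))"
  have "I \<ge> 0" unfolding I_def by (intro integral_nonneg_AE) auto
  \<comment> \<open>The summand \<open>B * I\<close> serves \<open>n > 0\<close>, with
    \<open>I\<close> the Gaussian integral; the extra \<open>B\<close> covers \<open>n = 0\<close>,
    where \<open>a 0\<close> is \<open>b\<close> itself.\<close>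
  define C where "C = B * (I + 1)"
  have "C > 0" using B \<open>I \<ge> 0\<close> by (simp add: C_def)
  have "a n x * tilt \<alpha> x \<le> C * laplace \<nu> \<alpha> ^ n * max 1 (real n) powr (- real CARD('d) / 2)"
    if "norm (\<alpha> - \<alpha>0) \<le> \<delta>" for \<alpha> n x
  proof -
    have \<alpha>: "norm (\<alpha> - \<alpha>0) \<le> d1" "norm (\<alpha> - \<alpha>0) \<le> 3 * d2" using that by (auto simp: \<delta>_def)
    have s: "tilt_summable \<nu> \<alpha>" using k(3) \<alpha> by blast
    have L0: "laplace \<nu> \<alpha> \<ge> 0" by (rule laplace_nonneg) simp
    have Lb: "0 \<le> laplace b \<alpha>" "laplace b \<alpha> \<le> B" using B(2)[OF \<alpha>(2)] by (auto intro: laplace_nonneg)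
    show ?thesis
    proof (cases "n = 0")
      case True
      have "b x * tilt \<alpha> x \<le> laplace b \<alpha>"
        by (intro tilt_term_le_laplace b_summable s) auto
      also have "\<dots> \<le> C" using Lb(2) mult_nonneg_nonneg[OF less_imp_le[OF B(1)] \<open>I \<ge> 0\<close>] unfolding C_def ring_distribs by linarith
      finally show ?thesis using True by simp
    next
      case False
      let ?J = "\<lambda>\<theta>::real^'d. laplace \<nu> \<alpha> ^ n * B * exp (- \<kappa> * (norm (\<theta> /\<^sub>R (1 / sqrt n)))\<^sup>2)"
      have "integrable lborel (\<lambda>\<theta>::real^'d. exp (- (\<kappa> * n) * (norm \<theta>)\<^sup>2))"
        using k(1) False by (intro integrable_gaussian) auto
      also have "(\<lambda>\<theta>::real^'d. exp (- (\<kappa> * n) * (norm \<theta>)\<^sup>2)) = (\<lambda>\<theta>. exp (- \<kappa> * (norm (\<theta> /\<^sub>R (1 / sqrt n)))\<^sup>2))"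
        by (auto simp: power_mult_distrib)
      finally have int: "integrable lborel (?J :: real ^ 'd \<Rightarrow> real)"
        by (rule integrable_mult_right)
      have le: "norm (indicator torus \<theta> *\<^sub>R (cis (- (\<theta> \<bullet> vreal x)) * (fourier \<nu> \<alpha> \<theta> ^ n * fourier b \<alpha> \<theta>))) \<le> ?J \<theta>" for \<theta>
      proof (cases "\<theta> \<in> torus")
        case True
        have "norm (fourier \<nu> \<alpha> \<theta>) ^ n * norm (fourier b \<alpha> \<theta>) \<le> (laplace \<nu> \<alpha> * exp (- \<kappa> * (norm \<theta>)\<^sup>2)) ^ n * B"
          using k(4)[OF \<alpha>(1) True] norm_fourier_le[OF b_nonneg b_summable[OF s], of \<theta>] Lb L0
          by (intro mult_mono power_mono) auto
        also have "\<dots> = laplace \<nu> \<alpha> ^ n * B * exp (- \<kappa> * (norm \<theta>)\<^sup>2) ^ n"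
          by (simp add: power_mult_distrib)
        also have "exp (- \<kappa> * (norm \<theta>)\<^sup>2) ^ n = exp (- \<kappa> * (norm (\<theta> /\<^sub>R (1 / sqrt n)))\<^sup>2)"
          using False by (simp add: power_mult_distrib algebra_simps flip: exp_of_nat_mult)
        finally show ?thesis using True by (simp add: norm_mult norm_power)
      qed (use L0 B in auto)
      have int2: "integrable lborel (\<lambda>\<theta>. indicator torus \<theta> *\<^sub>R (cis (- (\<theta> \<bullet> vreal x)) * (fourier \<nu> \<alpha> \<theta> ^ n * fourier b \<alpha> \<theta>)))"
        by (rule Bochner_Integration.integrable_bound[OF int])
          (use a_integrand_measurable[OF s] order_trans[OF le abs_ge_self] in simp_all)
      have "a n x * tilt \<alpha> x \<le> (2 * pi) ^ CARD('d) * (a n x * tilt \<alpha> x)"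
      proof -
        have "1 \<le> (2 * pi) ^ CARD('d)" using pi_gt3 by (intro one_le_power) simp
        from mult_right_mono[OF this, of "a n x * tilt \<alpha> x"] show ?thesis by simp
      qed
      also have "\<dots> = norm (complex_of_real ((2 * pi) ^ CARD('d) * (a n x * tilt \<alpha> x)))"
        by (subst norm_of_real) auto
      also have "\<dots> \<le> (\<integral>\<theta>. ?J \<theta> \<partial>lborel)"
        unfolding a_inversion[OF s]
        by (rule Bochner_Integration.integral_norm_bound_integral[OF int2 int]) (rule le)
      also have "\<dots> = laplace \<nu> \<alpha> ^ n * B * ((1 / sqrt n) ^ CARD('d) * I)"
      proof -
        have "(\<integral>x. exp (- \<kappa> * (norm ((x::real^'d) /\<^sub>R (1 / sqrt n)))\<^sup>2) \<partial>lborel) = (1 / sqrt n) ^ DIM(real^'d) *\<^sub>R I"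
          unfolding I_def by (rule lborel_integral_scale) (use False in auto)
        then show ?thesis
          by (simp only: integral_mult_right_zero DIM_cart DIM_real mult_1_right real_scaleR_def)
      qed
      also have "(1 / sqrt n) ^ CARD('d) = max 1 (real n) powr (- real CARD('d) / 2)"
      proof -
        have "(1 / sqrt n) ^ CARD('d) = inverse (sqrt n powr real CARD('d))"
          using False by (subst powr_realpow) (auto simp: power_one_over inverse_eq_divide)
        also have "sqrt n powr real CARD('d) = real n powr (1 / 2 * real CARD('d))"
          by (simp only: powr_half_sqrt[OF of_nat_0_le_iff, symmetric] powr_powr)
        also have "inverse (real n powr (1 / 2 * real CARD('d))) = real n powr (- real CARD('d) / 2)"
          by (simp only: powr_minus[symmetric]) simp
        finally have "(1 / sqrt n) ^ CARD('d) = real n powr (- real CARD('d) / 2)" .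
        then show ?thesis using False by (simp add: max_def)
      qed
      also have "laplace \<nu> \<alpha> ^ n * B * (max 1 (real n) powr (- real CARD('d) / 2) * I) \<le> C * laplace \<nu> \<alpha> ^ n * max 1 (real n) powr (- real CARD('d) / 2)"
        using B(1) L0 by (simp add: C_def algebra_simps)
      finally show ?thesis .
    qed
  qed
  moreover have "\<delta> > 0" using k d2 by (simp add: \<delta>_def)
  ultimately show ?thesis using \<open>C > 0\<close> by blast
qed

end

section \<open>A local limit theorem\<close>

lemma norm_cis_taylor_1: "norm (cis y - 1 - \<i> * of_real y) \<le> y\<^sup>2 / 2"
  using iexp_approx1[of y 1] by (simp add: cis_conv_exp numeral_2_eq_2 diff_diff_eq)

lemma norm_cis_taylor_2: "norm (cis y - 1 - \<i> * of_real y - of_real (- y\<^sup>2 / 2)) \<le> \<bar>y\<bar> ^ 3"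
proof -
  have sum: "(\<Sum>k\<le>2. (\<i> * complex_of_real y) ^ k / fact k) = 1 + \<i> * of_real y + of_real (- y\<^sup>2 / 2)"
    by (simp add: numeral_2_eq_2 power2_eq_square algebra_simps)
  have "cis y - 1 - \<i> * of_real y - of_real (- y\<^sup>2 / 2) = iexp y - (1 + \<i> * of_real y + of_real (- y\<^sup>2 / 2))"
    by (simp add: cis_conv_exp algebra_simps)
  then have "norm (cis y - 1 - \<i> * of_real y - of_real (- y\<^sup>2 / 2)) = norm (iexp y - (1 + \<i> * of_real y + of_real (- y\<^sup>2 / 2)))"
    by (simp only:)
  also have "\<dots> \<le> \<bar>y\<bar> ^ Suc 2 / fact (Suc 2)"
    using iexp_approx1[of y 2] unfolding sum .
  also have "\<dots> \<le> \<bar>y\<bar> ^ 3"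
    by (simp add: divide_le_eq fact_numeral)
  finally show ?thesis .
qed

text \<open>Compare with the powers of \<open>w k = exp (\<zeta> / n k)\<close>: in the unit disc
  \<open>n\<close>-th powers differ by at most \<open>n\<close> times the difference of the bases.
  No complex logarithm appears.\<close>

lemma power_tendsto_exp:
  fixes z :: "nat \<Rightarrow> complex" and n :: "nat \<Rightarrow> nat" and \<zeta> :: real
  assumes z: "\<And>k. norm (z k) \<le> 1" and n: "filterlim n at_top sequentially" and "\<zeta> \<le> 0"
    and lim: "(\<lambda>k. of_nat (n k) * (z k - 1)) \<longlonglongrightarrow> of_real \<zeta>"
  shows "(\<lambda>k. z k ^ n k) \<longlonglongrightarrow> of_real (exp \<zeta>)"
proof -
  have nr: "filterlim (\<lambda>k. real (n k)) at_top sequentially"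
    using n filterlim_compose filterlim_real_sequentially by blast
  define w where "w k = exp (\<zeta> / real (n k))" for k
  have pos: "eventually (\<lambda>k. n k > 0) sequentially"
    using filterlim_at_top_dense[THEN iffD1, OF nr, rule_format, of 0] by simp
  have w1: "(\<lambda>k. real (n k) * (w k - 1)) \<longlonglongrightarrow> \<zeta>"
  proof (rule tendsto_sandwich)
    show "eventually (\<lambda>k. \<zeta> \<le> real (n k) * (w k - 1)) sequentially"
      using pos
    proof eventually_elim
      case (elim k)
      have "\<zeta> = real (n k) * (\<zeta> / real (n k))" using elim by simp
      also have "\<zeta> / real (n k) \<le> w k - 1"
        using exp_ge_add_one_self[of "\<zeta> / real (n k)"] unfolding w_def by linarith
      then have "real (n k) * (\<zeta> / real (n k)) \<le> real (n k) * (w k - 1)"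
        by (intro mult_left_mono) auto
      finally show ?case .
    qed
    show "eventually (\<lambda>k. real (n k) * (w k - 1) \<le> \<zeta> + \<zeta>\<^sup>2 * exp \<bar>\<zeta>\<bar> * inverse (real (n k))) sequentially"
      using pos
    proof eventually_elim
      case (elim k)
      let ?v = "\<zeta> / real (n k)"
      have "\<bar>?v\<bar> \<le> \<bar>\<zeta>\<bar>" using mult_left_mono[of 1 "real (n k)" "\<bar>\<zeta>\<bar>"] elim by (simp add: field_simps)
      then have "exp \<bar>?v\<bar> \<le> exp \<bar>\<zeta>\<bar>" by simp
      then have "w k - 1 \<le> ?v + ?v\<^sup>2 * exp \<bar>\<zeta>\<bar>"
        using exp_le_quadratic[of ?v] mult_left_mono[of "exp \<bar>?v\<bar>" "exp \<bar>\<zeta>\<bar>" "?v\<^sup>2"] by (simp add: w_def)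
      then have "real (n k) * (w k - 1) \<le> real (n k) * (?v + ?v\<^sup>2 * exp \<bar>\<zeta>\<bar>)"
        by (intro mult_left_mono) auto
      also have "\<dots> = \<zeta> + \<zeta>\<^sup>2 * exp \<bar>\<zeta>\<bar> * inverse (real (n k))"
        using elim by (simp add: field_simps power2_eq_square)
      finally show ?case .
    qed
    have "(\<lambda>k. \<zeta> + \<zeta>\<^sup>2 * exp \<bar>\<zeta>\<bar> * inverse (real (n k))) \<longlonglongrightarrow> \<zeta> + \<zeta>\<^sup>2 * exp \<bar>\<zeta>\<bar> * 0"
      by (intro tendsto_intros filterlim_compose[OF tendsto_inverse_0_at_top nr] tendsto_inverse_0_at_top nr)
    then show "(\<lambda>k. \<zeta> + \<zeta>\<^sup>2 * exp \<bar>\<zeta>\<bar> * inverse (real (n k))) \<longlonglongrightarrow> \<zeta>" by simp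
  qed auto
  have "(\<lambda>k. norm (of_nat (n k) * (z k - 1) - of_real (real (n k) * (w k - 1)))) \<longlonglongrightarrow> norm (complex_of_real \<zeta> - of_real \<zeta>)"
    by (intro tendsto_intros lim w1)
  then have d0: "(\<lambda>k. norm (of_nat (n k) * (z k - 1) - of_real (real (n k) * (w k - 1)))) \<longlonglongrightarrow> 0" by simp
  have "(\<lambda>k. z k ^ n k - of_real (w k) ^ n k) \<longlonglongrightarrow> 0"
  proof (rule Lim_null_comparison[OF always_eventually d0], rule allI)
    fix k
    have "norm (z k ^ n k - of_real (w k) ^ n k) \<le> n k * norm (z k - of_real (w k))"
      using z \<open>\<zeta> \<le> 0\<close> by (intro norm_power_diff) (auto simp: w_def divide_nonpos_nonneg)
    also have "\<dots> = norm (of_nat (n k) * (z k - 1) - of_real (real (n k) * (w k - 1)))"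
    proof -
      have "of_nat (n k) * (z k - 1) - of_real (real (n k) * (w k - 1)) = of_nat (n k) * (z k - of_real (w k))"
        by (simp add: algebra_simps)
      then show ?thesis by (simp add: norm_mult)
    qed
    finally show "norm (z k ^ n k - of_real (w k) ^ n k) \<le> norm (of_nat (n k) * (z k - 1) - of_real (real (n k) * (w k - 1)))" .
  qed
  moreover have "eventually (\<lambda>k. complex_of_real (w k) ^ n k = of_real (exp \<zeta>)) sequentially"
    using pos
  proof eventually_elim
    case (elim k)
    then have "w k ^ n k = exp \<zeta>" by (simp add: w_def flip: exp_of_nat_mult)
    then show ?case by (metis of_real_power)
  qed
  ultimately have "(\<lambda>k. z k ^ n k - of_real (exp \<zeta>)) \<longlonglongrightarrow> 0"
    by (elim Lim_transform_eventually) (auto elim: eventually_mono)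
  then show ?thesis by (simp add: LIM_zero_iff)
qed

context lattice_walk
begin

lemma tendsto_mean:
  assumes "tilt_summable \<nu> c" "cs \<longlonglongrightarrow> c"
  shows "(\<lambda>k. mean (cs k)) \<longlonglongrightarrow> mean c"
proof -
  obtain \<delta> where d: "\<delta> > 0" "exp_dominated \<nu> c \<delta>" using nu_dominated[OF assms(1)] by blast
  show ?thesis
    unfolding mean_def
    by (rule exp_dominated_tendsto[OF nu_nonneg d(2,1) assms(2), where C = "1 / (\<delta> / 2)"])
      (use power_le_exp[of _ "\<delta> / 2" 1] d in \<open>auto intro!: always_eventually\<close>)
qed

text \<open>When the transform at \<open>c\<close> is 1, the variance of
  \<open>\<eta> \<bullet> X\<close> for a step \<open>X\<close> of the tilted walk.\<close>

definition cov :: "real ^ 'd \<Rightarrow> real ^ 'd \<Rightarrow> real" where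
  "cov c \<eta> = (\<Sum>\<^sub>\<infinity>x. \<nu> x * tilt c x * (\<eta> \<bullet> (vreal x - mean c))\<^sup>2)"

lemma cov_nonneg: "cov c \<eta> \<ge> 0"
  unfolding cov_def by (intro infsum_nonneg) auto

text \<open>Second-order expansion of the centred characteristic function at scale
  \<open>sqrt (t k)\<close>, with the tilt moving as well. Centring removes the linear term, and
  dominated convergence treats the rest termwise.\<close>

lemma char_expansion:
  assumes c: "tilt_summable \<nu> c" and cs: "cs \<longlonglongrightarrow> c" "\<And>k. tilt_summable \<nu> (cs k)" "\<And>k. laplace \<nu> (cs k) = 1"
    and t: "filterlim t at_top sequentially" "\<And>k. t k > 0"
  shows "(\<lambda>k. of_real (t k) * (cis (- (\<eta> \<bullet> mean (cs k)) / sqrt (t k)) * fourier \<nu> (cs k) (\<eta> /\<^sub>R sqrt (t k)) - 1))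
    \<longlonglongrightarrow> of_real (- cov c \<eta> / 2)"
proof -
  obtain \<delta> where d: "\<delta> > 0" "exp_dominated \<nu> c \<delta>" using nu_dominated[OF c] by blast
  define \<tau> where "\<tau> k x = \<eta> \<bullet> (vreal x - mean (cs k))" for k x
  define y where "y k x = \<tau> k x / sqrt (t k)" for k x
  define q where "q k x = complex_of_real (t k) * (cis (y k x) - 1 - \<i> * of_real (y k x))" for k x
  define r where "r x = complex_of_real (- (\<eta> \<bullet> (vreal x - mean c))\<^sup>2 / 2)" for x
  have tyy: "t k * (y k x)\<^sup>2 = (\<tau> k x)\<^sup>2" for k x
    using t(2)[of k] by (simp add: y_def power_divide)
  have m: "(\<lambda>k. mean (cs k)) \<longlonglongrightarrow> mean c" by (rule tendsto_mean[OF c cs(1)])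
  obtain M where M: "\<And>k. norm (mean (cs k)) \<le> M"
    using convergent_imp_Bseq[OF convergentI[OF m]] by (auto simp: Bseq_def)
  then have Mc: "norm (mean c) \<le> M"
    by (intro LIMSEQ_le_const2[OF tendsto_norm[OF m]]) auto
  \<comment> \<open>From \<open>power_le_exp\<close> with exponent 2 and rate
    \<open>\<delta> / 2\<close>, applied to \<open>norm (vreal x) + M\<close>; the growth rate is
    the one that \<open>exp_dominated_tendsto\<close> admits.\<close>
  define C where "C = (norm \<eta>)\<^sup>2 * (2 / (\<delta> / 2)\<^sup>2 * exp (\<delta> / 2 * M))"
  have sq: "(\<eta> \<bullet> (vreal x - v))\<^sup>2 \<le> C * exp (\<delta> / 2 * norm (vreal x))" if "norm v \<le> M" for x v
  proof -
    have "\<bar>\<eta> \<bullet> (vreal x - v)\<bar> \<le> norm \<eta> * norm (vreal x - v)" by (rule Cauchy_Schwarz_ineq2)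
    also have "\<dots> \<le> norm \<eta> * (norm (vreal x) + M)"
      using norm_triangle_ineq4[of "vreal x" v] that by (intro mult_left_mono) auto
    finally have "\<bar>\<eta> \<bullet> (vreal x - v)\<bar>\<^sup>2 \<le> (norm \<eta> * (norm (vreal x) + M))\<^sup>2" by (intro power_mono) auto
    then have "(\<eta> \<bullet> (vreal x - v))\<^sup>2 \<le> (norm \<eta>)\<^sup>2 * (norm (vreal x) + M)\<^sup>2" by (simp add: power_mult_distrib)
    also have "\<dots> \<le> (norm \<eta>)\<^sup>2 * (2 / (\<delta> / 2)\<^sup>2 * exp (\<delta> / 2 * (norm (vreal x) + M)))"
      using power_le_exp[of "norm (vreal x) + M" "\<delta> / 2" 2] d(1) that
      by (intro mult_left_mono) (auto intro: add_nonneg_nonneg order_trans[OF norm_ge_zero])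
    also have "\<dots> = C * exp (\<delta> / 2 * norm (vreal x))"
      by (simp add: C_def ring_distribs exp_add)
    finally show ?thesis .
  qed
  have eq: "of_real (t k) * (cis (- (\<eta> \<bullet> mean (cs k)) / sqrt (t k)) * fourier \<nu> (cs k) (\<eta> /\<^sub>R sqrt (t k)) - 1)
      = (\<Sum>\<^sub>\<infinity>x. (\<nu> x * tilt (cs k) x) *\<^sub>R q k x)" for k
  proof -
    let ?\<beta> = "\<eta> /\<^sub>R sqrt (t k)" and ?p = "\<lambda>x. \<nu> x * tilt (cs k) x"
    have yb: "y k x = ?\<beta> \<bullet> vreal x - ?\<beta> \<bullet> mean (cs k)" for x
      by (simp add: y_def \<tau>_def inner_diff_right divide_inverse mult.commute right_diff_distrib)
    have p: "(?p has_sum 1) UNIV"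
      using has_sum_infsum[OF cs(2)[of k, unfolded tilt_summable_def]] cs(3)[of k] by (simp add: laplace_def)
    have A: "((\<lambda>x. complex_of_real (?p x) * cis (y k x)) has_sum (cis (- (?\<beta> \<bullet> mean (cs k))) * fourier \<nu> (cs k) ?\<beta>)) UNIV"
    proof -
      have "((\<lambda>x. cis (- (?\<beta> \<bullet> mean (cs k))) * (complex_of_real (?p x) * cis (?\<beta> \<bullet> vreal x))) has_sum
         (cis (- (?\<beta> \<bullet> mean (cs k))) * fourier \<nu> (cs k) ?\<beta>)) UNIV"
        unfolding fourier_def by (intro has_sum_cmult_right has_sum_infsum fourier_summable cs)
      moreover have "cis (- (?\<beta> \<bullet> mean (cs k))) * (complex_of_real (?p x) * cis (?\<beta> \<bullet> vreal x)) = complex_of_real (?p x) * cis (y k x)" for x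
        by (simp add: yb cis_mult[symmetric] mult_ac flip: cis_mult) (simp add: cis_mult mult_ac)
      ultimately show ?thesis by (simp only:)
    qed
    have B: "((\<lambda>x. complex_of_real (?p x)) has_sum 1) UNIV"
      using has_sum_of_real[OF p, where 'a = complex] by simp
    \<comment> \<open>The phases \<open>y k x\<close> are centred at the mean of the tilted
      probability, so their average vanishes; hence the linear term may be subtracted in
      \<open>q\<close>.\<close>
    have E: "((\<lambda>x. ?p x * y k x) has_sum 0) UNIV"
    proof -
      have "((\<lambda>x. ?p x * (?\<beta> \<bullet> vreal x) + ?p x * (- (?\<beta> \<bullet> mean (cs k)))) has_sum (?\<beta> \<bullet> mean (cs k) + 1 * (- (?\<beta> \<bullet> mean (cs k))))) UNIV"
        by (intro has_sum_add has_sum_cmult_left inner_mean cs p)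
      then show ?thesis by (simp add: yb algebra_simps)
    qed
    have "((\<lambda>x. of_real (t k) * (complex_of_real (?p x) * cis (y k x) + (- 1) * complex_of_real (?p x) + (- \<i>) * complex_of_real (?p x * y k x)))
       has_sum (of_real (t k) * (cis (- (?\<beta> \<bullet> mean (cs k))) * fourier \<nu> (cs k) ?\<beta> + (- 1) * 1 + (- \<i>) * 0))) UNIV"
      using has_sum_of_real[OF E, where 'a = complex]
      by (intro has_sum_cmult_right has_sum_add A B) auto
    moreover have "of_real (t k) * (complex_of_real (?p x) * cis (y k x) + (- 1) * complex_of_real (?p x) + (- \<i>) * complex_of_real (?p x * y k x))
        = ?p x *\<^sub>R q k x" for x
      by (simp add: q_def scaleR_conv_of_real algebra_simps)
    ultimately have "((\<lambda>x. ?p x *\<^sub>R q k x) has_sum (of_real (t k) * (cis (- (?\<beta> \<bullet> mean (cs k))) * fourier \<nu> (cs k) ?\<beta> - 1))) UNIV"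
      by simp
    then show ?thesis by (simp add: infsumI divide_inverse mult.commute)
  qed
  have "(\<lambda>k. \<Sum>\<^sub>\<infinity>x. (\<nu> x * tilt (cs k) x) *\<^sub>R q k x) \<longlonglongrightarrow> (\<Sum>\<^sub>\<infinity>x. (\<nu> x * tilt c x) *\<^sub>R r x)"
  proof (rule exp_dominated_tendsto[OF nu_nonneg d(2,1) cs(1)])
    fix x
    have \<tau>: "(\<lambda>k. \<tau> k x) \<longlonglongrightarrow> \<eta> \<bullet> (vreal x - mean c)"
      unfolding \<tau>_def by (intro tendsto_intros m)
    have "(\<lambda>k. q k x - of_real (- (\<tau> k x)\<^sup>2 / 2)) \<longlonglongrightarrow> 0"
    proof (rule Lim_null_comparison[OF always_eventually])
      show "\<forall>k. norm (q k x - of_real (- (\<tau> k x)\<^sup>2 / 2)) \<le> \<bar>\<tau> k x\<bar> ^ 3 * inverse (sqrt (t k))"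
      proof
        fix k
        have "q k x - of_real (- (\<tau> k x)\<^sup>2 / 2) = of_real (t k) * (cis (y k x) - 1 - \<i> * of_real (y k x) - of_real (- (y k x)\<^sup>2 / 2))"
          unfolding tyy[symmetric] q_def by (simp add: algebra_simps)
        also have "norm \<dots> \<le> t k * \<bar>y k x\<bar> ^ 3"
          unfolding norm_mult using t(2)[of k] norm_cis_taylor_2[of "y k x"] by (simp add: mult_left_mono)
        also have "\<dots> = \<bar>\<tau> k x\<bar> ^ 3 * inverse (sqrt (t k))"
          using t(2)[of k] by (simp add: y_def power_divide field_simps power3_eq_cube)
        finally show "norm (q k x - of_real (- (\<tau> k x)\<^sup>2 / 2)) \<le> \<bar>\<tau> k x\<bar> ^ 3 * inverse (sqrt (t k))" .
      qed
      have "(\<lambda>k. \<bar>\<tau> k x\<bar> ^ 3 * inverse (sqrt (t k))) \<longlonglongrightarrow> \<bar>\<eta> \<bullet> (vreal x - mean c)\<bar> ^ 3 * 0"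
        by (intro tendsto_intros \<tau> tendsto_inverse_0_at_top filterlim_compose[OF sqrt_at_top t(1)])
      then show "(\<lambda>k. \<bar>\<tau> k x\<bar> ^ 3 * inverse (sqrt (t k))) \<longlonglongrightarrow> 0" by simp
    qed
    moreover have "(\<lambda>k. complex_of_real (- (\<tau> k x)\<^sup>2 / 2)) \<longlonglongrightarrow> r x"
      unfolding r_def by (intro tendsto_intros \<tau>) auto
    ultimately have "(\<lambda>k. (q k x - of_real (- (\<tau> k x)\<^sup>2 / 2)) + of_real (- (\<tau> k x)\<^sup>2 / 2)) \<longlonglongrightarrow> 0 + r x"
      by (rule tendsto_add)
    then show "(\<lambda>k. q k x) \<longlonglongrightarrow> r x" by simp
  next
    have "norm (q k x) \<le> C * exp (\<delta> / 2 * norm (vreal x))" for k x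
    proof -
      have "norm (q k x) \<le> t k * ((y k x)\<^sup>2 / 2)"
        unfolding q_def norm_mult using t(2)[of k] norm_cis_taylor_1[of "y k x"] by (simp add: mult_left_mono)
      also have "\<dots> \<le> (\<tau> k x)\<^sup>2" using tyy[of k x] by (simp add: field_simps)
      also have "\<dots> \<le> C * exp (\<delta> / 2 * norm (vreal x))" unfolding \<tau>_def by (rule sq[OF M])
      finally show ?thesis .
    qed
    then show "eventually (\<lambda>k. \<forall>x. norm (q k x) \<le> C * exp (\<delta> / 2 * norm (vreal x))) sequentially" by simp
  qed
  also have "(\<Sum>\<^sub>\<infinity>x. (\<nu> x * tilt c x) *\<^sub>R r x) = of_real (- cov c \<eta> / 2)"
  proof -
    have "(\<lambda>x. \<nu> x * tilt c x * (\<eta> \<bullet> (vreal x - mean c))\<^sup>2) summable_on UNIV"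
    proof (rule summable_on_comparison_test[OF summable_on_cmult_right[OF d(2)[unfolded exp_dominated_def], of C]])
      fix x :: "int ^ 'd"
      have "C \<ge> 0" by (simp add: C_def)
      moreover have "exp (\<delta> / 2 * norm (vreal x)) \<le> exp (\<delta> * norm (vreal x))" using d(1) by simp
      ultimately have "C * exp (\<delta> / 2 * norm (vreal x)) \<le> C * exp (\<delta> * norm (vreal x))"
        by (intro mult_left_mono)
      then have "(\<eta> \<bullet> (vreal x - mean c))\<^sup>2 \<le> C * exp (\<delta> * norm (vreal x))"
        using sq[OF Mc, of x] by linarith
      then show "\<nu> x * tilt c x * (\<eta> \<bullet> (vreal x - mean c))\<^sup>2 \<le> C * (\<nu> x * tilt c x * exp (\<delta> * norm (vreal x)))"
        using mult_left_mono[of _ _ "\<nu> x * tilt c x"] by (fastforce simp: mult_ac)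
    qed auto
    then have "((\<lambda>x. (- 1 / 2) * (\<nu> x * tilt c x * (\<eta> \<bullet> (vreal x - mean c))\<^sup>2)) has_sum (- 1 / 2) * cov c \<eta>) UNIV"
      unfolding cov_def by (intro has_sum_cmult_right has_sum_infsum)
    from has_sum_of_real[OF this, where 'a = complex] show ?thesis
      by (intro infsumI) (simp add: r_def scaleR_conv_of_real field_simps)
  qed
  finally show ?thesis unfolding eq .
qed

text \<open>After rescaling by \<open>sqrt (t k)\<close> the integrand converges pointwise below a
  Gaussian. Integrability of the limit is recorded too, since the limit integral is itself studied
  later.\<close>

lemma local_limit:
  assumes c: "tilt_summable \<nu> c" and cs: "cs \<longlonglongrightarrow> c" "\<And>k. tilt_summable \<nu> (cs k)" "\<And>k. laplace \<nu> (cs k) = 1"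
    and t: "filterlim t at_top sequentially" "\<And>k. t k > 0"
    and n: "(\<lambda>k. real (n k) / t k) \<longlonglongrightarrow> 1" "(\<lambda>k. (t k - real (n k)) / sqrt (t k)) \<longlonglongrightarrow> \<rho>"
    and x: "\<And>k. vreal (x k) = t k *\<^sub>R mean (cs k)"
  shows "(\<lambda>k. complex_of_real ((2 * pi) ^ CARD('d) * (sqrt (t k) ^ CARD('d) * (a (n k) (x k) * tilt (cs k) (x k))))) \<longlonglongrightarrow>
      (\<integral>\<eta>. cis (- (\<rho> * (\<eta> \<bullet> mean c))) * of_real (exp (- cov c \<eta> / 2) * laplace b c) \<partial>lborel)" (is ?lim)
    and "integrable lborel (\<lambda>\<eta>. cis (- (\<rho> * (\<eta> \<bullet> mean c))) * of_real (exp (- cov c \<eta> / 2) * laplace b c))" (is ?int)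
proof -
  define F where "F k \<theta> = indicator torus \<theta> *\<^sub>R (cis (- (\<theta> \<bullet> vreal (x k))) * (fourier \<nu> (cs k) \<theta> ^ n k * fourier b (cs k) \<theta>))" for k \<theta>
  define f where "f \<eta> = cis (- (\<rho> * (\<eta> \<bullet> mean c))) * complex_of_real (exp (- cov c \<eta> / 2) * laplace b c)" for \<eta>
  have Fm: "F k \<in> borel_measurable borel" for k
    unfolding F_def by (rule a_integrand_measurable[OF cs(2)])
  have Feq: "complex_of_real ((2 * pi) ^ CARD('d) * (sqrt (t k) ^ CARD('d) * (a (n k) (x k) * tilt (cs k) (x k)))) = (\<integral>\<eta>. F k (\<eta> /\<^sub>R sqrt (t k)) \<partial>lborel)" for k
  proof -
    have "(\<integral>\<eta>. F k (\<eta> /\<^sub>R sqrt (t k)) \<partial>lborel) = sqrt (t k) ^ CARD('d) *\<^sub>R (\<integral>\<theta>. F k \<theta> \<partial>lborel)"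
      using lborel_integral_scale[OF Fm, of "sqrt (t k)" k] t(2)[of k] by simp
    also have "(\<integral>\<theta>. F k \<theta> \<partial>lborel) = of_real ((2 * pi) ^ CARD('d) * (a (n k) (x k) * tilt (cs k) (x k)))"
      unfolding F_def by (rule a_inversion[OF cs(2), symmetric])
    finally show ?thesis by (simp add: scaleR_conv_of_real)
  qed
  obtain \<delta>b where db: "\<delta>b > 0" "exp_dominated b c \<delta>b" using b_dominated[OF c] by blast
  obtain B where B: "B > 0" "\<And>\<beta>. norm (\<beta> - c) \<le> \<delta>b \<Longrightarrow> laplace b \<beta> \<le> B"
    using laplace_bounded_near[OF b_nonneg db(2)] by blast
  obtain \<kappa> \<delta> where k: "\<kappa> > 0" "\<delta> > 0"
    "\<And>\<alpha> \<theta>. norm (\<alpha> - c) \<le> \<delta> \<Longrightarrow> \<theta> \<in> torus \<Longrightarrow> norm (fourier \<nu> \<alpha> \<theta>) \<le> laplace \<nu> \<alpha> * exp (- \<kappa> * (norm \<theta>)\<^sup>2)"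
    using fourier_decay[OF c] by blast
  have nn: "filterlim n at_top sequentially"
  proof -
    have "filterlim (\<lambda>k. real (n k) / t k * t k) at_top sequentially"
      by (rule filterlim_tendsto_pos_mult_at_top[OF n(1) _ t(1)]) simp
    then have "filterlim (\<lambda>k. real (n k)) at_top sequentially"
      using t(2) by (simp add: less_imp_neq[symmetric])
    then show ?thesis by (simp add: filterlim_sequentially_iff_filterlim_real)
  qed
  have sq: "filterlim (\<lambda>k. sqrt (t k)) at_top sequentially"
    by (rule filterlim_compose[OF sqrt_at_top t(1)])
  have lim: "(\<lambda>k. F k (\<eta> /\<^sub>R sqrt (t k))) \<longlonglongrightarrow> f \<eta>" for \<eta>
  proof -
    let ?z = "\<lambda>k. cis (- (\<eta> \<bullet> mean (cs k)) / sqrt (t k)) * fourier \<nu> (cs k) (\<eta> /\<^sub>R sqrt (t k))"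
    have "(\<lambda>k. of_real (real (n k) / t k) * (of_real (t k) * (?z k - 1))) \<longlonglongrightarrow> of_real 1 * of_real (- cov c \<eta> / 2)"
      by (intro tendsto_mult tendsto_of_real n char_expansion c cs t)
    also have "(\<lambda>k. of_real (real (n k) / t k) * (of_real (t k) * (?z k - 1))) = (\<lambda>k. of_nat (n k) * (?z k - 1))"
      using t(2) by (auto simp: less_imp_neq[symmetric])
    finally have "(\<lambda>k. ?z k ^ n k) \<longlonglongrightarrow> of_real (exp (- cov c \<eta> / 2))"
      using norm_fourier_le[OF nu_nonneg cs(2)] cs(3) cov_nonneg[of c \<eta>]
      by (intro power_tendsto_exp nn) (auto simp: norm_mult)
    moreover have e0: "(\<lambda>k. \<eta> /\<^sub>R sqrt (t k)) \<longlonglongrightarrow> 0"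
      using tendsto_scaleR[OF tendsto_inverse_0_at_top[OF sq] tendsto_const[of \<eta>]] by simp
    have "(\<lambda>k. fourier b (cs k) (\<eta> /\<^sub>R sqrt (t k))) \<longlonglongrightarrow> fourier b c 0"
      by (rule tendsto_fourier[OF b_nonneg db(2,1) cs(1) e0])
    moreover have "(\<lambda>k. cis (- ((t k - real (n k)) / sqrt (t k) * (\<eta> \<bullet> mean (cs k))))) \<longlonglongrightarrow> cis (- (\<rho> * (\<eta> \<bullet> mean c)))"
      by (intro tendsto_intros n tendsto_mean c cs)
    ultimately have L: "(\<lambda>k. cis (- ((t k - real (n k)) / sqrt (t k) * (\<eta> \<bullet> mean (cs k)))) * (?z k ^ n k * fourier b (cs k) (\<eta> /\<^sub>R sqrt (t k)))) \<longlonglongrightarrow>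
        cis (- (\<rho> * (\<eta> \<bullet> mean c))) * (of_real (exp (- cov c \<eta> / 2)) * fourier b c 0)"
      by (intro tendsto_mult)
    have f: "cis (- (\<rho> * (\<eta> \<bullet> mean c))) * (of_real (exp (- cov c \<eta> / 2)) * fourier b c 0) = f \<eta>"
      by (simp add: f_def fourier_0 b_summable[OF c])
    have E: "eventually (\<lambda>k. cis (- ((t k - real (n k)) / sqrt (t k) * (\<eta> \<bullet> mean (cs k)))) * (?z k ^ n k * fourier b (cs k) (\<eta> /\<^sub>R sqrt (t k))) = F k (\<eta> /\<^sub>R sqrt (t k))) sequentially"
    proof -
      have "eventually (\<lambda>k. norm (\<eta> /\<^sub>R sqrt (t k)) < pi) sequentially"
        using order_tendstoD(2)[OF tendsto_norm[OF e0], of pi] by simp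
      then show ?thesis
      proof eventually_elim
        case (elim k)
        then have tor: "\<eta> /\<^sub>R sqrt (t k) \<in> torus"
          unfolding mem_torus by (intro allI order_trans[OF component_le_norm_cart]) simp
        \<comment> \<open>The walk is centred at \<open>n k\<close> times the mean, the target lies
          at \<open>t k\<close> times the mean; their mismatch, of order \<open>sqrt (t k)\<close>,
          is the phase that survives in the limit.\<close>
        have "cis (- ((t k - real (n k)) / sqrt (t k) * (\<eta> \<bullet> mean (cs k)))) * cis (- (\<eta> \<bullet> mean (cs k)) / sqrt (t k)) ^ n k
            = cis (- ((\<eta> /\<^sub>R sqrt (t k)) \<bullet> vreal (x k)))"
          unfolding Complex.DeMoivre cis_mult x using t(2)[of k]
          by (intro arg_cong[where f = cis]) (simp add: field_simps)
        then show ?case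
          using tor by (simp add: F_def power_mult_distrib mult.assoc[symmetric])
      qed
    qed
    show ?thesis
      by (rule Lim_transform_eventually[OF L[unfolded f] E])
  qed
  have ev: "eventually (\<lambda>k. \<forall>\<eta>. norm (F k (\<eta> /\<^sub>R sqrt (t k))) \<le> B * exp (- (\<kappa> / 2) * (norm \<eta>)\<^sup>2)) sequentially"
  proof -
    have "eventually (\<lambda>k. dist (cs k) c < min \<delta> \<delta>b) sequentially"
      using tendstoD[OF cs(1), of "min \<delta> \<delta>b"] k(2) db(1) by simp
    \<comment> \<open>Decay accumulated over \<open>n k\<close> steps is measured on the scale of
      \<open>t k\<close>; the ratio \<open>1 / 2\<close> costs half of
      \<open>\<kappa>\<close>.\<close>
    moreover have "eventually (\<lambda>k. real (n k) / t k > 1 / 2) sequentially"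
      by (rule order_tendstoD(1)[OF n(1)]) simp
    ultimately show ?thesis
    proof eventually_elim
      case (elim k)
      have ck: "norm (cs k - c) \<le> \<delta>" "norm (cs k - c) \<le> \<delta>b" using elim by (auto simp: dist_norm)
      show ?case
      proof
        fix \<eta> :: "real ^ 'd"
        let ?\<theta> = "\<eta> /\<^sub>R sqrt (t k)"
        show "norm (F k ?\<theta>) \<le> B * exp (- (\<kappa> / 2) * (norm \<eta>)\<^sup>2)"
        proof (cases "?\<theta> \<in> torus")
          case True
          have "norm (F k ?\<theta>) = norm (fourier b (cs k) ?\<theta>) * norm (fourier \<nu> (cs k) ?\<theta>) ^ n k"
            using True by (simp add: F_def norm_mult norm_power)
          also have "\<dots> \<le> B * exp (- \<kappa> * (norm ?\<theta>)\<^sup>2) ^ n k"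
            using k(3)[OF ck(1) True] cs(3)[of k] B(2)[OF ck(2)] B(1) norm_fourier_le[OF b_nonneg b_summable[OF cs(2)[of k]], of ?\<theta>]
            by (intro mult_mono power_mono) auto
          also have "exp (- \<kappa> * (norm ?\<theta>)\<^sup>2) ^ n k = exp (- (\<kappa> * (norm \<eta>)\<^sup>2 * (real (n k) / t k)))"
            using t(2)[of k] by (simp add: power_mult_distrib field_simps flip: exp_of_nat_mult)
          also have "\<dots> \<le> exp (- (\<kappa> * (norm \<eta>)\<^sup>2 * (1 / 2)))"
            using elim k(1) by (intro exp_le_cancel_iff[THEN iffD2] le_imp_neg_le mult_left_mono) auto
          finally show ?thesis using B(1) by (simp add: field_simps)
        qed (use B in \<open>simp add: F_def\<close>)
      qed
    qed
  qed
  then obtain N where N: "\<And>k \<eta>. k \<ge> N \<Longrightarrow> norm (F k (\<eta> /\<^sub>R sqrt (t k))) \<le> B * exp (- (\<kappa> / 2) * (norm \<eta>)\<^sup>2)"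
    by (auto simp: eventually_sequentially)
  have wint: "integrable lborel (\<lambda>\<eta>::real^'d. B * exp (- (\<kappa> / 2) * (norm \<eta>)\<^sup>2))"
    using k(1) by (intro integrable_mult_right integrable_gaussian) simp
  have FmN: "(\<lambda>\<eta>. F (k + N) (\<eta> /\<^sub>R sqrt (t (k + N)))) \<in> borel_measurable lborel" for k
    using measurable_compose[OF _ Fm[of "k + N"], of "\<lambda>\<eta>. \<eta> /\<^sub>R sqrt (t (k + N))" borel] by simp
  have limN: "(\<lambda>k. F (k + N) (\<eta> /\<^sub>R sqrt (t (k + N)))) \<longlonglongrightarrow> f \<eta>" for \<eta>
    using LIMSEQ_ignore_initial_segment[OF lim[of \<eta>], of N] .
  have fm: "f \<in> borel_measurable lborel"
    by (rule borel_measurable_LIMSEQ_metric[OF FmN limN])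
  have "(\<lambda>k. \<integral>\<eta>. F (k + N) (\<eta> /\<^sub>R sqrt (t (k + N))) \<partial>lborel) \<longlonglongrightarrow> (\<integral>\<eta>. f \<eta> \<partial>lborel)"
    by (rule integral_dominated_convergence[where s = "\<lambda>k \<eta>. F (k + N) (\<eta> /\<^sub>R sqrt (t (k + N)))", OF fm FmN wint]) (use limN N in auto)
  then have "(\<lambda>k. \<integral>\<eta>. F k (\<eta> /\<^sub>R sqrt (t k)) \<partial>lborel) \<longlonglongrightarrow> (\<integral>\<eta>. f \<eta> \<partial>lborel)"
    by (rule LIMSEQ_offset)
  then show ?lim unfolding Feq f_def .
  show ?int unfolding f_def[symmetric]
    by (rule integrable_dominated_convergence[where s = "\<lambda>k \<eta>. F (k + N) (\<eta> /\<^sub>R sqrt (t (k + N)))", OF fm FmN wint]) (use limN N in auto)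
qed

end

section \<open>The Green function of a lattice walk\<close>

text \<open>A series is the integral of a step function. As an integral it admits the change of
  variables \<open>s = t + r * sqrt t\<close>, which puts the fluctuations of the time on a fixed
  scale. Negative \<open>s\<close> is cut off because \<open>nat\<close> would send it to the index
  0.\<close>

lemma suminf_eq_integral_floor:
  fixes g :: "nat \<Rightarrow> real"
  assumes g: "\<And>n. g n \<ge> 0" and s: "summable g"
  shows "(\<integral>s. (if (s::real) \<ge> 0 then g (nat \<lfloor>s\<rfloor>) else 0) \<partial>lborel) = (\<Sum>n. g n)"
proof -
  let ?h = "\<lambda>s::real. if s \<ge> 0 then g (nat \<lfloor>s\<rfloor>) else 0"
  have eq: "ennreal (?h s) = (\<Sum>n. ennreal (g n) * indicator {real n..<real n + 1} s)" for s
  proof (cases "s \<ge> 0")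
    case True
    have "(\<Sum>n. ennreal (g n) * indicator {real n..<real n + 1} s)
        = (\<Sum>n\<in>{nat \<lfloor>s\<rfloor>}. ennreal (g n) * indicator {real n..<real n + 1} s)"
    proof (rule suminf_finite)
      fix n assume "n \<notin> {nat \<lfloor>s\<rfloor>}"
      then have "n \<noteq> nat \<lfloor>s\<rfloor>" by simp
      then have "\<not> (real n \<le> s \<and> s < real n + 1)"
        using True floor_unique[of "int n" s] by auto
      then show "ennreal (g n) * indicator {real n..<real n + 1} s = 0" by (auto simp: indicator_def)
    qed simp
    also have "\<dots> = ennreal (g (nat \<lfloor>s\<rfloor>))"
      using True by (auto simp: indicator_def)
    finally show ?thesis using True by simp
  next
    case False
    then have "ennreal (g n) * indicator {real n..<real n + 1} s = 0" for n
      by (auto simp: indicator_def)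
    then have "(\<Sum>n. ennreal (g n) * indicator {real n..<real n + 1} s) = 0" by (simp only: suminf_zero)
    then show ?thesis using False by simp
  qed
  have m: "?h \<in> borel_measurable lborel" by measurable
  have "(\<integral>\<^sup>+s. ennreal (?h s) \<partial>lborel) = (\<Sum>n. \<integral>\<^sup>+s. ennreal (g n) * indicator {real n..<real n + 1} s \<partial>lborel)"
    unfolding eq by (rule nn_integral_suminf) auto
  also have "\<dots> = (\<Sum>n. ennreal (g n))"
    by (intro suminf_cong) (simp add: nn_integral_cmult_indicator)
  also have "\<dots> = ennreal (\<Sum>n. g n)"
    using g s by (rule suminf_ennreal2)
  finally have "(\<integral>\<^sup>+s. ennreal (?h s) \<partial>lborel) = ennreal (\<Sum>n. g n)" .
  moreover have "integral\<^sup>L lborel ?h = enn2real (\<integral>\<^sup>+s. ennreal (?h s) \<partial>lborel)"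
    using g m by (intro integral_eq_nn_integral) auto
  ultimately show ?thesis
    using suminf_nonneg[OF s g] by simp
qed

lemma integrable_exp_abs:
  fixes \<kappa> :: real
  assumes "\<kappa> > 0"
  shows "integrable lborel (\<lambda>r::real. exp (- \<kappa> * \<bar>r\<bar>))"
proof -
  have *: "integrable lborel (\<lambda>r::real. indicator {0..} r * exp (- \<kappa> * r))"
  proof -
    have "integrable lborel (\<lambda>r. exponential_density \<kappa> r / \<kappa>)"
    proof -
      interpret prob_space "density lborel (exponential_density \<kappa>)"
        using assms by (rule prob_space_exponential_density)
      have "emeasure (density lborel (exponential_density \<kappa>)) UNIV = 1"
        using emeasure_space_1 by simp
      then have "(\<integral>\<^sup>+x. ennreal (exponential_density \<kappa> x) \<partial>lborel) = 1"
        by (simp add: emeasure_density)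
      then have "integrable lborel (exponential_density \<kappa>)"
        using assms by (intro integrableI_nonneg) (auto simp: exponential_density_nonneg)
      then show ?thesis by simp
    qed
    also have "(\<lambda>r. exponential_density \<kappa> r / \<kappa>) = (\<lambda>r. indicator {0..} r * exp (- \<kappa> * r))"
      using assms by (auto simp: exponential_density_def indicator_def mult.commute)
    finally show ?thesis .
  qed
  have "integrable lborel (\<lambda>r::real. indicator {0..} (0 + (-1) * r) * exp (- \<kappa> * (0 + (-1) * r)))"
    by (rule lborel_integrable_real_affine[OF *]) simp
  from Bochner_Integration.integrable_add[OF * this]
  have "integrable lborel (\<lambda>r. indicator {0..} r * exp (- \<kappa> * r) + indicator {0..} (0 + (-1) * r) * exp (- \<kappa> * (0 + (-1) * r)))" .
  then show ?thesis
    by (rule Bochner_Integration.integrable_bound) (auto simp: indicator_def abs_if)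
qed

context lattice_walk
begin

text \<open>A tilt with transform below 1 makes the total tilted masses decay geometrically.\<close>

lemma a_summable: "summable (\<lambda>n. a n x)"
proof -
  obtain \<alpha> where \<alpha>: "tilt_summable \<nu> \<alpha>" "laplace \<nu> \<alpha> < 1" using drift by blast
  have "summable (\<lambda>n. laplace \<nu> \<alpha> ^ n * laplace b \<alpha>)"
    using \<alpha> laplace_nonneg[of \<nu> \<alpha>] by (intro summable_mult2 summable_geometric) auto
  then show ?thesis
    using \<alpha> by (intro summable_of_laplace[of a \<alpha>]) (auto intro!: tilt_summable_step b_summable simp: laplace_step b_summable)
qed

text \<open>Chernoff's bound with the local prefactor: tilt further by \<open>s\<close> times the mean with \<open>s\<close> proportional to
  \<open>(t - n) / max t \<bar>t - n\<bar>\<close>, which is Gaussian for \<open>n\<close> near \<open>t\<close> and exponential far away.\<close>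

lemma a_tail:
  assumes c: "tilt_summable \<nu> c" "mean c \<noteq> 0" and cs: "cs \<longlonglongrightarrow> c" "\<And>k. laplace \<nu> (cs k) = 1"
  shows "\<exists>C>0. \<exists>\<kappa>>0. eventually (\<lambda>k. \<forall>t n x. t \<ge> 1 \<longrightarrow> vreal x = t *\<^sub>R mean (cs k) \<longrightarrow>
    sqrt t ^ CARD('d) * (a n x * tilt (cs k) x) \<le> C * exp (- \<kappa> * (t - real n)\<^sup>2 / max t \<bar>t - real n\<bar>)) sequentially"
proof -
  obtain C1 d1 where C1: "C1 > 0" "d1 > 0"
    "\<And>\<alpha> n x. norm (\<alpha> - c) \<le> d1 \<Longrightarrow> a n x * tilt \<alpha> x \<le> C1 * laplace \<nu> \<alpha> ^ n * max 1 (real n) powr (- real CARD('d) / 2)"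
    using a_bound[OF c(1)] by blast
  obtain d2 where d2: "d2 > 0" "exp_dominated \<nu> c (3 * d2)" using dominated_at[OF c(1)] by blast
  obtain K where K: "K > 0" "\<And>\<alpha> \<beta>. norm (\<alpha> - c) \<le> d2 \<Longrightarrow> norm \<beta> \<le> d2 \<Longrightarrow>
    laplace \<nu> (\<alpha> + \<beta>) \<le> laplace \<nu> \<alpha> + \<beta> \<bullet> mean \<alpha> + K * (norm \<beta>)\<^sup>2"
    using laplace_taylor[OF d2(2,1)] by blast
  define M where "M = norm (mean c)"
  have "M > 0" using c(2) by (simp add: M_def)
  \<comment> \<open>The first bounds keep the extra tilt within the ranges of \<open>a_bound\<close>
    and \<open>laplace_taylor\<close>, given that the mean has norm below \<open>2 * M\<close>. The
    last, \<open>4 * K * \<delta> \<le> 1\<close>, makes the quadratic cost at most half of the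
    linear gain.\<close>
  define \<delta> where "\<delta> = min (min (d1 / 2) d2 / (2 * M)) (1 / (4 * K))"
  have "\<delta> \<le> min (d1 / 2) d2 / (2 * M)" "\<delta> \<le> 1 / (4 * K)" by (simp_all add: \<delta>_def)
  then have "\<delta> * (2 * M) \<le> min (d1 / 2) d2" "\<delta> * (4 * K) \<le> 1"
    using K(1) \<open>M > 0\<close> by (simp_all add: pos_le_divide_eq)
  moreover have "\<delta> > 0" using C1(2) d2(1) K(1) \<open>M > 0\<close> by (simp add: \<delta>_def)
  ultimately have \<delta>: "\<delta> > 0" "\<delta> * (2 * M) \<le> d1 / 2" "\<delta> * (2 * M) \<le> d2" "\<delta> * (4 * K) \<le> 1"
    by simp_all
  \<comment> \<open>\<open>M\<^sup>2 / 4\<close> bounds the squared norm of the mean from below, and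
    \<open>\<delta> / 2\<close> is the half of the linear gain that survives.\<close>
  define \<kappa> where "\<kappa> = M\<^sup>2 / 4 * \<delta> / 2"
  have "\<kappa> > 0" using \<open>M > 0\<close> \<delta>(1) by (simp add: \<kappa>_def)
  \<comment> \<open>The first summand is for \<open>n \<ge> t / 2\<close>, the second for smaller
    \<open>n\<close>.\<close>
  define C2 where "C2 = 2 ^ CARD('d) + fact CARD('d) / (\<kappa> / 8) ^ CARD('d)"
  have "C2 > 0" using \<open>\<kappa> > 0\<close> by (auto simp: C2_def intro!: add_pos_pos)
  have m: "(\<lambda>k. norm (mean (cs k))) \<longlonglongrightarrow> M"
    unfolding M_def by (intro tendsto_norm tendsto_mean c cs)
  have ev: "eventually (\<lambda>k. dist (cs k) c < min (d1 / 2) d2) sequentially"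
    using tendstoD[OF cs(1), of "min (d1 / 2) d2"] C1(2) d2(1) by simp
  have "eventually (\<lambda>k. norm (mean (cs k)) > M / 2) sequentially" "eventually (\<lambda>k. norm (mean (cs k)) < 2 * M) sequentially"
    by (rule order_tendstoD[OF m], use \<open>M > 0\<close> in simp)+
  with ev have "eventually (\<lambda>k. \<forall>t n x. t \<ge> 1 \<longrightarrow> vreal x = t *\<^sub>R mean (cs k) \<longrightarrow>
    sqrt t ^ CARD('d) * (a n x * tilt (cs k) x) \<le> C1 * C2 * exp (- (\<kappa> / 2) * (t - real n)\<^sup>2 / max t \<bar>t - real n\<bar>)) sequentially"
  proof eventually_elim
    case (elim k)
    show ?case
    proof (intro allI impI)
      fix t :: real and n :: nat and x :: "int ^ 'd"
      assume t: "t \<ge> 1" and x: "vreal x = t *\<^sub>R mean (cs k)"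
      \<comment> \<open>From here \<open>D\<close> is the distance of \<open>n\<close> from
        \<open>t\<close> and hides the sublevel set.\<close>
      define D where "D = \<bar>t - real n\<bar>"
      define X where "X = max t D"
      define R where "R = D\<^sup>2 / X"
      define m where "m = mean (cs k)"
      define s where "s = \<delta> * (t - real n) / X"
      have X: "X \<ge> 1" "D \<ge> 0" "D \<le> X" "t \<le> X" using t by (auto simp: X_def D_def)
      moreover have "real n \<le> t + D" unfolding D_def by linarith
      ultimately have Xn: "real n \<le> 2 * X" by linarith
      have "R \<ge> 0" using X by (simp add: R_def)
      have mM: "M / 2 < norm m" "norm m < 2 * M" using elim by (auto simp: m_def)
      have "\<bar>s\<bar> = \<delta> * (D / X)" using X \<delta>(1) by (simp add: s_def D_def abs_mult)
      also have "\<dots> \<le> \<delta> * 1" using X \<delta>(1) by (intro mult_left_mono) auto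
      finally have s: "\<bar>s\<bar> \<le> \<delta>" by simp
      have sm: "norm (s *\<^sub>R m) \<le> \<delta> * (2 * M)"
        using s mM by (simp add: mult_mono)
      have ck: "norm (cs k - c) \<le> d1 / 2" "norm (cs k - c) \<le> d2" using elim(1) by (auto simp: dist_norm)
      have "norm (cs k + s *\<^sub>R m - c) \<le> norm (cs k - c) + norm (s *\<^sub>R m)"
        using norm_triangle_ineq[of "cs k - c" "s *\<^sub>R m"] by (simp add: algebra_simps)
      then have n1: "norm (cs k + s *\<^sub>R m - c) \<le> d1" using ck(1) sm \<delta>(2) by linarith
      have "laplace \<nu> (cs k + s *\<^sub>R m) \<le> 1 + s * (norm m)\<^sup>2 + K * (s\<^sup>2 * (norm m)\<^sup>2)"
        using K(2)[OF ck(2), of "s *\<^sub>R m"] sm \<delta>(3) cs(2)[of k]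
        by (simp add: m_def[symmetric] power2_norm_eq_inner power_mult_distrib)
      also have "\<dots> \<le> exp (s * (norm m)\<^sup>2 + K * (s\<^sup>2 * (norm m)\<^sup>2))"
        using exp_ge_add_one_self[of "s * (norm m)\<^sup>2 + K * (s\<^sup>2 * (norm m)\<^sup>2)"] by (simp only: add.assoc)
      finally have "laplace \<nu> (cs k + s *\<^sub>R m) ^ n \<le> exp (s * (norm m)\<^sup>2 + K * (s\<^sup>2 * (norm m)\<^sup>2)) ^ n"
        by (intro power_mono laplace_nonneg) auto
      also have "\<dots> = exp (real n * (s * (norm m)\<^sup>2 + K * (s\<^sup>2 * (norm m)\<^sup>2)))"
        by (simp flip: exp_of_nat_mult)
      finally have Ln: "laplace \<nu> (cs k + s *\<^sub>R m) ^ n \<le> exp (real n * (s * (norm m)\<^sup>2 + K * (s\<^sup>2 * (norm m)\<^sup>2)))" .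
      let ?P = "max 1 (real n) powr (- real CARD('d) / 2)"
      have "tilt (cs k) x = tilt (cs k + s *\<^sub>R m) x * exp (- (s * (t * (norm m)\<^sup>2)))"
        by (simp add: tilt_def x m_def[symmetric] inner_add_left power2_norm_eq_inner algebra_simps flip: exp_add)
      then have "a n x * tilt (cs k) x = (a n x * tilt (cs k + s *\<^sub>R m) x) * exp (- (s * (t * (norm m)\<^sup>2)))"
        by simp
      also have "\<dots> \<le> (C1 * exp (real n * (s * (norm m)\<^sup>2 + K * (s\<^sup>2 * (norm m)\<^sup>2))) * ?P) * exp (- (s * (t * (norm m)\<^sup>2)))"
        using C1(3)[OF n1, of n x] Ln C1(1)
        by (intro mult_right_mono order_trans[OF C1(3)[OF n1, of n x]] mult_left_mono) auto
      also have "\<dots> = C1 * ?P * exp (real n * (s * (norm m)\<^sup>2 + K * (s\<^sup>2 * (norm m)\<^sup>2)) - s * (t * (norm m)\<^sup>2))"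
        by (simp only: diff_conv_add_uminus exp_add mult_ac)
      also have "\<dots> \<le> C1 * ?P * exp (- \<kappa> * R)"
      proof -
        have st: "s * (t - real n) = \<delta> * R"
          using X by (simp add: s_def R_def D_def power2_eq_square)
        have "s\<^sup>2 * real n \<le> s\<^sup>2 * (2 * X)" using Xn by (intro mult_left_mono) auto
        also have "\<dots> = 2 * \<delta>\<^sup>2 * R"
          using X by (simp add: s_def R_def D_def power_mult_distrib power_divide power2_eq_square field_simps)
        finally have sn: "s\<^sup>2 * real n \<le> 2 * \<delta>\<^sup>2 * R" .
        have "K * (s\<^sup>2 * real n) \<le> K * (2 * \<delta>\<^sup>2 * R)" using sn K(1) by (intro mult_left_mono) auto
        also have "\<dots> = \<delta> * (4 * K) * (\<delta> * R / 2)" by (simp add: power2_eq_square)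
        also have "\<dots> \<le> 1 * (\<delta> * R / 2)" using \<delta>(1,4) \<open>R \<ge> 0\<close> by (intro mult_right_mono) auto
        finally have Ks: "K * (s\<^sup>2 * real n) \<le> \<delta> * R / 2" by simp
        have "real n * (s * (norm m)\<^sup>2 + K * (s\<^sup>2 * (norm m)\<^sup>2)) - s * (t * (norm m)\<^sup>2) = (norm m)\<^sup>2 * (K * (s\<^sup>2 * real n) - s * (t - real n))"
          by (simp add: algebra_simps)
        also have "\<dots> \<le> (norm m)\<^sup>2 * (- (\<delta> * R / 2))"
          using Ks st by (intro mult_left_mono) auto
        also have "\<dots> \<le> (M / 2)\<^sup>2 * (- (\<delta> * R / 2))"
          using mM \<open>M > 0\<close> \<delta>(1) \<open>R \<ge> 0\<close> by (intro mult_right_mono_neg power_mono) auto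
        also have "\<dots> = - \<kappa> * R" by (simp add: \<kappa>_def power_divide)
        finally show ?thesis using C1(1) by (intro mult_left_mono) auto
      qed
      finally have main: "a n x * tilt (cs k) x \<le> C1 * ?P * exp (- \<kappa> * R)" .
      \<comment> \<open>Half of the exponent pays for the prefactor. For
        \<open>n \<ge> t / 2\<close> the powers of \<open>t\<close> and \<open>n\<close> balance;
        otherwise \<open>R\<close> is at least \<open>t / 4\<close> and the exponential swallows the
        power of \<open>t\<close>.\<close>
      have pre: "sqrt t ^ CARD('d) * ?P * exp (- (\<kappa> / 2) * R) \<le> C2"
      proof (cases "real n \<ge> t / 2")
        case True
        have e: "max 1 (real n) \<ge> t / 2" using True by simp
        have "sqrt t ^ CARD('d) = t powr (real CARD('d) / 2)"
          using t by (simp add: powr_realpow[symmetric] powr_half_sqrt[symmetric] powr_powr)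
        also have "\<dots> \<le> (2 * max 1 (real n)) powr (real CARD('d) / 2)"
          using e t by (intro powr_mono2) auto
        also have "\<dots> = 2 powr (real CARD('d) / 2) * max 1 (real n) powr (real CARD('d) / 2)"
          by (simp add: powr_mult)
        finally have "sqrt t ^ CARD('d) * ?P \<le> 2 powr (real CARD('d) / 2) * max 1 (real n) powr (real CARD('d) / 2) * ?P"
          by (intro mult_right_mono) auto
        also have "\<dots> = 2 powr (real CARD('d) / 2)"
          by (simp add: powr_add[symmetric] mult.assoc)
        also have "\<dots> \<le> 2 powr (real CARD('d))" by (intro powr_mono) auto
        also have "\<dots> = 2 ^ CARD('d)" by (simp add: powr_realpow)
        finally have "sqrt t ^ CARD('d) * ?P \<le> 2 ^ CARD('d)" .
        moreover have "exp (- (\<kappa> / 2) * R) \<le> 1" using \<open>\<kappa> > 0\<close> \<open>R \<ge> 0\<close> by simp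
        ultimately have "sqrt t ^ CARD('d) * ?P * exp (- (\<kappa> / 2) * R) \<le> 2 ^ CARD('d) * 1"
          by (intro mult_mono) auto
        then show ?thesis using \<open>\<kappa> > 0\<close> by (simp add: C2_def add_increasing2)
      next
        case False
        then have D: "D = t - real n" "D \<ge> t / 2" "X = t" using t by (auto simp: D_def X_def)
        have "(t / 2)\<^sup>2 / t \<le> R" unfolding R_def D(3) using D(2) t by (intro divide_right_mono power_mono) auto
        then have R: "t / 4 \<le> R" using t by (simp add: power2_eq_square)
        have "?P \<le> max 1 (real n) powr 0" by (intro powr_mono) auto
        moreover have "max 1 (real n) \<noteq> 0" by linarith
        ultimately have P1: "?P \<le> 1" by simp
        have "sqrt t \<le> t" using t by (intro real_le_lsqrt) (auto simp: power2_eq_square)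
        then have "sqrt t ^ CARD('d) \<le> t ^ CARD('d)"
          using t by (intro power_mono) auto
        also have "\<dots> \<le> fact CARD('d) / (\<kappa> / 8) ^ CARD('d) * exp (\<kappa> / 8 * t)"
          using t \<open>\<kappa> > 0\<close> by (intro power_le_exp) auto
        finally have "sqrt t ^ CARD('d) * ?P * exp (- (\<kappa> / 2) * R) \<le> (fact CARD('d) / (\<kappa> / 8) ^ CARD('d) * exp (\<kappa> / 8 * t)) * 1 * exp (- (\<kappa> / 2) * (t / 4))"
          using R \<open>\<kappa> > 0\<close> P1 t by (intro mult_mono) auto
        also have "\<dots> = fact CARD('d) / (\<kappa> / 8) ^ CARD('d)"
          by (simp add: mult.assoc flip: exp_add)
        finally show ?thesis by (simp add: C2_def add_increasing)
      qed
      have "sqrt t ^ CARD('d) * (a n x * tilt (cs k) x) \<le> sqrt t ^ CARD('d) * (C1 * ?P * exp (- \<kappa> * R))"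
        using t main by (intro mult_left_mono) auto
      also have "exp (- \<kappa> * R) = exp (- (\<kappa> / 2) * R) * exp (- (\<kappa> / 2) * R)"
        by (simp flip: exp_add)
      also have "sqrt t ^ CARD('d) * (C1 * ?P * (exp (- (\<kappa> / 2) * R) * exp (- (\<kappa> / 2) * R)))
         = C1 * (sqrt t ^ CARD('d) * ?P * exp (- (\<kappa> / 2) * R)) * exp (- (\<kappa> / 2) * R)" by (simp add: mult_ac)
      also have "\<dots> \<le> C1 * C2 * exp (- (\<kappa> / 2) * R)"
        using pre C1(1) by (intro mult_right_mono mult_left_mono) auto
      finally show "sqrt t ^ CARD('d) * (a n x * tilt (cs k) x) \<le> C1 * C2 * exp (- (\<kappa> / 2) * (t - real n)\<^sup>2 / max t \<bar>t - real n\<bar>)"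
        by (simp add: R_def X_def D_def)
    qed
  qed
  moreover have "C1 * C2 > 0" "\<kappa> / 2 > 0" using C1(1) \<open>C2 > 0\<close> \<open>\<kappa> > 0\<close> by auto
  ultimately show ?thesis by blast
qed

end

text \<open>Makes the bound of \<open>a_tail\<close> integrable in \<open>r\<close>. For a deviation
  \<open>D \<ge> t\<close> the quotient is \<open>D\<close> itself; otherwise
  \<open>D\<^sup>2 / t \<ge> 2 * D / sqrt t - 1\<close>. Rounding moves \<open>D\<close> by at most
  1, which leads to the constant 3.\<close>

lemma floor_deviation:
  fixes t r :: real
  assumes t: "t \<ge> 1" and nn: "t + r * sqrt t \<ge> 0" and n: "n = nat \<lfloor>t + r * sqrt t\<rfloor>"
  shows "(t - real n)\<^sup>2 / max t \<bar>t - real n\<bar> \<ge> \<bar>r\<bar> - 3"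
proof -
  define D where "D = \<bar>t - real n\<bar>"
  have "sqrt t \<ge> 1" using t by simp
  have "real n = of_int \<lfloor>t + r * sqrt t\<rfloor>" using nn n by simp
  then have "\<bar>(t - real n) + r * sqrt t\<bar> \<le> 1" by linarith
  then have "\<bar>r * sqrt t\<bar> - 1 \<le> D" unfolding D_def by linarith
  then have D: "\<bar>r\<bar> * sqrt t - 1 \<le> D" using t by (simp add: abs_mult)
  have "\<bar>r\<bar> * 1 \<le> \<bar>r\<bar> * sqrt t" using \<open>sqrt t \<ge> 1\<close> by (intro mult_left_mono) auto
  show ?thesis
  proof (cases "D \<ge> t")
    case True
    have "(t - real n)\<^sup>2 = D * D" by (simp add: D_def power2_eq_square)
    then have "(t - real n)\<^sup>2 / max t \<bar>t - real n\<bar> = D"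
      using t True by (simp add: D_def[symmetric])
    then show ?thesis using D \<open>\<bar>r\<bar> * 1 \<le> \<bar>r\<bar> * sqrt t\<close> by linarith
  next
    case False
    have "0 \<le> (D / sqrt t - 1)\<^sup>2" by simp
    also have "\<dots> = D\<^sup>2 / t - 2 * (D / sqrt t) + 1"
      using t by (simp add: power2_diff power_divide)
    finally have 1: "D\<^sup>2 / t \<ge> 2 * (D / sqrt t) - 1" by simp
    have "(\<bar>r\<bar> * sqrt t - 1) / sqrt t \<le> D / sqrt t" using D t by (intro divide_right_mono) auto
    moreover have "(\<bar>r\<bar> * sqrt t - 1) / sqrt t = \<bar>r\<bar> - 1 / sqrt t" using t by (simp add: diff_divide_distrib)
    moreover have "1 / sqrt t \<le> 1" using \<open>sqrt t \<ge> 1\<close> by simp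
    ultimately have "D / sqrt t \<ge> \<bar>r\<bar> - 1" by linarith
    with 1 have "D\<^sup>2 / t \<ge> \<bar>r\<bar> - 3" by linarith
    moreover have "(t - real n)\<^sup>2 / max t \<bar>t - real n\<bar> = D\<^sup>2 / t"
      using False by (simp add: D_def)
    ultimately show ?thesis by simp
  qed
qed

section \<open>Asymptotics of the Green function along converging directions\<close>

context lattice_walk
begin

text \<open>The limit of \<open>local_limit\<close> at \<open>\<rho> = - r\<close>, divided by the
  constant of the inversion formula. It is a Gaussian density along the line spanned by the mean,
  left as a Fourier integral so that no covariance matrix is inverted.\<close>

definition limit_density :: "real ^ 'd \<Rightarrow> real \<Rightarrow> real" where
  "limit_density c r = Re (\<integral>\<eta>. cis (r * (\<eta> \<bullet> mean c)) * of_real (exp (- cov c \<eta> / 2) * laplace b c) \<partial>lborel) / (2 * pi) ^ CARD('d)"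

lemma laplace_b_pos: "tilt_summable \<nu> c \<Longrightarrow> laplace b c > 0"
  using b_pos tilt_term_le_laplace[OF b_nonneg b_summable, of c] by (metis mult_pos_pos order_less_le_trans tilt_pos)

text \<open>At \<open>r = 0\<close> the phase disappears and the integrand is strictly positive, so
  the value is positive; continuity at 0 spreads this to an interval, and elsewhere the function is
  nonnegative.\<close>

lemma limit_density_integral_pos:
  assumes c: "tilt_summable \<nu> c"
    and int: "\<And>r. integrable lborel (\<lambda>\<eta>. cis (r * (\<eta> \<bullet> mean c)) * complex_of_real (exp (- cov c \<eta> / 2) * laplace b c))"
    and nn: "\<And>r. limit_density c r \<ge> 0" and dint: "integrable lborel (limit_density c)"
  shows "0 < (\<integral>r. limit_density c r \<partial>lborel)"
proof -
  let ?g = "\<lambda>\<eta>. exp (- cov c \<eta> / 2) * laplace b c"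
  have L: "laplace b c > 0" by (rule laplace_b_pos[OF c])
  have gint: "integrable lborel ?g"
    using int[of 0] by (simp add: complex_of_real_integrable_eq del: of_real_mult)
  have "0 \<le> integral\<^sup>L lborel ?g" using L by (intro integral_nonneg_AE) auto
  moreover have "integral\<^sup>L lborel ?g \<noteq> 0"
  proof
    assume "integral\<^sup>L lborel ?g = 0"
    then have "AE \<eta> in (lborel :: (real ^ 'd) measure). False"
      using L gint by (subst (asm) integral_nonneg_eq_0_iff_AE) auto
    then have "emeasure (lborel :: (real ^ 'd) measure) UNIV = 0"
      using emeasure_eq_0_AE[of "\<lambda>_. True" "lborel :: (real ^ 'd) measure"] by simp
    then show False by simp
  qed
  ultimately have g0: "integral\<^sup>L lborel ?g > 0" by linarith
  have lim0: "limit_density c 0 > 0"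
    using g0 by (simp add: limit_density_def del: of_real_mult)
  have "(\<lambda>k. limit_density c (s k)) \<longlonglongrightarrow> limit_density c 0" if s: "s \<longlonglongrightarrow> 0" for s
    unfolding limit_density_def
    by (intro tendsto_divide tendsto_const tendsto_Re integral_dominated_convergence[where w = ?g])
      (use int gint L in \<open>auto intro!: tendsto_eq_intros s simp: norm_mult intro: borel_measurable_integrable\<close>)
  then have "isCont (limit_density c) 0"
    by (auto simp: continuous_at_sequentially comp_def)
  then obtain \<epsilon> where e: "\<epsilon> > 0" "\<And>r. dist r 0 < \<epsilon> \<Longrightarrow> dist (limit_density c r) (limit_density c 0) < limit_density c 0 / 2"
    using lim0 unfolding continuous_at_eps_delta by (metis half_gt_zero)
  have "0 < limit_density c 0 / 2 * (\<epsilon> / 2)" using lim0 e(1) by simp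
  also have "\<dots> = (\<integral>r. indicator {0..\<epsilon>/2} r * (limit_density c 0 / 2) \<partial>lborel)"
    using e(1) by simp
  also have "\<dots> \<le> (\<integral>r. limit_density c r \<partial>lborel)"
  proof (rule integral_mono)
    show "indicator {0..\<epsilon>/2} r * (limit_density c 0 / 2) \<le> limit_density c r" for r
    proof (cases "r \<in> {0..\<epsilon>/2}")
      case True
      then have "dist r 0 < \<epsilon>" using e(1) by simp
      from e(2)[OF this] have "limit_density c 0 / 2 \<le> limit_density c r" unfolding dist_real_def by linarith
      then show ?thesis using True by simp
    qed (use nn in auto)
  qed (use dint e(1) in auto)
  finally show ?thesis .
qed

text \<open>The direction, and with it the tilt, may vary with \<open>k\<close>; this freedom later
  yields uniformity. Positivity of the limit is proved alongside because the nonnegativity and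
  integrability of \<open>limit_density\<close> are by-products of the convergence.\<close>

theorem green_limit:
  assumes xs: "filterlim (\<lambda>k. norm (vreal (xs k))) at_top sequentially" "\<And>k. xs k \<noteq> 0"
    and u: "(\<lambda>k. vreal (xs k) /\<^sub>R norm (vreal (xs k))) \<longlonglongrightarrow> u" "norm u = 1"
    and mx: "\<And>k. maximizer (vreal (xs k) /\<^sub>R norm (vreal (xs k))) (cs k)" "maximizer u c"
  shows "(\<lambda>k. norm (vreal (xs k)) powr ((real CARD('d) - 1) / 2) * ((\<Sum>n. a n (xs k)) * tilt (cs k) (xs k)))
      \<longlonglongrightarrow> norm (mean c) powr ((real CARD('d) - 1) / 2) * (\<integral>r. limit_density c r \<partial>lborel)" (is ?lim)
    and "0 < norm (mean c) powr ((real CARD('d) - 1) / 2) * (\<integral>r. limit_density c r \<partial>lborel)" (is ?pos)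
proof -
  define v where "v k = vreal (xs k) /\<^sub>R norm (vreal (xs k))" for k
  have v1: "norm (v k) = 1" for k using xs(2)[of k] by (simp add: v_def)
  have v0: "v k \<noteq> 0" for k using v1[of k] by auto
  have "u \<noteq> 0" using u(2) by auto
  have mxk: "maximizer (v k) (cs k)" for k using mx(1)[of k] by (simp add: v_def)
  have cs: "tilt_summable \<nu> (cs k)" "laplace \<nu> (cs k) = 1" for k
    using mxk[of k] maximizer_boundary[OF mxk v0] by (auto simp: maximizer_def D_def)
  have mean: "mean (cs k) \<noteq> 0" "mean (cs k) = norm (mean (cs k)) *\<^sub>R v k" for k
    using maximizer_mean[OF mxk v1] by blast+
  have c: "tilt_summable \<nu> c" "mean c \<noteq> 0"
    using mx(2) maximizer_mean[OF mx(2) u(2)] by (auto simp: maximizer_def D_def)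
  have csc: "cs \<longlonglongrightarrow> c"
    using maximizer_tendsto[of v u cs c] u(1) \<open>u \<noteq> 0\<close> mxk mx(2) by (simp add: v_def[abs_def])
  have ml: "(\<lambda>k. norm (mean (cs k))) \<longlonglongrightarrow> norm (mean c)"
    by (intro tendsto_norm tendsto_mean c csc)
  \<comment> \<open>The tilted mean points towards \<open>xs k\<close>, so \<open>t k\<close> is the
    time at which the tilted walk is expected there.\<close>
  define t where "t k = norm (vreal (xs k)) / norm (mean (cs k))" for k
  have tpos: "t k > 0" for k using mean(1)[of k] xs(2)[of k] by (simp add: t_def)
  have xt: "vreal (xs k) = t k *\<^sub>R mean (cs k)" for k
  proof -
    have "t k *\<^sub>R mean (cs k) = t k *\<^sub>R (norm (mean (cs k)) *\<^sub>R v k)" using mean(2)[of k] by simp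
    also have "\<dots> = norm (vreal (xs k)) *\<^sub>R v k" using mean(1)[of k] by (simp add: t_def)
    also have "\<dots> = vreal (xs k)" using xs(2)[of k] by (simp add: v_def)
    finally show ?thesis by simp
  qed
  have tlim: "filterlim t at_top sequentially"
  proof -
    have "filterlim (\<lambda>k. inverse (norm (mean (cs k))) * norm (vreal (xs k))) at_top sequentially"
      by (rule filterlim_tendsto_pos_mult_at_top[OF tendsto_inverse[OF ml] _ xs(1)]) (use c(2) in auto)
    then show ?thesis by (simp add: t_def[abs_def] divide_inverse mult.commute)
  qed
  have sqt: "filterlim (\<lambda>k. sqrt (t k)) at_top sequentially"
    by (rule filterlim_compose[OF sqrt_at_top tlim])
  have isq: "(\<lambda>k. inverse (sqrt (t k))) \<longlonglongrightarrow> 0"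
    by (rule tendsto_inverse_0_at_top[OF sqt])
  define n where "n r k = nat \<lfloor>t k + r * sqrt (t k)\<rfloor>" for r k
  have evnn: "eventually (\<lambda>k. t k + r * sqrt (t k) \<ge> 0) sequentially" for r
  proof -
    have "eventually (\<lambda>k. sqrt (t k) \<ge> \<bar>r\<bar>) sequentially"
      using sqt by (simp add: filterlim_at_top)
    then show ?thesis
    proof eventually_elim
      case (elim k)
      then have "sqrt (t k) * (sqrt (t k) + r) \<ge> 0" using tpos[of k] by (intro mult_nonneg_nonneg) auto
      then show ?case using tpos[of k] by (simp add: algebra_simps)
    qed
  qed
  have dev: "(\<lambda>k. (t k - real (n r k)) / sqrt (t k)) \<longlonglongrightarrow> - r" for r
  proof -
    have "(\<lambda>k. (t k - real (n r k)) / sqrt (t k) + r) \<longlonglongrightarrow> 0"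
    proof (rule Lim_null_comparison[OF _ isq])
      show "eventually (\<lambda>k. norm ((t k - real (n r k)) / sqrt (t k) + r) \<le> inverse (sqrt (t k))) sequentially"
        using evnn[of r]
      proof eventually_elim
        case (elim k)
        then have "real (n r k) = of_int \<lfloor>t k + r * sqrt (t k)\<rfloor>" by (simp add: n_def)
        then have "\<bar>t k - real (n r k) + r * sqrt (t k)\<bar> \<le> 1" by linarith
        then have "\<bar>t k - real (n r k) + r * sqrt (t k)\<bar> / sqrt (t k) \<le> 1 / sqrt (t k)"
          using tpos[of k] by (intro divide_right_mono) auto
        moreover have "(t k - real (n r k)) / sqrt (t k) + r = (t k - real (n r k) + r * sqrt (t k)) / sqrt (t k)"
          using tpos[of k] by (simp add: field_simps)
        ultimately show ?case using tpos[of k] by (simp add: inverse_eq_divide)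
      qed
    qed
    from tendsto_add[OF this tendsto_const[of "- r"]] show ?thesis by simp
  qed
  have rat: "(\<lambda>k. real (n r k) / t k) \<longlonglongrightarrow> 1" for r
  proof -
    have "(\<lambda>k. 1 - (t k - real (n r k)) / sqrt (t k) * inverse (sqrt (t k))) \<longlonglongrightarrow> 1 - (- r) * 0"
      by (intro tendsto_intros dev isq)
    moreover have "1 - (t k - real (n r k)) / sqrt (t k) * inverse (sqrt (t k)) = real (n r k) / t k" for k
    proof -
      have "sqrt (t k) * sqrt (t k) = t k" using tpos[of k] by simp
      then have "(t k - real (n r k)) / sqrt (t k) * inverse (sqrt (t k)) = (t k - real (n r k)) / t k"
        by (metis divide_divide_eq_left divide_inverse)
      then show ?thesis using tpos[of k] by (simp add: diff_divide_distrib)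
    qed
    ultimately show ?thesis by simp
  qed
  note LL = local_limit[OF c(1) csc cs tlim tpos rat dev xt]
  \<comment> \<open>Times \<open>t k + r * sqrt (t k)\<close> below 0 are cut off, since
    \<open>n r k\<close> would turn them into 0.\<close>
  define S where "S k r = (if t k + r * sqrt (t k) \<ge> 0 then sqrt (t k) ^ CARD('d) * (a (n r k) (xs k) * tilt (cs k) (xs k)) else 0)" for k r
  have Slim: "(\<lambda>k. S k r) \<longlonglongrightarrow> limit_density c r" for r
  proof -
    have "(\<lambda>k. Re (complex_of_real ((2 * pi) ^ CARD('d) * (sqrt (t k) ^ CARD('d) * (a (n r k) (xs k) * tilt (cs k) (xs k))))) / (2 * pi) ^ CARD('d))
       \<longlonglongrightarrow> limit_density c r"
      unfolding limit_density_def using LL(1)[of r] by (intro tendsto_divide tendsto_Re tendsto_const) auto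
    then have "(\<lambda>k. sqrt (t k) ^ CARD('d) * (a (n r k) (xs k) * tilt (cs k) (xs k))) \<longlonglongrightarrow> limit_density c r"
      by (simp only: Re_complex_of_real) simp
    then show ?thesis
      by (rule Lim_transform_eventually) (use evnn[of r] in \<open>auto simp: S_def elim!: eventually_mono\<close>)
  qed
  have Snn: "S k r \<ge> 0" for k r using tpos[of k] by (simp add: S_def)
  \<comment> \<open>The oscillating integral does not show its sign; nonnegativity is inherited from
    the masses converging to it.\<close>
  have dnn: "limit_density c r \<ge> 0" for r
    by (rule LIMSEQ_le_const[OF Slim]) (use Snn in auto)
  have Sm: "S k \<in> borel_measurable lborel" for k
    unfolding S_def n_def by measurable
  have dm: "limit_density c \<in> borel_measurable lborel"
    by (rule borel_measurable_LIMSEQ_real[OF Slim Sm])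
  obtain C \<kappa> where C: "C > 0" "\<kappa> > 0" and tail: "eventually (\<lambda>k. \<forall>t n x. t \<ge> 1 \<longrightarrow> vreal x = t *\<^sub>R mean (cs k) \<longrightarrow>
    sqrt t ^ CARD('d) * (a n x * tilt (cs k) x) \<le> C * exp (- \<kappa> * (t - real n)\<^sup>2 / max t \<bar>t - real n\<bar>)) sequentially"
    using a_tail[OF c csc cs(2)] by blast
  have "eventually (\<lambda>k. t k \<ge> 1) sequentially" using tlim by (simp add: filterlim_at_top)
  with tail have "eventually (\<lambda>k. \<forall>r. norm (S k r) \<le> C * exp (3 * \<kappa>) * exp (- \<kappa> * \<bar>r\<bar>)) sequentially"
  proof eventually_elim
    case (elim k)
    show ?case
    proof
      fix r
      show "norm (S k r) \<le> C * exp (3 * \<kappa>) * exp (- \<kappa> * \<bar>r\<bar>)"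
      proof (cases "t k + r * sqrt (t k) \<ge> 0")
        case True
        let ?R = "(t k - real (n r k))\<^sup>2 / max (t k) \<bar>t k - real (n r k)\<bar>"
        have "S k r \<le> C * exp (- \<kappa> * ?R)"
          using elim(1)[rule_format, OF elim(2) xt, of "n r k"] True by (simp add: S_def)
        also have "\<dots> \<le> C * exp (- \<kappa> * (\<bar>r\<bar> - 3))"
          using floor_deviation[OF elim(2) True n_def] C
          by (intro mult_left_mono exp_le_cancel_iff[THEN iffD2] mult_left_mono_neg) auto
        also have "\<dots> = C * exp (3 * \<kappa>) * exp (- \<kappa> * \<bar>r\<bar>)"
          by (simp add: algebra_simps flip: exp_add)
        finally show ?thesis using Snn[of k r] by simp
      qed (use C in \<open>simp add: S_def\<close>)
    qed
  qed
  then obtain N where N: "\<And>k r. k \<ge> N \<Longrightarrow> norm (S k r) \<le> C * exp (3 * \<kappa>) * exp (- \<kappa> * \<bar>r\<bar>)"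
    by (auto simp: eventually_sequentially)
  have wint: "integrable lborel (\<lambda>r. C * exp (3 * \<kappa>) * exp (- \<kappa> * \<bar>r\<bar>))"
    by (intro integrable_mult_right integrable_exp_abs C)
  have limN: "(\<lambda>k. S (k + N) r) \<longlonglongrightarrow> limit_density c r" for r
    using LIMSEQ_ignore_initial_segment[OF Slim[of r], of N] .
  have dint: "integrable lborel (limit_density c)"
    by (rule integrable_dominated_convergence[where s = "\<lambda>k. S (k + N)", OF dm Sm wint]) (use limN N in auto)
  have "(\<lambda>k. integral\<^sup>L lborel (S (k + N))) \<longlonglongrightarrow> integral\<^sup>L lborel (limit_density c)"
    by (rule integral_dominated_convergence[where s = "\<lambda>k. S (k + N)", OF dm Sm wint]) (use limN N in auto)
  then have Sint: "(\<lambda>k. integral\<^sup>L lborel (S k)) \<longlonglongrightarrow> integral\<^sup>L lborel (limit_density c)"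
    by (rule LIMSEQ_offset)
  have val: "norm (vreal (xs k)) powr ((real CARD('d) - 1) / 2) * ((\<Sum>n. a n (xs k)) * tilt (cs k) (xs k))
      = norm (mean (cs k)) powr ((real CARD('d) - 1) / 2) * integral\<^sup>L lborel (S k)" for k
  proof -
    let ?p = "sqrt (t k) ^ CARD('d) * tilt (cs k) (xs k)"
    let ?g = "\<lambda>n. ?p * a n (xs k)"
    have st: "sqrt (t k) > 0" using tpos[of k] by simp
    have "?p * (\<Sum>n. a n (xs k)) = (\<Sum>n. ?g n)"
      by (rule suminf_mult[OF a_summable, symmetric])
    also have "\<dots> = (\<integral>s. (if (s::real) \<ge> 0 then ?g (nat \<lfloor>s\<rfloor>) else 0) \<partial>lborel)"
      by (rule suminf_eq_integral_floor[symmetric]) (use st in \<open>auto intro!: summable_mult a_summable\<close>)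
    also have "\<dots> = sqrt (t k) * (\<integral>r. (if t k + sqrt (t k) * r \<ge> 0 then ?g (nat \<lfloor>t k + sqrt (t k) * r\<rfloor>) else 0) \<partial>lborel)"
      using st by (subst lborel_integral_real_affine[where c = "sqrt (t k)" and t = "t k"]) auto
    also have "(\<lambda>r. if t k + sqrt (t k) * r \<ge> 0 then ?g (nat \<lfloor>t k + sqrt (t k) * r\<rfloor>) else 0) = S k"
      by (auto simp: S_def n_def mult_ac)
    finally have eq: "?p * (\<Sum>n. a n (xs k)) = sqrt (t k) * integral\<^sup>L lborel (S k)" .
    \<comment> \<open>The division by \<open>sqrt (t k)\<close> is the Jacobian of the change from
      \<open>s\<close> to \<open>r\<close>.\<close>
    have "t k powr ((real CARD('d) - 1) / 2) = sqrt (t k) ^ CARD('d) / sqrt (t k)"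
    proof -
      have "sqrt (t k) ^ CARD('d) = sqrt (t k) powr real CARD('d)"
        by (rule powr_realpow[OF st, symmetric])
      also have "\<dots> = t k powr (1 / 2 * real CARD('d))"
        by (simp only: powr_half_sqrt[OF less_imp_le[OF tpos], symmetric] powr_powr)
      finally have "sqrt (t k) ^ CARD('d) = t k powr (1 / 2 * real CARD('d))" .
      moreover have "sqrt (t k) = t k powr (1 / 2)"
        by (simp only: powr_half_sqrt[OF less_imp_le[OF tpos]])
      ultimately show ?thesis
        by (simp only: powr_diff[symmetric]) (simp add: field_simps)
    qed
    then have "t k powr ((real CARD('d) - 1) / 2) * ((\<Sum>n. a n (xs k)) * tilt (cs k) (xs k)) = (?p * (\<Sum>n. a n (xs k))) / sqrt (t k)"
      by simp
    also have "\<dots> = integral\<^sup>L lborel (S k)" unfolding eq using st by simp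
    finally have "t k powr ((real CARD('d) - 1) / 2) * ((\<Sum>n. a n (xs k)) * tilt (cs k) (xs k)) = integral\<^sup>L lborel (S k)" .
    moreover have "norm (vreal (xs k)) = norm (mean (cs k)) * t k" using mean(1)[of k] by (simp add: t_def)
    then have "norm (vreal (xs k)) powr ((real CARD('d) - 1) / 2) = norm (mean (cs k)) powr ((real CARD('d) - 1) / 2) * t k powr ((real CARD('d) - 1) / 2)"
      using tpos[of k] by (simp add: powr_mult)
    ultimately show ?thesis by simp
  qed
  show ?lim
    unfolding val by (intro tendsto_mult tendsto_powr ml Sint tendsto_const) (use c(2) in auto)
  have "0 < (\<integral>r. limit_density c r \<partial>lborel)"
    using LL(2) by (intro limit_density_integral_pos[OF c(1) _ dnn dint]) (simp only: mult_minus_left minus_minus)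
  then show ?pos using c(2) by simp
qed

end

section \<open>Excursions of nonnegative matrices\<close>

text \<open>The entries lie in an arbitrary commutative ring so that the same identities serve the
  real Laplace matrices and the complex Fourier matrices.\<close>

primrec mpow :: "nat \<Rightarrow> (nat \<Rightarrow> nat \<Rightarrow> 'a::comm_ring_1) \<Rightarrow> nat \<Rightarrow> nat \<Rightarrow> nat \<Rightarrow> 'a" where
  "mpow p F 0 i j = (if i = j then 1 else 0)"
| "mpow p F (Suc n) i j = (\<Sum>k\<in>{1..p}. F i k * mpow p F n k j)"

text \<open>The total weight of the paths of length \<open>n\<close> from \<open>s\<close> to
  \<open>j\<close> that avoid \<open>s\<close> at the times \<open>1, ..., n\<close>.\<close>

primrec taboo :: "nat \<Rightarrow> nat \<Rightarrow> (nat \<Rightarrow> nat \<Rightarrow> 'a::comm_ring_1) \<Rightarrow> nat \<Rightarrow> nat \<Rightarrow> 'a" where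
  "taboo p s F 0 j = (if j = s then 1 else 0)"
| "taboo p s F (Suc n) j = (if j = s then 0 else \<Sum>k\<in>{1..p}. taboo p s F n k * F k j)"

text \<open>The index counts the steps before the return, so \<open>first_return p s F n\<close> weighs excursions of length \<open>n + 1\<close>.\<close>

definition first_return :: "nat \<Rightarrow> nat \<Rightarrow> (nat \<Rightarrow> nat \<Rightarrow> 'a::comm_ring_1) \<Rightarrow> nat \<Rightarrow> 'a" where
  "first_return p s F n = (\<Sum>k\<in>{1..p}. taboo p s F n k * F k s)"

lemma mpow_add:
  assumes "i \<in> {1..p}" "j \<in> {1..p}"
  shows "mpow p F (m + n) i j = (\<Sum>k\<in>{1..p}. mpow p F m i k * mpow p F n k j)"
  using assms
proof (induction m arbitrary: i)
  case 0
  have "(\<Sum>k\<in>{1..p}. mpow p F 0 i k * mpow p F n k j) = (\<Sum>k\<in>{1..p}. if i = k then mpow p F n k j else 0)"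
    by (intro sum.cong) auto
  then show ?case using 0 by simp
next
  case (Suc m)
  have "mpow p F (Suc m + n) i j = (\<Sum>l\<in>{1..p}. F i l * (\<Sum>k\<in>{1..p}. mpow p F m l k * mpow p F n k j))"
    using Suc by simp
  also have "\<dots> = (\<Sum>k\<in>{1..p}. \<Sum>l\<in>{1..p}. F i l * (mpow p F m l k * mpow p F n k j))"
    unfolding sum_distrib_left by (rule sum.swap)
  also have "\<dots> = (\<Sum>k\<in>{1..p}. mpow p F (Suc m) i k * mpow p F n k j)"
    by (simp add: sum_distrib_right mult.assoc)
  finally show ?case .
qed

lemma mpow_Suc_right:
  assumes "i \<in> {1..p}" "j \<in> {1..p}"
  shows "mpow p F (Suc n) i j = (\<Sum>k\<in>{1..p}. mpow p F n i k * F k j)"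
proof -
  have "mpow p F 1 k j = F k j" if "k \<in> {1..p}" for k
  proof -
    have "mpow p F 1 k j = (\<Sum>l\<in>{1..p}. F k l * (if l = j then 1 else 0))"
      by (simp only: One_nat_def mpow.simps)
    also have "\<dots> = (\<Sum>l\<in>{1..p}. if l = j then F k l else 0)"
      by (intro sum.cong) auto
    also have "\<dots> = F k j" using assms by (subst sum.delta) auto
    finally show ?thesis .
  qed
  then show ?thesis
    using mpow_add[OF assms, of F n 1] by (simp del: mpow.simps)
qed

text \<open>Paths are split at their last visit to \<open>s\<close>.\<close>

lemma last_exit:
  assumes "s \<in> {1..p}" "j \<in> {1..p}"
  shows "mpow p F n s j = (\<Sum>m\<le>n. mpow p F m s s * taboo p s F (n - m) j)"
  using assms(2)
proof (induction n arbitrary: j)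
  case 0
  then show ?case by auto
next
  case (Suc n)
  show ?case
  proof (cases "j = s")
    case True
    have "(\<Sum>m\<le>Suc n. mpow p F m s s * taboo p s F (Suc n - m) s) = (\<Sum>m\<in>{Suc n}. mpow p F m s s * taboo p s F (Suc n - m) s)"
      by (rule sum.mono_neutral_right) (auto simp: Suc_diff_le)
    then show ?thesis using True by simp
  next
    case False
    have "mpow p F (Suc n) s j = (\<Sum>k\<in>{1..p}. (\<Sum>m\<le>n. mpow p F m s s * taboo p s F (n - m) k) * F k j)"
      unfolding mpow_Suc_right[OF assms(1) Suc.prems] by (intro sum.cong refl) (simp only: Suc.IH)
    also have "\<dots> = (\<Sum>m\<le>n. \<Sum>k\<in>{1..p}. mpow p F m s s * taboo p s F (n - m) k * F k j)"
      unfolding sum_distrib_right by (rule sum.swap)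
    also have "\<dots> = (\<Sum>m\<le>n. mpow p F m s s * taboo p s F (Suc n - m) j)"
      using False by (intro sum.cong) (auto simp: Suc_diff_le sum_distrib_left mult.assoc)
    finally show ?thesis using False by simp
  qed
qed

text \<open>The renewal equation, splitting off the last excursion, which ends at time
  \<open>n + 1\<close>.\<close>

lemma first_return_decomposition:
  assumes "s \<in> {1..p}"
  shows "mpow p F (Suc n) s s = (\<Sum>m\<le>n. mpow p F m s s * first_return p s F (n - m))"
proof -
  have "mpow p F (Suc n) s s = (\<Sum>k\<in>{1..p}. (\<Sum>m\<le>n. mpow p F m s s * taboo p s F (n - m) k) * F k s)"
    unfolding mpow_Suc_right[OF assms assms] by (intro sum.cong refl) (simp only: last_exit[OF assms])
  also have "\<dots> = (\<Sum>m\<le>n. \<Sum>k\<in>{1..p}. mpow p F m s s * taboo p s F (n - m) k * F k s)"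
    unfolding sum_distrib_right by (rule sum.swap)
  finally show ?thesis by (simp add: first_return_def sum_distrib_left mult.assoc)
qed

text \<open>Cauchy products of the two decompositions. Summability is asked of the norms because the
  entries may be complex.\<close>

lemma
  fixes F :: "nat \<Rightarrow> nat \<Rightarrow> 'a::{real_normed_field, banach}"
  assumes s: "s \<in> {1..p}" "j \<in> {1..p}"
    and A: "summable (\<lambda>n. norm (mpow p F n s s))"
    and H: "summable (\<lambda>n. norm (taboo p s F n j))"
    and R: "summable (\<lambda>n. norm (first_return p s F n))"
  shows green_sums: "(\<lambda>n. mpow p F n s j) sums ((\<Sum>n. mpow p F n s s) * (\<Sum>n. taboo p s F n j))"
    and return_equation: "(\<Sum>n. mpow p F n s s) * (1 - (\<Sum>n. first_return p s F n)) = 1"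
proof -
  show "(\<lambda>n. mpow p F n s j) sums ((\<Sum>n. mpow p F n s s) * (\<Sum>n. taboo p s F n j))"
    unfolding last_exit[OF s] by (rule Cauchy_product_sums[OF A H])
  have "(\<lambda>n. mpow p F (Suc n) s s) sums ((\<Sum>n. mpow p F n s s) * (\<Sum>n. first_return p s F n))"
    unfolding first_return_decomposition[OF s(1)] by (rule Cauchy_product_sums[OF A R])
  then have "(\<Sum>n. mpow p F (Suc n) s s) = (\<Sum>n. mpow p F n s s) * (\<Sum>n. first_return p s F n)"
    by (rule sums_unique[symmetric])
  then show "(\<Sum>n. mpow p F n s s) * (1 - (\<Sum>n. first_return p s F n)) = 1"
    using suminf_split_head[OF summable_norm_cancel[OF A]] by (simp add: algebra_simps del: mpow.simps(2))
qed

section \<open>Summability for nonnegative and irreducible matrices\<close>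

locale nonneg_matrix =
  fixes p :: nat and F :: "nat \<Rightarrow> nat \<Rightarrow> real"
  assumes F_nonneg: "\<And>i j. i \<in> {1..p} \<Longrightarrow> j \<in> {1..p} \<Longrightarrow> F i j \<ge> 0"
begin

lemma mpow_nonneg: "i \<in> {1..p} \<Longrightarrow> j \<in> {1..p} \<Longrightarrow> mpow p F n i j \<ge> 0"
  by (induction n arbitrary: i) (auto intro!: sum_nonneg mult_nonneg_nonneg F_nonneg)

lemma taboo_nonneg: "j \<in> {1..p} \<Longrightarrow> taboo p s F n j \<ge> 0"
  by (induction n arbitrary: j) (auto intro!: sum_nonneg mult_nonneg_nonneg F_nonneg)

lemma first_return_nonneg: "s \<in> {1..p} \<Longrightarrow> first_return p s F n \<ge> 0"
  unfolding first_return_def by (auto intro!: sum_nonneg mult_nonneg_nonneg F_nonneg taboo_nonneg)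

lemma taboo_step:
  assumes "k \<in> {1..p}" "j \<in> {1..p}" "j \<noteq> s"
  shows "taboo p s F n k * F k j \<le> taboo p s F (Suc n) j"
proof -
  have "taboo p s F n k * F k j \<le> (\<Sum>k\<in>{1..p}. taboo p s F n k * F k j)"
    by (rule member_le_sum) (use assms in \<open>auto intro!: mult_nonneg_nonneg F_nonneg taboo_nonneg\<close>)
  then show ?thesis using assms(3) by simp
qed

lemma summable_taboo_base: "summable (\<lambda>n. taboo p s F n s)"
  by (rule summable_finite[of "{0}"]) (auto simp: gr0_conv_Suc)

text \<open>By the renewal equation the partial sums satisfy
  \<open>S (n + 1) \<le> 1 + \<phi> * S n\<close>, where \<open>\<phi>\<close> is the total return
  weight; hence they stay below \<open>1 / (1 - \<phi>)\<close>.\<close>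

lemma summable_returns:
  assumes s: "s \<in> {1..p}" and R: "summable (first_return p s F)" "(\<Sum>n. first_return p s F n) < 1"
  shows "summable (\<lambda>n. mpow p F n s s)"
proof (rule summableI_nonneg_bounded)
  let ?a = "\<lambda>n. mpow p F n s s" and ?r = "first_return p s F"
  define \<phi> where "\<phi> = suminf ?r"
  show "0 \<le> ?a n" for n using s by (intro mpow_nonneg)
  have le: "sum ?a {..<Suc n} \<le> 1 + sum ?a {..<n} * \<phi>" for n
  proof -
    have "sum ?a {..<Suc n} = 1 + (\<Sum>m<n. ?a (Suc m))"
      by (subst sum.lessThan_Suc_shift) simp
    also have "(\<Sum>m<n. ?a (Suc m)) = (\<Sum>m<n. \<Sum>i\<le>m. ?a i * ?r (m - i))"
      by (simp only: first_return_decomposition[OF s])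
    also have "\<dots> = (\<Sum>(m, i)\<in>(SIGMA m:{..<n}. {..m}). ?a i * ?r (m - i))"
      by (rule sum.Sigma) auto
    also have "\<dots> = (\<Sum>(i, l)\<in>(SIGMA i:{..<n}. {..<n - i}). ?a i * ?r l)"
      by (rule sum.reindex_bij_witness[where i = "\<lambda>(i, l). (i + l, i)" and j = "\<lambda>(m, i). (i, m - i)"]) auto
    also have "\<dots> = (\<Sum>i<n. \<Sum>l<n - i. ?a i * ?r l)"
      by (rule sum.Sigma[symmetric]) auto
    also have "\<dots> \<le> (\<Sum>i<n. ?a i * \<phi>)"
      unfolding sum_distrib_left[symmetric] \<phi>_def using s R(1)
      by (intro sum_mono mult_left_mono sum_le_suminf) (auto intro: mpow_nonneg first_return_nonneg)
    finally show ?thesis by (simp add: sum_distrib_right)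
  qed
  show "sum ?a {..<n} \<le> 1 / (1 - \<phi>)" for n
  proof -
    have "sum ?a {..<n} \<le> sum ?a {..<Suc n}" using s by (auto intro!: mpow_nonneg)
    also have "\<dots> \<le> 1 + sum ?a {..<n} * \<phi>" by (rule le)
    finally show ?thesis using R(2) by (simp add: \<phi>_def field_simps)
  qed
qed

text \<open>Summing the renewal equation gives \<open>A * (1 - R) = 1\<close> with
  \<open>A \<ge> 0\<close>, which forces \<open>R < 1\<close>.\<close>

lemma returns_summable_imp:
  assumes s: "s \<in> {1..p}" and A: "summable (\<lambda>n. mpow p F n s s)"
  shows "summable (first_return p s F)" "(\<Sum>n. first_return p s F n) < 1"
proof -
  let ?a = "\<lambda>n. mpow p F n s s" and ?r = "first_return p s F"
  show r: "summable ?r"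
  proof (rule summable_comparison_test[OF _ A[THEN summable_Suc_iff[THEN iffD2]]], intro exI allI impI)
    fix n
    have "?a 0 * ?r (n - 0) \<le> (\<Sum>m\<le>n. ?a m * ?r (n - m))"
      using s by (intro member_le_sum) (auto intro!: mult_nonneg_nonneg mpow_nonneg first_return_nonneg)
    then show "norm (?r n) \<le> ?a (Suc n)"
      using first_return_nonneg[OF s, of n] unfolding first_return_decomposition[OF s] by simp
  qed
  have An: "summable (\<lambda>n. norm (?a n))" using A mpow_nonneg[OF s s] by simp
  have Rn: "summable (\<lambda>n. norm (?r n))" using r first_return_nonneg[OF s] by simp
  have "(\<lambda>n. ?a (Suc n)) sums (suminf ?a * suminf ?r)"
    unfolding first_return_decomposition[OF s] by (rule Cauchy_product_sums[OF An Rn])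
  then have "(\<Sum>n. ?a (Suc n)) = suminf ?a * suminf ?r" by (rule sums_unique[symmetric])
  then have eq: "suminf ?a * (1 - suminf ?r) = 1"
    using suminf_split_head[OF A] by (simp add: algebra_simps del: mpow.simps(2))
  have "suminf ?a \<ge> 0" by (rule suminf_nonneg[OF A mpow_nonneg[OF s s]])
  show "(\<Sum>n. ?r n) < 1"
  proof (rule ccontr)
    assume "\<not> suminf ?r < 1"
    then have "suminf ?a * (1 - suminf ?r) \<le> 0" using \<open>suminf ?a \<ge> 0\<close> by (simp add: mult_nonneg_nonpos)
    with eq show False by simp
  qed
qed

text \<open>A vector contracted by the factor \<open>\<rho>\<close> away from \<open>s\<close>
  dominates the taboo weights. The criterion consists of finitely many inequalities in the entries
  of \<open>F\<close>.\<close>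

lemma taboo_geometric:
  assumes w: "\<And>j. j \<in> {1..p} \<Longrightarrow> w j \<ge> 0" "w s \<ge> 1" and "0 \<le> \<rho>"
    and le: "\<And>j. j \<in> {1..p} \<Longrightarrow> j \<noteq> s \<Longrightarrow> (\<Sum>k\<in>{1..p}. w k * F k j) \<le> \<rho> * w j"
    and j: "j \<in> {1..p}"
  shows "taboo p s F n j \<le> \<rho> ^ n * w j"
  using j
proof (induction n arbitrary: j)
  case 0
  then show ?case using w by auto
next
  case (Suc n)
  show ?case
  proof (cases "j = s")
    case True
    then show ?thesis using Suc.prems w \<open>0 \<le> \<rho>\<close> by simp
  next
    case False
    have "taboo p s F (Suc n) j \<le> (\<Sum>k\<in>{1..p}. \<rho> ^ n * w k * F k j)"
      using False Suc by (auto intro!: sum_mono mult_right_mono F_nonneg)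
    also have "\<dots> = \<rho> ^ n * (\<Sum>k\<in>{1..p}. w k * F k j)" by (simp add: sum_distrib_left mult.assoc)
    also have "\<dots> \<le> \<rho> ^ n * (\<rho> * w j)" using le[OF Suc.prems False] \<open>0 \<le> \<rho>\<close> by (intro mult_left_mono) auto
    finally show ?thesis by (simp add: mult_ac)
  qed
qed

end

locale irreducible_matrix = nonneg_matrix +
  assumes irreducible: "\<And>i j. i \<in> {1..p} \<Longrightarrow> j \<in> {1..p} \<Longrightarrow> \<exists>n. mpow p F n i j > 0"
begin

text \<open>Summability spreads backwards along edges: one step from \<open>k\<close> to
  \<open>l\<close> bounds the taboo weights at \<open>k\<close> by later ones at \<open>l\<close>,
  or by the return weights if \<open>l = s\<close>. Irreducibility provides a path from
  \<open>j\<close> to \<open>s\<close>.\<close>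

lemma summable_taboo:
  assumes s: "s \<in> {1..p}" and R: "summable (first_return p s F)" and j: "j \<in> {1..p}"
  shows "summable (\<lambda>n. taboo p s F n j)"
proof -
  have step: "summable (\<lambda>n. taboo p s F n k)"
    if "summable (\<lambda>n. taboo p s F n l)" "k \<in> {1..p}" "l \<in> {1..p}" "F k l > 0" for k l
  proof -
    have "summable (\<lambda>n. taboo p s F n k * F k l)"
    proof (cases "l = s")
      case True
      show ?thesis
      proof (rule summable_comparison_test[OF _ R], intro exI allI impI)
        fix n
        have "taboo p s F n k * F k s \<le> (\<Sum>k\<in>{1..p}. taboo p s F n k * F k s)"
          by (rule member_le_sum) (use that s in \<open>auto intro!: mult_nonneg_nonneg F_nonneg taboo_nonneg\<close>)
        then show "norm (taboo p s F n k * F k l) \<le> first_return p s F n"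
          using that True by (simp add: first_return_def abs_mult taboo_nonneg F_nonneg)
      qed
    next
      case False
      show ?thesis
        by (rule summable_comparison_test[OF _ that(1)[THEN summable_Suc_iff[THEN iffD2]]], intro exI allI impI)
          (use that False taboo_step[of k l s] in \<open>simp add: abs_mult taboo_nonneg F_nonneg del: taboo.simps\<close>)
    qed
    from summable_mult2[OF this, of "1 / F k l"] show ?thesis using that by simp
  qed
  have "mpow p F n i s > 0 \<Longrightarrow> i \<in> {1..p} \<Longrightarrow> summable (\<lambda>n. taboo p s F n i)" for n i
  proof (induction n arbitrary: i)
    case 0
    then show ?case using summable_taboo_base by (auto split: if_splits)
  next
    case (Suc n)
    then obtain k where k: "k \<in> {1..p}" "F i k * mpow p F n k s > 0"
      by (metis (no_types, lifting) mpow.simps(2) not_le sum_nonpos)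
    then have "F i k > 0" "mpow p F n k s > 0"
      using F_nonneg[of i k] mpow_nonneg[of k s n] Suc.prems s by (auto simp: zero_less_mult_iff)
    then show ?case using step[of k i] Suc k by blast
  qed
  then show ?thesis using irreducible[OF j s] j by blast
qed

text \<open>Follow a path from \<open>s\<close> to \<open>j\<close>, starting afresh whenever it
  visits \<open>s\<close>.\<close>

lemma taboo_reach:
  assumes s: "s \<in> {1..p}" and j: "j \<in> {1..p}"
  shows "\<exists>n. taboo p s F n j > 0"
proof -
  have "mpow p F n s i > 0 \<Longrightarrow> i \<in> {1..p} \<Longrightarrow> \<exists>n. taboo p s F n i > 0" for n i
  proof (induction n arbitrary: i)
    case 0
    then show ?case by (intro exI[of _ 0]) (auto split: if_splits)
  next
    case (Suc n)
    show ?case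
    proof (cases "i = s")
      case True
      then show ?thesis by (intro exI[of _ 0]) simp
    next
      case False
      from Suc.prems obtain k where k: "k \<in> {1..p}" "mpow p F n s k * F k i > 0"
        unfolding mpow_Suc_right[OF s Suc.prems(2)] by (metis (no_types, lifting) not_le sum_nonpos)
      then have "F k i > 0" "mpow p F n s k > 0"
        using F_nonneg[of k i] mpow_nonneg[of s k n] Suc.prems s by (auto simp: zero_less_mult_iff)
      then obtain m where "taboo p s F m k > 0" using Suc.IH k by blast
      then have "0 < taboo p s F m k * F k i" using \<open>F k i > 0\<close> by simp
      also have "\<dots> \<le> taboo p s F (Suc m) i" using k Suc.prems False by (intro taboo_step) auto
      finally show ?thesis by blast
    qed
  qed
  then show ?thesis using irreducible[OF s j] j by blast
qed

text \<open>The weights \<open>min (n + 1) (m + 1)\<close> make \<open>w\<close> strictly superharmonic for the taboo matrix as soon as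
  every state is visited before time \<open>m\<close>; strictness is what survives small perturbations of \<open>F\<close>.\<close>

lemma strict_superharmonic:
  assumes s: "s \<in> {1..p}" and R: "summable (first_return p s F)"
  shows "\<exists>w \<rho>. 0 < \<rho> \<and> \<rho> < 1 \<and> w s \<ge> 1 \<and> (\<forall>j\<in>{1..p}. w j > 0) \<and>
    (\<forall>j\<in>{1..p}. j \<noteq> s \<longrightarrow> (\<Sum>k\<in>{1..p}. w k * F k j) < \<rho> * w j)"
proof -
  let ?t = "taboo p s F"
  obtain N where N: "\<And>j. j \<in> {1..p} \<Longrightarrow> ?t (N j) j > 0" using taboo_reach[OF s] by metis
  define m where "m = (\<Sum>j\<in>{1..p}. N j)"
  have Nm: "N j \<le> m" if "j \<in> {1..p}" for j unfolding m_def using that by (intro member_le_sum) auto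
  \<comment> \<open>The weights grow by 1 up to index \<open>m\<close> and are constant afterwards,
    so they are bounded and still increase at every time \<open>N j\<close>.\<close>
  define c where "c n = real (min (Suc n) (Suc m))" for n
  have c: "0 < c n" "c n \<le> real (Suc m)" "c 0 = 1" for n by (auto simp: c_def)
  define w where "w j = (\<Sum>n. c n * ?t n j)" for j
  have sm: "summable (\<lambda>n. c n * ?t n j)" if "j \<in> {1..p}" for j
  proof (rule summable_comparison_test[OF _ summable_mult[OF summable_taboo[OF s R that], of "real (Suc m)"]], intro exI allI impI)
    fix n
    show "norm (c n * ?t n j) \<le> real (Suc m) * ?t n j"
      using c(1,2)[of n] taboo_nonneg[OF that, of s n] by (simp add: abs_mult mult_right_mono)
  qed
  have cn: "0 \<le> c n * ?t n j" if "j \<in> {1..p}" for n j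
    using c(1)[of n] taboo_nonneg[OF that, of s n] by simp
  have wpos: "w j > 0" if "j \<in> {1..p}" for j
  proof -
    have "0 < c (N j) * ?t (N j) j" using N[OF that] c by simp
    also have "\<dots> \<le> w j"
      unfolding w_def using sum_le_suminf[OF sm[OF that], of "{N j}"] cn[OF that] by simp
    finally show ?thesis .
  qed
  have ws: "w s \<ge> 1"
    unfolding w_def using sum_le_suminf[OF sm[OF s], of "{0}"] cn[OF s] c(3) by simp
  have lt: "(\<Sum>k\<in>{1..p}. w k * F k j) < w j" if j: "j \<in> {1..p}" "j \<noteq> s" for j
  proof -
    have "(\<lambda>n. \<Sum>k\<in>{1..p}. c n * ?t n k * F k j) sums (\<Sum>k\<in>{1..p}. w k * F k j)"
      unfolding w_def by (intro sums_sum sums_mult2 summable_sums sm)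
    moreover have "(\<Sum>k\<in>{1..p}. c n * ?t n k * F k j) = c n * ?t (Suc n) j" for n
      using j by (simp add: sum_distrib_left mult.assoc)
    ultimately have S: "(\<lambda>n. c n * ?t (Suc n) j) sums (\<Sum>k\<in>{1..p}. w k * F k j)" by simp
    have W: "(\<lambda>n. c (Suc n) * ?t (Suc n) j) sums w j"
      using summable_sums[OF sm[OF j(1)]] sums_Suc_iff[where f = "\<lambda>n. c n * ?t n j" and s = "w j"] j
      by (simp add: w_def)
    have D: "(\<lambda>n. (c (Suc n) - c n) * ?t (Suc n) j) sums (w j - (\<Sum>k\<in>{1..p}. w k * F k j))"
      using sums_diff[OF W S] by (simp add: left_diff_distrib)
    \<comment> \<open>Since \<open>j \<noteq> s\<close>, the time \<open>N j\<close> is positive;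
      the increment of \<open>c\<close> just before it yields the strict inequality.\<close>
    obtain n where n: "N j = Suc n" using N[OF j(1)] j(2) by (cases "N j") (auto split: if_splits)
    have mono: "0 \<le> c (Suc n) - c n" for n by (auto simp: c_def)
    have "0 < (c (Suc n) - c n) * ?t (Suc n) j"
      using N[OF j(1)] Nm[OF j(1)] n by (auto simp: c_def simp del: taboo.simps)
    also have "\<dots> \<le> (\<Sum>n. (c (Suc n) - c n) * ?t (Suc n) j)"
      using sum_le_suminf[OF sums_summable[OF D], of "{n}"] mono taboo_nonneg[OF j(1)]
      by (auto intro!: mult_nonneg_nonneg simp del: taboo.simps)
    also have "\<dots> = w j - (\<Sum>k\<in>{1..p}. w k * F k j)" using D by (rule sums_unique[symmetric])
    finally show ?thesis by simp
  qed
  \<comment> \<open>The inserted 0 gives the maximum a value when \<open>s\<close> is the only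
    state; \<open>\<rho>\<close> then lies halfway between \<open>\<rho>0\<close> and 1.\<close>
  define \<rho>0 where "\<rho>0 = Max (insert 0 ((\<lambda>j. (\<Sum>k\<in>{1..p}. w k * F k j) / w j) ` ({1..p} - {s})))"
  have "\<rho>0 < 1" "\<rho>0 \<ge> 0" using lt wpos by (auto simp: \<rho>0_def)
  define \<rho> where "\<rho> = (1 + \<rho>0) / 2"
  have "(\<Sum>k\<in>{1..p}. w k * F k j) < \<rho> * w j" if "j \<in> {1..p}" "j \<noteq> s" for j
  proof -
    have "(\<Sum>k\<in>{1..p}. w k * F k j) / w j \<le> \<rho>0" unfolding \<rho>0_def using that by (intro Max_ge) auto
    also have "\<dots> < \<rho>" using \<open>\<rho>0 < 1\<close> by (simp add: \<rho>_def)
    finally show ?thesis using wpos[OF that(1)] by (simp add: field_simps)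
  qed
  then show ?thesis
    using wpos ws \<open>\<rho>0 < 1\<close> \<open>\<rho>0 \<ge> 0\<close> by (intro exI[of _ w] exI[of _ \<rho>]) (auto simp: \<rho>_def)
qed

text \<open>A loop at \<open>j\<close>, preceded by a path from \<open>i\<close> and followed by one
  back, is a loop at \<open>i\<close>. This symmetry in the base state makes \<open>D\<close> common
  to all excursion walks.\<close>

lemma summable_returns_cong:
  assumes "i \<in> {1..p}" "j \<in> {1..p}" "summable (\<lambda>n. mpow p F n i i)"
  shows "summable (\<lambda>n. mpow p F n j j)"
proof -
  obtain m l where m: "mpow p F m i j > 0" and l: "mpow p F l j i > 0"
    using irreducible[of i j] irreducible[of j i] assms by blast
  have ge: "mpow p F a u v * mpow p F c v x \<le> mpow p F (a + c) u x"
    if "u \<in> {1..p}" "v \<in> {1..p}" "x \<in> {1..p}" for a c u v x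
    unfolding mpow_add[OF that(1,3)] using that
    by (intro member_le_sum[of v "{1..p}" "\<lambda>k. mpow p F a u k * mpow p F c k x"]) (auto intro!: mult_nonneg_nonneg mpow_nonneg)
  have "summable (\<lambda>n. mpow p F (n + (m + l)) i i)" using summable_ignore_initial_segment[OF assms(3)] .
  then have "summable (\<lambda>n. (mpow p F m i j * mpow p F l j i) * mpow p F n j j)"
  proof (rule summable_comparison_test[rotated], intro exI allI impI)
    fix n
    have "mpow p F m i j * (mpow p F n j j * mpow p F l j i) \<le> mpow p F m i j * mpow p F (n + l) j i"
      using assms m by (intro mult_left_mono ge) auto
    also have "\<dots> \<le> mpow p F (m + (n + l)) i i" using assms by (intro ge) auto
    finally show "norm ((mpow p F m i j * mpow p F l j i) * mpow p F n j j) \<le> mpow p F (n + (m + l)) i i"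
      using m l mpow_nonneg[OF assms(2,2), of n] by (simp add: abs_mult ac_simps)
  qed
  from summable_mult[OF this, of "1 / (mpow p F m i j * mpow p F l j i)"] m l show ?thesis by simp
qed

text \<open>In the supremum norm weighted by the superharmonic vector, \<open>F\<close> contracts
  off \<open>s\<close>, and \<open>d\<close> vanishes at \<open>s\<close>; iterating
  \<open>d = d F\<close> therefore forces \<open>d = 0\<close>. This yields uniqueness of the
  stationary distribution.\<close>

lemma stationary_vanishes:
  assumes s: "s \<in> {1..p}" and R: "summable (first_return p s F)"
    and d: "d s = 0" "\<And>j. j \<in> {1..p} \<Longrightarrow> (\<Sum>k\<in>{1..p}. d k * F k j) = d j" and j: "j \<in> {1..p}"
  shows "d j = 0"
proof -
  obtain w \<rho> where \<rho>: "0 < \<rho>" "\<rho> < 1" and w: "\<And>j. j \<in> {1..p} \<Longrightarrow> w j > 0"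
    "\<And>j. j \<in> {1..p} \<Longrightarrow> j \<noteq> s \<Longrightarrow> (\<Sum>k\<in>{1..p}. w k * F k j) < \<rho> * w j"
    using strict_superharmonic[OF s R] by blast
  define K where "K = (\<Sum>k\<in>{1..p}. \<bar>d k\<bar> / w k)"
  have "K \<ge> 0" unfolding K_def using w(1) by (intro sum_nonneg divide_nonneg_nonneg) (auto intro: less_imp_le)
  have "\<bar>d i\<bar> \<le> K * \<rho> ^ n * w i" if "i \<in> {1..p}" for n i
    using that
  proof (induction n arbitrary: i)
    case 0
    have "\<bar>d i\<bar> / w i \<le> K"
      unfolding K_def by (rule member_le_sum) (use w(1) 0 in \<open>auto intro!: divide_nonneg_pos\<close>)
    then show ?case using w(1)[OF 0] by (simp add: field_simps)
  next
    case (Suc n)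
    show ?case
    proof (cases "i = s")
      case True
      then show ?thesis using d(1) \<rho> w(1)[OF Suc.prems] \<open>K \<ge> 0\<close> by simp
    next
      case False
      have "\<bar>d i\<bar> \<le> (\<Sum>k\<in>{1..p}. \<bar>d k * F k i\<bar>)"
        unfolding d(2)[OF Suc.prems, symmetric] by (rule sum_abs)
      also have "\<dots> \<le> (\<Sum>k\<in>{1..p}. K * \<rho> ^ n * w k * F k i)"
        using Suc F_nonneg[OF _ Suc.prems] by (intro sum_mono) (auto simp: abs_mult intro!: mult_right_mono)
      also have "\<dots> = K * \<rho> ^ n * (\<Sum>k\<in>{1..p}. w k * F k i)" by (simp add: sum_distrib_left mult.assoc)
      also have "\<dots> \<le> K * \<rho> ^ n * (\<rho> * w i)"
        using w(2)[OF Suc.prems False] \<rho> \<open>K \<ge> 0\<close> by (intro mult_left_mono) auto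
      finally show ?thesis by (simp add: mult_ac)
    qed
  qed
  moreover have "(\<lambda>n. K * \<rho> ^ n * w j) \<longlonglongrightarrow> K * 0 * w j"
    using \<rho> by (intro tendsto_intros LIMSEQ_power_zero) auto
  ultimately have "\<bar>d j\<bar> \<le> 0" using j by (intro LIMSEQ_le_const) auto
  then show ?thesis by simp
qed

end

text \<open>For a stochastic matrix the taboo mass lost in one step is exactly the mass returning to
  \<open>s\<close>.\<close>

lemma sum_taboo_Suc:
  assumes s: "s \<in> {1..p}" and F: "\<And>k. k \<in> {1..p} \<Longrightarrow> (\<Sum>j\<in>{1..p}. F k j) = 1"
  shows "(\<Sum>j\<in>{1..p}. taboo p s F (Suc n) j) = (\<Sum>j\<in>{1..p}. taboo p s F n j) - first_return p s F n"
proof -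
  let ?t = "taboo p s F"
  have "(\<Sum>j\<in>{1..p}. ?t (Suc n) j) = (\<Sum>j\<in>{1..p} - {s}. ?t (Suc n) j)"
    using s by (subst sum.remove[of _ s]) auto
  also have "\<dots> = (\<Sum>j\<in>{1..p} - {s}. \<Sum>k\<in>{1..p}. ?t n k * F k j)"
    by (intro sum.cong) auto
  also have "\<dots> = (\<Sum>j\<in>{1..p}. \<Sum>k\<in>{1..p}. ?t n k * F k j) - first_return p s F n"
    using s by (subst sum.remove[of "{1..p}" s]) (auto simp: first_return_def)
  also have "(\<Sum>j\<in>{1..p}. \<Sum>k\<in>{1..p}. ?t n k * F k j) = (\<Sum>k\<in>{1..p}. \<Sum>j\<in>{1..p}. ?t n k * F k j)"
    by (rule sum.swap)
  also have "\<dots> = (\<Sum>k\<in>{1..p}. ?t n k)"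
    by (intro sum.cong refl) (simp only: F sum_distrib_left[symmetric] mult_1_right)
  finally show ?thesis .
qed

lemma suminf_taboo_base: "(\<Sum>n. taboo p s F n s) = (1::real)"
proof -
  have "(\<lambda>n. taboo p s F n s) sums (\<Sum>n\<in>{0}. taboo p s F n s)"
    by (rule sums_finite) (auto simp: gr0_conv_Suc)
  then show ?thesis by (simp add: sums_iff)
qed

lemma suminf_taboo_rec:
  fixes F :: "nat \<Rightarrow> nat \<Rightarrow> real"
  assumes sm: "\<And>k. k \<in> {1..p} \<Longrightarrow> summable (\<lambda>n. taboo p s F n k)" and j: "j \<in> {1..p}" "j \<noteq> s"
  shows "(\<Sum>n. taboo p s F n j) = (\<Sum>k\<in>{1..p}. (\<Sum>n. taboo p s F n k) * F k j)"
proof -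
  have "(\<lambda>n. \<Sum>k\<in>{1..p}. taboo p s F n k * F k j) sums (\<Sum>k\<in>{1..p}. (\<Sum>n. taboo p s F n k) * F k j)"
    by (intro sums_sum sums_mult2 summable_sums sm)
  then have "(\<lambda>n. taboo p s F (Suc n) j) sums (\<Sum>k\<in>{1..p}. (\<Sum>n. taboo p s F n k) * F k j)"
    using j by simp
  from sums_unique[OF this] show ?thesis
    using suminf_split_head[OF sm[OF j(1)]] j by simp
qed

lemma suminf_first_return:
  fixes F :: "nat \<Rightarrow> nat \<Rightarrow> real"
  assumes sm: "\<And>k. k \<in> {1..p} \<Longrightarrow> summable (\<lambda>n. taboo p s F n k)"
  shows "first_return p s F sums (\<Sum>k\<in>{1..p}. (\<Sum>n. taboo p s F n k) * F k s)"
  unfolding first_return_def[abs_def] by (intro sums_sum sums_mult2 summable_sums sm)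

text \<open>Comparing row sums with those of a stochastic matrix \<open>F0\<close> turns the recursions for the
  taboo sums into a first-order formula for the return generating function.\<close>

lemma first_return_minus_1:
  fixes F F0 :: "nat \<Rightarrow> nat \<Rightarrow> real"
  assumes s: "s \<in> {1..p}" and sm: "\<And>k. k \<in> {1..p} \<Longrightarrow> summable (\<lambda>n. taboo p s F n k)"
    and F0: "\<And>k. k \<in> {1..p} \<Longrightarrow> (\<Sum>j\<in>{1..p}. F0 k j) = 1"
  shows "(\<Sum>n. first_return p s F n) - 1 = (\<Sum>k\<in>{1..p}. \<Sum>j\<in>{1..p}. (\<Sum>n. taboo p s F n k) * (F k j - F0 k j))"
proof -
  define h where "h k = (\<Sum>n. taboo p s F n k)" for k
  have h: "h s = 1" "\<And>j. j \<in> {1..p} \<Longrightarrow> j \<noteq> s \<Longrightarrow> (\<Sum>k\<in>{1..p}. h k * F k j) = h j"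
    using suminf_taboo_base[of p s F] suminf_taboo_rec[OF sm] by (auto simp: h_def)
  have R: "(\<Sum>n. first_return p s F n) = (\<Sum>k\<in>{1..p}. h k * F k s)"
    using sums_unique[OF suminf_first_return[OF sm]] by (simp add: h_def)
  have "(\<Sum>k\<in>{1..p}. \<Sum>j\<in>{1..p}. h k * F k j) = (\<Sum>j\<in>{1..p}. \<Sum>k\<in>{1..p}. h k * F k j)"
    by (rule sum.swap)
  also have "\<dots> = (\<Sum>k\<in>{1..p}. h k * F k s) + (\<Sum>j\<in>{1..p} - {s}. h j)"
    using s h(2) by (subst sum.remove[of "{1..p}" s]) (auto intro!: sum.cong)
  also have "(\<Sum>j\<in>{1..p} - {s}. h j) = (\<Sum>j\<in>{1..p}. h j) - 1"
    using sum.remove[of "{1..p}" s h] s h(1) by simp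
  finally have 1: "(\<Sum>k\<in>{1..p}. \<Sum>j\<in>{1..p}. h k * F k j) = (\<Sum>n. first_return p s F n) + ((\<Sum>j\<in>{1..p}. h j) - 1)"
    unfolding R .
  have 2: "(\<Sum>k\<in>{1..p}. \<Sum>j\<in>{1..p}. h k * F0 k j) = (\<Sum>k\<in>{1..p}. h k)"
    by (intro sum.cong refl) (simp only: F0 sum_distrib_left[symmetric] mult_1_right)
  show ?thesis
    unfolding h_def[symmetric] right_diff_distrib sum_subtractf 1 2 by simp
qed

section \<open>Excursions of Markov-additive processes\<close>

lemma laplace_add:
  assumes "tilt_summable f \<alpha>" "tilt_summable g \<alpha>"
  shows "laplace (\<lambda>x. f x + g x) \<alpha> = laplace f \<alpha> + laplace g \<alpha>"
proof -
  have "complex_of_real (laplace (\<lambda>x. f x + g x) \<alpha>) = of_real (laplace f \<alpha> + laplace g \<alpha>)"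
    using fourier_add[OF assms, of 0] by (simp add: fourier_0 assms tilt_summable_add)
  then show ?thesis by (simp only: of_real_eq_iff)
qed

lemma laplace_sum:
  assumes "finite K" "\<And>k. k \<in> K \<Longrightarrow> tilt_summable (f k) \<alpha>"
  shows "laplace (\<lambda>x. \<Sum>k\<in>K. f k x) \<alpha> = (\<Sum>k\<in>K. laplace (f k) \<alpha>)"
proof -
  have "complex_of_real (laplace (\<lambda>x. \<Sum>k\<in>K. f k x) \<alpha>) = (\<Sum>k\<in>K. fourier (f k) \<alpha> 0)"
    using fourier_sum[OF assms, where \<theta> = 0] fourier_0[OF tilt_summable_sum[OF assms]] by simp
  also have "\<dots> = of_real (\<Sum>k\<in>K. laplace (f k) \<alpha>)"
    unfolding of_real_sum by (intro sum.cong refl fourier_0 assms)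
  finally show ?thesis by (simp only: of_real_eq_iff)
qed

lemma
  assumes "finite K" "\<And>k x. k \<in> K \<Longrightarrow> f k x \<ge> 0" "\<And>k x. k \<in> K \<Longrightarrow> g k x \<ge> 0"
    and "\<And>k. k \<in> K \<Longrightarrow> tilt_summable (f k) \<alpha>" "\<And>k. k \<in> K \<Longrightarrow> tilt_summable (g k) \<alpha>"
  shows tilt_summable_sum_conv: "tilt_summable (\<lambda>x. \<Sum>k\<in>K. conv (f k) (g k) x) \<alpha>"
    and fourier_sum_conv: "fourier (\<lambda>x. \<Sum>k\<in>K. conv (f k) (g k) x) \<alpha> \<theta> = (\<Sum>k\<in>K. fourier (f k) \<alpha> \<theta> * fourier (g k) \<alpha> \<theta>)"
    and laplace_sum_conv: "laplace (\<lambda>x. \<Sum>k\<in>K. conv (f k) (g k) x) \<alpha> = (\<Sum>k\<in>K. laplace (f k) \<alpha> * laplace (g k) \<alpha>)"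
proof -
  have c: "tilt_summable (conv (f k) (g k)) \<alpha>" if "k \<in> K" for k
    using assms that by (intro tilt_summable_conv)
  show "tilt_summable (\<lambda>x. \<Sum>k\<in>K. conv (f k) (g k) x) \<alpha>"
    by (rule tilt_summable_sum[OF assms(1) c])
  show "fourier (\<lambda>x. \<Sum>k\<in>K. conv (f k) (g k) x) \<alpha> \<theta> = (\<Sum>k\<in>K. fourier (f k) \<alpha> \<theta> * fourier (g k) \<alpha> \<theta>)"
    by (rule trans[OF fourier_sum[OF assms(1) c]]) (use assms in \<open>auto intro!: sum.cong fourier_conv\<close>)
  show "laplace (\<lambda>x. \<Sum>k\<in>K. conv (f k) (g k) x) \<alpha> = (\<Sum>k\<in>K. laplace (f k) \<alpha> * laplace (g k) \<alpha>)"
    by (rule trans[OF laplace_sum[OF assms(1) c]]) (use assms in \<open>auto intro!: sum.cong laplace_conv\<close>)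
qed

lemma laplace_cmult: "laplace (\<lambda>x. c * f x) \<alpha> = c * laplace f \<alpha>"
  unfolding laplace_def by (simp only: mult.assoc infsum_cmult_right')

lemma laplace_mono:
  assumes "tilt_summable g \<alpha>" "\<And>x. 0 \<le> f x" "\<And>x. f x \<le> g x"
  shows "laplace f \<alpha> \<le> laplace g \<alpha>"
  using assms tilt_summable_mono[OF assms] unfolding laplace_def tilt_summable_def
  by (intro infsum_mono mult_right_mono) auto

lemma laplace_suminf:
  assumes f: "\<And>n x. f n x \<ge> 0" and s: "\<And>n. tilt_summable (f n) \<alpha>"
    and S: "summable (\<lambda>n. laplace (f n) \<alpha>)"
  shows "laplace (\<lambda>x. \<Sum>n. f n x) \<alpha> = (\<Sum>n. laplace (f n) \<alpha>)"
proof -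
  have "(\<lambda>n. complex_of_real (laplace (f n) \<alpha>)) sums of_real (laplace (\<lambda>x. \<Sum>n. f n x) \<alpha>)"
    using fourier_suminf[OF f s S, of 0] fourier_0[OF s] fourier_0[OF tilt_summable_suminf[OF f s S]] by simp
  then have "(\<lambda>n. laplace (f n) \<alpha>) sums laplace (\<lambda>x. \<Sum>n. f n x) \<alpha>"
    by (simp only: sums_of_real_iff)
  then show ?thesis by (rule sums_unique)
qed

text \<open>The converse of \<open>tilt_summable_suminf\<close>: partial sums of a nonnegative
  series have at most the tilted mass of the whole.\<close>

lemma summable_laplace_of_suminf:
  assumes f: "\<And>n x. f n x \<ge> 0" and s: "\<And>n. tilt_summable (f n) \<alpha>" and p: "\<And>x. summable (\<lambda>n. f n x)"
    and S: "tilt_summable (\<lambda>x. \<Sum>n. f n x) \<alpha>"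
  shows "summable (\<lambda>n. laplace (f n) \<alpha>)"
proof (rule summableI_nonneg_bounded)
  show "0 \<le> laplace (f n) \<alpha>" for n by (intro laplace_nonneg f)
  fix n
  have "(\<Sum>i<n. laplace (f i) \<alpha>) = laplace (\<lambda>x. \<Sum>i<n. f i x) \<alpha>"
    by (rule laplace_sum[symmetric]) (use s in auto)
  also have "\<dots> \<le> laplace (\<lambda>x. \<Sum>n. f n x) \<alpha>"
    using f p by (intro laplace_mono[OF S] sum_nonneg sum_le_suminf) auto
  finally show "(\<Sum>i<n. laplace (f i) \<alpha>) \<le> laplace (\<lambda>x. \<Sum>n. f n x) \<alpha>" .
qed

lemma isCont_laplace:
  assumes "\<And>x. f x \<ge> 0" "exp_dominated f \<alpha> \<delta>" "\<delta> > 0"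
  shows "isCont (laplace f) \<alpha>"
  unfolding continuous_at_sequentially comp_def using tendsto_laplace[OF assms] by blast

lemma tilt_summable_zero [simp]: "tilt_summable (\<lambda>_. 0) \<alpha>"
  and fourier_zero [simp]: "fourier (\<lambda>_. 0) \<alpha> \<theta> = 0" and laplace_zero [simp]: "laplace (\<lambda>_. 0) \<alpha> = 0"
  by (simp_all add: tilt_summable_def fourier_def laplace_def)

locale markov_additive =
  fixes p :: nat and mu :: "'d::finite jumps"
  assumes MAP: "is_MAP p mu" and irred: "MAP_irreducible p mu" and moments: "finite_exp_moments p mu"
begin

lemma mu_nonneg [simp]: "mu i j x \<ge> 0"
  using MAP by (simp add: is_MAP_def)

lemma mu_dominated:
  assumes "i \<in> {1..p}" "j \<in> {1..p}"
  shows "exp_dominated (mu i j) \<alpha> \<delta>"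
  unfolding exp_dominated_def
proof (rule summable_on_comparison_test)
  let ?a = "norm \<alpha> + \<bar>\<delta>\<bar> + 1"
  have "?a > 0" by (simp add: add_nonneg_pos)
  then show "(\<lambda>x. exp (?a * norm (vreal x)) * mu i j x) summable_on UNIV"
    using moments assms unfolding finite_exp_moments_def by blast
  fix x :: "int ^ 'd"
  have "tilt \<alpha> x * exp (\<delta> * norm (vreal x)) \<le> exp (norm \<alpha> * norm (vreal x)) * exp (\<delta> * norm (vreal x))"
    unfolding tilt_def using norm_cauchy_schwarz[of \<alpha> "vreal x"] by (intro mult_right_mono) auto
  also have "\<dots> \<le> exp (?a * norm (vreal x))"
    unfolding exp_add[symmetric] by (auto simp: ring_distribs intro!: add_increasing2 mult_right_mono)
  finally show "mu i j x * tilt \<alpha> x * exp (\<delta> * norm (vreal x)) \<le> exp (?a * norm (vreal x)) * mu i j x"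
    by (simp add: mult.assoc mult.commute[of _ "mu i j x"] mult_left_mono)
qed simp

lemma mu_summable: "i \<in> {1..p} \<Longrightarrow> j \<in> {1..p} \<Longrightarrow> tilt_summable (mu i j) \<alpha>"
  using mu_dominated[of i j \<alpha> 0] by (simp add: exp_dominated_0)

definition P :: "nat \<Rightarrow> nat \<Rightarrow> nat \<Rightarrow> int ^ 'd \<Rightarrow> real" where
  "P n i j x = trans_n p mu n (0, i) (x, j)"

lemma trans_n_shift: "trans_n p mu n (y, i) (x, j) = trans_n p mu n (0, i) (x - y, j)"
proof (induction n arbitrary: y i x)
  case (Suc n)
  have "trans_n p mu n (y + z, k) (x, j) = trans_n p mu n (z, k) (x - y, j)" for z k
    unfolding Suc.IH[of "y + z"] Suc.IH[of z k "x - y"] by (simp add: diff_diff_eq)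
  then show ?case by simp
qed auto

lemma P_0: "P 0 i j = (if i = j then point else (\<lambda>_. 0))"
  by (auto simp: P_def point_def fun_eq_iff)

lemma P_Suc: "P (Suc n) i j = (\<lambda>x. \<Sum>k\<in>{1..p}. conv (mu i k) (P n k j) x)"
proof
  fix x
  have "trans_n p mu n (0 + z, k) (x, j) = P n k j (x - z)" for z k
    using trans_n_shift[of n z k x j] by (simp only: P_def add_0)
  then show "P (Suc n) i j x = (\<Sum>k\<in>{1..p}. conv (mu i k) (P n k j) x)"
    unfolding P_def[of "Suc n"] conv_def by (simp only: trans_n.simps fst_conv snd_conv)
qed

lemma P_nonneg [simp]: "P n i j x \<ge> 0"
  by (induction n arbitrary: i x) (auto simp: P_0 P_Suc intro!: sum_nonneg conv_nonneg)

text \<open>Summability and the two formulas are proved in one induction because the product rule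
  for transforms presupposes summability.\<close>

lemma
  assumes "i \<in> {1..p}" "j \<in> {1..p}"
  shows P_summable: "tilt_summable (P n i j) \<alpha>"
    and fourier_P: "fourier (P n i j) \<alpha> \<theta> = mpow p (\<lambda>i j. fourier (mu i j) \<alpha> \<theta>) n i j"
    and laplace_P: "laplace (P n i j) \<alpha> = mpow p (\<lambda>i j. laplace (mu i j) \<alpha>) n i j"
proof -
  have "tilt_summable (P n i j) \<alpha> \<and> fourier (P n i j) \<alpha> \<theta> = mpow p (\<lambda>i j. fourier (mu i j) \<alpha> \<theta>) n i j
    \<and> laplace (P n i j) \<alpha> = mpow p (\<lambda>i j. laplace (mu i j) \<alpha>) n i j"
    using assms(1)
  proof (induction n arbitrary: i)
    case 0
    then show ?case by (auto simp: P_0)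
  next
    case (Suc n)
    then have t: "tilt_summable (mu i k) \<alpha>" "tilt_summable (P n k j) \<alpha>" if "k \<in> {1..p}" for k
      using that mu_summable by auto
    note sc = tilt_summable_sum_conv fourier_sum_conv laplace_sum_conv
    note sc = sc[where K = "{1..p}" and f = "\<lambda>k. mu i k" and g = "\<lambda>k. P n k j" and \<alpha> = \<alpha>, OF finite_atLeastAtMost mu_nonneg P_nonneg t]
    show ?case
      unfolding P_Suc mpow.simps
      by (intro conjI sc(1) trans[OF sc(2)] trans[OF sc(3)] sum.cong refl) (simp_all only: Suc.IH)
  qed
  then show "tilt_summable (P n i j) \<alpha>" "fourier (P n i j) \<alpha> \<theta> = mpow p (\<lambda>i j. fourier (mu i j) \<alpha> \<theta>) n i j"
    "laplace (P n i j) \<alpha> = mpow p (\<lambda>i j. laplace (mu i j) \<alpha>) n i j" by auto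
qed

abbreviation L :: "real ^ 'd \<Rightarrow> nat \<Rightarrow> nat \<Rightarrow> real" where
  "L \<alpha> i j \<equiv> laplace (mu i j) \<alpha>"

abbreviation F :: "real ^ 'd \<Rightarrow> real ^ 'd \<Rightarrow> nat \<Rightarrow> nat \<Rightarrow> complex" where
  "F \<alpha> \<theta> i j \<equiv> fourier (mu i j) \<alpha> \<theta>"

lemma P_reach: "i \<in> {1..p} \<Longrightarrow> j \<in> {1..p} \<Longrightarrow> \<exists>n. P n i j x > 0"
  using irred by (auto simp: MAP_irreducible_def states_def P_def)

lemma irreducible_L: "irreducible_matrix p (L \<alpha>)"
proof
  show "L \<alpha> i j \<ge> 0" for i j by (rule laplace_nonneg) simp
  fix i j assume ij: "i \<in> {1..p}" "j \<in> {1..p}"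
  then obtain n where "P n i j 0 > 0" using P_reach by blast
  also have "P n i j 0 \<le> mpow p (L \<alpha>) n i j"
    using tilt_term_le_laplace[OF P_nonneg P_summable[OF ij], of n 0] laplace_P[OF ij] by simp
  finally show "\<exists>n. mpow p (L \<alpha>) n i j > 0" by blast
qed

sublocale L: irreducible_matrix p "L \<alpha>" for \<alpha>
  by (rule irreducible_L)

text \<open>\<open>e s n j x\<close> is the probability of moving from \<open>(0, s)\<close> to \<open>(x, j)\<close> in \<open>n\<close> steps with the modulating chain
  avoiding \<open>s\<close> at the times \<open>1, ..., n\<close>, and \<open>r s n x\<close> that of returning to \<open>s\<close> for the first time at time \<open>n + 1\<close>,
  at position \<open>x\<close>. Summed over \<open>n\<close> they give the expected visits \<open>H\<close> and the excursion law \<open>N\<close>.\<close>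

primrec e :: "nat \<Rightarrow> nat \<Rightarrow> nat \<Rightarrow> int ^ 'd \<Rightarrow> real" where
  "e s 0 j = (if j = s then point else (\<lambda>_. 0))"
| "e s (Suc n) j = (if j = s then (\<lambda>_. 0) else (\<lambda>x. \<Sum>k\<in>{1..p}. conv (e s n k) (mu k j) x))"

definition r :: "nat \<Rightarrow> nat \<Rightarrow> int ^ 'd \<Rightarrow> real" where
  "r s n x = (\<Sum>k\<in>{1..p}. conv (e s n k) (mu k s) x)"

lemma e_nonneg [simp]: "e s n j x \<ge> 0"
  by (induction n arbitrary: j x) (auto intro!: sum_nonneg conv_nonneg)

lemma r_nonneg [simp]: "r s n x \<ge> 0"
  unfolding r_def by (intro sum_nonneg conv_nonneg) auto

lemma
  assumes "j \<in> {1..p}"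
  shows e_summable: "tilt_summable (e s n j) \<alpha>"
    and fourier_e: "fourier (e s n j) \<alpha> \<theta> = taboo p s (F \<alpha> \<theta>) n j"
    and laplace_e: "laplace (e s n j) \<alpha> = taboo p s (L \<alpha>) n j"
proof -
  have "tilt_summable (e s n j) \<alpha> \<and> fourier (e s n j) \<alpha> \<theta> = taboo p s (F \<alpha> \<theta>) n j \<and> laplace (e s n j) \<alpha> = taboo p s (L \<alpha>) n j"
    using assms
  proof (induction n arbitrary: j)
    case (Suc n)
    then have t: "tilt_summable (e s n k) \<alpha>" "tilt_summable (mu k j) \<alpha>" if "k \<in> {1..p}" for k
      using that mu_summable by auto
    note sc = tilt_summable_sum_conv fourier_sum_conv laplace_sum_conv
    note sc = sc[where K = "{1..p}" and f = "\<lambda>k. e s n k" and g = "\<lambda>k. mu k j" and \<alpha> = \<alpha>, OF finite_atLeastAtMost e_nonneg mu_nonneg t]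
    show ?case
    proof (cases "j = s")
      case False
      show ?thesis
        unfolding e.simps taboo.simps if_not_P[OF False]
        by (intro conjI sc(1) trans[OF sc(2)] trans[OF sc(3)] sum.cong refl) (simp_all only: Suc.IH)
    qed simp
  qed auto
  then show "tilt_summable (e s n j) \<alpha>" "fourier (e s n j) \<alpha> \<theta> = taboo p s (F \<alpha> \<theta>) n j" "laplace (e s n j) \<alpha> = taboo p s (L \<alpha>) n j"
    by auto
qed

lemma
  assumes s: "s \<in> {1..p}"
  shows r_summable: "tilt_summable (r s n) \<alpha>"
    and fourier_r: "fourier (r s n) \<alpha> \<theta> = first_return p s (F \<alpha> \<theta>) n"
    and laplace_r: "laplace (r s n) \<alpha> = first_return p s (L \<alpha>) n"
proof -
  have t: "tilt_summable (e s n k) \<alpha>" "tilt_summable (mu k s) \<alpha>" if "k \<in> {1..p}" for k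
    using that e_summable mu_summable s by auto
  note sc = tilt_summable_sum_conv fourier_sum_conv laplace_sum_conv
  note sc = sc[where K = "{1..p}" and f = "\<lambda>k. e s n k" and g = "\<lambda>k. mu k s" and \<alpha> = \<alpha>, OF finite_atLeastAtMost e_nonneg mu_nonneg t]
  show "tilt_summable (r s n) \<alpha>" unfolding r_def[abs_def] by (rule sc(1))
  show "fourier (r s n) \<alpha> \<theta> = first_return p s (F \<alpha> \<theta>) n"
    unfolding r_def[abs_def] first_return_def
    by (intro trans[OF sc(2)] sum.cong refl) (simp_all only: fourier_e)
  show "laplace (r s n) \<alpha> = first_return p s (L \<alpha>) n"
    unfolding r_def[abs_def] first_return_def
    by (intro trans[OF sc(3)] sum.cong refl) (simp_all only: laplace_e)
qed

section \<open>The domain of convergence of the excursion law\<close>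

definition good :: "nat \<Rightarrow> real ^ 'd \<Rightarrow> bool" where
  "good s \<alpha> \<longleftrightarrow> summable (first_return p s (L \<alpha>))"

lemma row_sum: "k \<in> {1..p} \<Longrightarrow> (\<Sum>j\<in>{1..p}. L 0 k j) = 1"
  using MAP by (simp add: is_MAP_def laplace_def)

text \<open>At tilt 0, \<open>T n\<close> is the probability of no return by time \<open>n\<close>.
  Its decrements are the return probabilities, so they sum to at most 1, and to exactly 1 once
  \<open>T\<close> tends to 0.\<close>

lemma
  assumes s: "s \<in> {1..p}"
  shows good_0: "good s 0" and first_return_0: "(\<Sum>n. first_return p s (L 0) n) = 1"
proof -
  define T where "T n = (\<Sum>j\<in>{1..p}. taboo p s (L 0) n j)" for n
  have T: "T (Suc n) = T n - first_return p s (L 0) n" for n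
    unfolding T_def by (rule sum_taboo_Suc[OF s row_sum])
  have T0: "T 0 = 1" using s by (simp add: T_def)
  have Tn: "T n \<ge> 0" for n unfolding T_def by (intro sum_nonneg L.taboo_nonneg)
  have S: "(\<Sum>n<m. first_return p s (L 0) n) = 1 - T m" for m
    by (induction m) (auto simp: T0 T)
  show g: "good s 0"
    unfolding good_def
    by (rule summableI_nonneg_bounded[where x = 1]) (use S Tn L.first_return_nonneg[OF s] in auto)
  \<comment> \<open>Irreducibility turns summability of the returns into summability of the taboo
    weights, whose terms tend to 0: the modulating chain is recurrent.\<close>
  have "T \<longlonglongrightarrow> (\<Sum>j\<in>{1..p}. 0)"
    unfolding T_def using L.summable_taboo[OF s g[unfolded good_def]] by (intro tendsto_sum summable_LIMSEQ_zero) auto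
  then have "(\<lambda>m. 1 - T m) \<longlonglongrightarrow> 1 - 0" by (intro tendsto_intros) simp
  then have "first_return p s (L 0) sums 1" unfolding sums_def S by simp
  then show "(\<Sum>n. first_return p s (L 0) n) = 1" by (rule sums_unique[symmetric])
qed

definition H :: "nat \<Rightarrow> nat \<Rightarrow> int ^ 'd \<Rightarrow> real" where
  "H s j x = (\<Sum>n. e s n j x)"

definition N :: "nat \<Rightarrow> int ^ 'd \<Rightarrow> real" where
  "N s x = (\<Sum>n. r s n x)"

context
  fixes s assumes s: "s \<in> {1..p}"
begin

lemma summable_taboo_good: "good s \<alpha> \<Longrightarrow> j \<in> {1..p} \<Longrightarrow> summable (\<lambda>n. taboo p s (L \<alpha>) n j)"
  unfolding good_def by (rule L.summable_taboo[OF s])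

lemma summable_laplace_e: "good s \<alpha> \<Longrightarrow> j \<in> {1..p} \<Longrightarrow> summable (\<lambda>n. laplace (e s n j) \<alpha>)"
  by (simp add: laplace_e summable_taboo_good)

lemma summable_laplace_r: "good s \<alpha> \<Longrightarrow> summable (\<lambda>n. laplace (r s n) \<alpha>)"
  by (simp add: laplace_r[OF s] good_def)

lemma e_summable_pointwise: "j \<in> {1..p} \<Longrightarrow> summable (\<lambda>n. e s n j x)"
  by (rule summable_of_laplace[OF e_nonneg e_summable summable_laplace_e[OF good_0[OF s]]])

lemma r_summable_pointwise: "summable (\<lambda>n. r s n x)"
  by (rule summable_of_laplace[OF r_nonneg r_summable[OF s] summable_laplace_r[OF good_0[OF s]]])

lemma H_nonneg: "j \<in> {1..p} \<Longrightarrow> H s j x \<ge> 0"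
  unfolding H_def by (intro suminf_nonneg e_summable_pointwise) auto

lemma N_nonneg: "N s x \<ge> 0"
  unfolding N_def by (intro suminf_nonneg r_summable_pointwise) auto

lemma H_pos: assumes "j \<in> {1..p}" shows "\<exists>x. H s j x > 0"
proof -
  obtain n where "taboo p s (L 0) n j > 0" using L.taboo_reach[OF s assms] by blast
  then have "laplace (e s n j) 0 > 0" by (simp add: laplace_e[OF assms])
  then obtain x where "e s n j x * tilt 0 x > 0"
    unfolding laplace_def using infsum_pos_imp_term_pos by blast
  then have "0 < e s n j x" by simp
  also have "\<dots> \<le> H s j x"
    unfolding H_def using sum_le_suminf[OF e_summable_pointwise[OF assms], of "{n}" x] by simp
  finally show ?thesis by blast
qed

lemma H_base: "H s s = point"
proof
  fix x
  have "(\<lambda>n. e s n s x) sums (\<Sum>n\<in>{0}. e s n s x)"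
    by (rule sums_finite) (auto simp: gr0_conv_Suc)
  then show "H s s x = point x" by (simp add: H_def sums_iff)
qed

text \<open>Interchange of sums in both directions identifies \<open>good\<close>, a condition on
  matrices, with convergence of the transform of the excursion law.\<close>

lemma N_summable_iff: "tilt_summable (N s) \<alpha> \<longleftrightarrow> good s \<alpha>"
proof
  assume "tilt_summable (N s) \<alpha>"
  then have "summable (\<lambda>n. laplace (r s n) \<alpha>)"
    unfolding N_def[abs_def] by (intro summable_laplace_of_suminf r_summable s r_summable_pointwise) auto
  then show "good s \<alpha>" by (simp add: laplace_r[OF s] good_def)
next
  assume "good s \<alpha>"
  then show "tilt_summable (N s) \<alpha>"
    unfolding N_def[abs_def] by (intro tilt_summable_suminf r_summable s summable_laplace_r) auto
qed

lemma
  assumes "good s \<alpha>"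
  shows fourier_N: "first_return p s (F \<alpha> \<theta>) sums fourier (N s) \<alpha> \<theta>"
    and laplace_N: "laplace (N s) \<alpha> = (\<Sum>n. first_return p s (L \<alpha>) n)"
  using fourier_suminf[OF r_nonneg r_summable[OF s] summable_laplace_r[OF assms]]
    laplace_suminf[OF r_nonneg r_summable[OF s] summable_laplace_r[OF assms]]
  by (simp_all add: fourier_r[OF s] laplace_r[OF s] N_def[abs_def])

lemma
  assumes "good s \<alpha>" "j \<in> {1..p}"
  shows H_summable: "tilt_summable (H s j) \<alpha>"
    and fourier_H: "(\<lambda>n. taboo p s (F \<alpha> \<theta>) n j) sums fourier (H s j) \<alpha> \<theta>"
    and laplace_H: "laplace (H s j) \<alpha> = (\<Sum>n. taboo p s (L \<alpha>) n j)"
  using tilt_summable_suminf[OF e_nonneg e_summable[OF assms(2)] summable_laplace_e[OF assms]]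
    fourier_suminf[OF e_nonneg e_summable[OF assms(2)] summable_laplace_e[OF assms]]
    laplace_suminf[OF e_nonneg e_summable[OF assms(2)] summable_laplace_e[OF assms]]
  by (simp_all add: fourier_e[OF assms(2)] laplace_e[OF assms(2)] H_def[abs_def])

text \<open>The strictly superharmonic vector at \<open>\<alpha>\<close> satisfies finitely many
  strict inequalities between continuous functions of the tilt. They persist nearby, and
  \<open>taboo_geometric\<close> makes the taboo series converge there.\<close>

lemma good_open:
  assumes "good s \<alpha>"
  shows "\<exists>\<delta>>0. \<forall>\<beta>. norm (\<beta> - \<alpha>) < \<delta> \<longrightarrow> good s \<beta>"
proof -
  obtain w \<rho> where \<rho>: "0 < \<rho>" "\<rho> < 1" and w: "w s \<ge> 1" "\<And>j. j \<in> {1..p} \<Longrightarrow> w j > 0"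
    "\<And>j. j \<in> {1..p} \<Longrightarrow> j \<noteq> s \<Longrightarrow> (\<Sum>k\<in>{1..p}. w k * L \<alpha> k j) < \<rho> * w j"
    using L.strict_superharmonic[OF s assms[unfolded good_def]] by blast
  have "isCont (\<lambda>\<beta>. \<Sum>k\<in>{1..p}. w k * L \<beta> k j) \<alpha>" if "j \<in> {1..p}" for j
    using that by (intro continuous_intros isCont_laplace[OF mu_nonneg mu_dominated[of _ _ _ 1]]) auto
  then have "eventually (\<lambda>\<beta>. (\<Sum>k\<in>{1..p}. w k * L \<beta> k j) < \<rho> * w j) (nhds \<alpha>)" if "j \<in> {1..p} - {s}" for j
    using that w(3)[of j] unfolding eventually_nhds_conv_at isCont_def
    by (intro conjI order_tendstoD(2)) auto
  then have "eventually (\<lambda>\<beta>. \<forall>j\<in>{1..p} - {s}. (\<Sum>k\<in>{1..p}. w k * L \<beta> k j) < \<rho> * w j) (nhds \<alpha>)"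
    by (intro eventually_ball_finite) auto
  then obtain \<delta> where d: "\<delta> > 0" "\<And>\<beta> j. dist \<beta> \<alpha> < \<delta> \<Longrightarrow> j \<in> {1..p} - {s} \<Longrightarrow> (\<Sum>k\<in>{1..p}. w k * L \<beta> k j) < \<rho> * w j"
    unfolding eventually_nhds_metric by blast
  have "good s \<beta>" if \<beta>: "norm (\<beta> - \<alpha>) < \<delta>" for \<beta>
  proof -
    have t: "taboo p s (L \<beta>) n j \<le> \<rho> ^ n * w j" if "j \<in> {1..p}" for n j
      using w \<rho> d(2)[of \<beta>] \<beta> that by (intro L.taboo_geometric) (auto simp: dist_norm intro: less_imp_le)
    have "summable (\<lambda>n. taboo p s (L \<beta>) n k * L \<beta> k s)" if k: "k \<in> {1..p}" for k
    proof (rule summable_mult2, rule summable_comparison_test[OF _ summable_mult2[OF summable_geometric, of \<rho> "w k"]])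
      show "\<exists>N. \<forall>n\<ge>N. norm (taboo p s (L \<beta>) n k) \<le> \<rho> ^ n * w k"
        using t[OF k] L.taboo_nonneg[OF k] by auto
    qed (use \<rho> in auto)
    then show ?thesis
      unfolding good_def first_return_def[abs_def] by (intro summable_sum)
  qed
  then show ?thesis using d(1) by blast
qed

lemma H_dominated: "good s \<alpha> \<Longrightarrow> j \<in> {1..p} \<Longrightarrow> \<exists>\<delta>>0. exp_dominated (H s j) \<alpha> \<delta>"
  using good_open[of \<alpha>] exp_dominatedI[of "H s j" _ \<alpha>, OF H_nonneg] H_summable by metis

text \<open>Holding with probability one half makes the excursion walk aperiodic without changing
  the set where its Laplace transform is at most one.\<close>

definition lazy :: "int ^ 'd \<Rightarrow> real" where
  "lazy x = 1 / 2 * (point x + N s x)"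

lemma lazy_nonneg: "lazy x \<ge> 0"
  using N_nonneg by (simp add: lazy_def)

lemma lazy_summable_iff: "tilt_summable lazy \<alpha> \<longleftrightarrow> good s \<alpha>"
proof
  assume "tilt_summable lazy \<alpha>"
  from tilt_summable_cmult[OF this, of 2] have "tilt_summable (N s) \<alpha>"
    by (rule tilt_summable_mono) (use N_nonneg in \<open>auto simp: lazy_def\<close>)
  then show "good s \<alpha>" by (simp add: N_summable_iff)
next
  assume "good s \<alpha>"
  then show "tilt_summable lazy \<alpha>"
    unfolding lazy_def[abs_def] by (intro tilt_summable_cmult tilt_summable_add) (auto simp: N_summable_iff)
qed

lemma fourier_lazy: "good s \<alpha> \<Longrightarrow> fourier lazy \<alpha> \<theta> = (1 + fourier (N s) \<alpha> \<theta>) / 2"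
  unfolding lazy_def[abs_def] by (subst fourier_cmult, subst fourier_add) (auto simp: N_summable_iff)

lemma laplace_lazy: "good s \<alpha> \<Longrightarrow> laplace lazy \<alpha> = (1 + laplace (N s) \<alpha>) / 2"
  unfolding lazy_def[abs_def] by (subst laplace_cmult, subst laplace_add) (auto simp: N_summable_iff)

text \<open>The tilted returns to \<open>s\<close> sum to
  \<open>1 / (1 - laplace (N s) \<alpha>)\<close>, finite exactly below 1; averaging with 1 does not
  move this threshold.\<close>

lemma transient_iff:
  "summable (\<lambda>n. mpow p (L \<alpha>) n s s) \<longleftrightarrow> tilt_summable lazy \<alpha> \<and> laplace lazy \<alpha> < 1"
  using L.summable_returns[OF s, of \<alpha>] L.returns_summable_imp[OF s, of \<alpha>] laplace_lazy[of \<alpha>] laplace_N[of \<alpha>]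
  unfolding lazy_summable_iff good_def by (auto simp: field_simps)

section \<open>The Green function through lazy excursions\<close>

interpretation K: nonneg_kernel lazy
  by standard (rule lazy_nonneg)

text \<open>At a tilt below the threshold both sides have absolutely convergent transforms, namely
  \<open>H / (1 - N)\<close> and half of \<open>H / (1 - (1 + N) / 2)\<close>, and Fourier
  uniqueness applies. The factor \<open>1 / 2\<close> reflects that a lazy walk spends two steps on
  average per excursion.\<close>

lemma green_eq:
  assumes \<alpha>: "tilt_summable lazy \<alpha>" "laplace lazy \<alpha> < 1" and j: "j \<in> {1..p}"
  shows "green p mu (0, s) (x, j) = 1 / 2 * (\<Sum>n. (conv lazy ^^ n) (H s j) x)"
    and "summable (\<lambda>n. P n s j x)" and "summable (\<lambda>n. (conv lazy ^^ n) (H s j) x)"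
proof -
  have g: "good s \<alpha>" using \<alpha> by (simp add: lazy_summable_iff)
  have A: "summable (\<lambda>n. mpow p (L \<alpha>) n s s)" using \<alpha> by (simp add: transient_iff)
  have Hs: "summable (\<lambda>n. taboo p s (L \<alpha>) n j)" by (rule summable_taboo_good[OF g j])
  have R: "summable (first_return p s (L \<alpha>))" using g by (simp add: good_def)
  have PL: "summable (\<lambda>n. laplace (P n s j) \<alpha>)"
    unfolding laplace_P[OF s j]
    using A Hs R L.mpow_nonneg[OF s s] L.taboo_nonneg[OF j] L.first_return_nonneg[OF s]
    by (intro sums_summable[OF green_sums[OF s j]]) auto
  let ?\<Gamma> = "\<lambda>x. \<Sum>n. (conv lazy ^^ n) (H s j) x" and ?G = "\<lambda>x. \<Sum>n. P n s j x"
  note Hn = H_nonneg[OF j] and Hsum = H_summable[OF g j]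
  have kn: "(conv lazy ^^ n) (H s j) x \<ge> 0" for n x by (rule K.step_nonneg[OF Hn])
  have ks: "tilt_summable ((conv lazy ^^ n) (H s j)) \<alpha>" for n by (rule K.tilt_summable_step[OF Hn \<alpha>(1) Hsum])
  have kL: "summable (\<lambda>n. laplace ((conv lazy ^^ n) (H s j)) \<alpha>)"
    unfolding K.laplace_step[OF Hn \<alpha>(1) Hsum]
    using \<alpha>(2) laplace_nonneg[of lazy \<alpha>, OF lazy_nonneg] by (intro summable_mult2 summable_geometric) auto
  show sP: "summable (\<lambda>n. P n s j x)" for x
    by (rule summable_of_laplace[OF P_nonneg P_summable[OF s j] PL])
  show sk: "summable (\<lambda>n. (conv lazy ^^ n) (H s j) x)" for x
    by (rule summable_of_laplace[OF kn ks kL])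
  have "2 * ?G x = ?\<Gamma> x"
  proof (rule fourier_eq_imp_eq[where f = "\<lambda>x. 2 * ?G x" and \<alpha> = \<alpha> and g = ?\<Gamma>])
    show "2 * ?G x \<ge> 0" "?\<Gamma> x \<ge> 0" for x using sP sk kn by (auto intro!: suminf_nonneg)
    show "tilt_summable (\<lambda>x. 2 * ?G x) \<alpha>"
      by (intro tilt_summable_cmult tilt_summable_suminf P_summable s j PL) auto
    show "tilt_summable ?\<Gamma> \<alpha>" by (rule tilt_summable_suminf[OF kn ks kL])
    fix \<theta>
    let ?N = "fourier (N s) \<alpha> \<theta>" and ?H = "fourier (H s j) \<alpha> \<theta>"
    have nA: "summable (\<lambda>n. norm (mpow p (F \<alpha> \<theta>) n s s))"
      using norm_fourier_le[OF P_nonneg P_summable[OF s s]]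
      by (intro summable_comparison_test[OF _ A]) (auto simp: fourier_P[OF s s] laplace_P[OF s s])
    have nH: "summable (\<lambda>n. norm (taboo p s (F \<alpha> \<theta>) n j))"
      using norm_fourier_le[OF e_nonneg e_summable[OF j]]
      by (intro summable_comparison_test[OF _ Hs]) (auto simp: fourier_e[OF j] laplace_e[OF j])
    have nR: "summable (\<lambda>n. norm (first_return p s (F \<alpha> \<theta>) n))"
      using norm_fourier_le[OF r_nonneg r_summable[OF s]]
      by (intro summable_comparison_test[OF _ R]) (auto simp: fourier_r[OF s] laplace_r[OF s])
    define A0 where "A0 = (\<Sum>n. mpow p (F \<alpha> \<theta>) n s s)"
    have A0: "A0 * (1 - ?N) = 1"
      using return_equation[OF s j nA nH nR] sums_unique[OF fourier_N[OF g]] by (simp add: A0_def)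
    have "(\<lambda>n. mpow p (F \<alpha> \<theta>) n s j) sums (A0 * ?H)"
      using green_sums[OF s j nA nH nR] sums_unique[OF fourier_H[OF g j]] by (simp add: A0_def)
    moreover have "(\<lambda>n. mpow p (F \<alpha> \<theta>) n s j) sums fourier ?G \<alpha> \<theta>"
      using fourier_suminf[OF P_nonneg P_summable[OF s j] PL, of \<theta>] by (simp add: fourier_P[OF s j])
    ultimately have G: "fourier ?G \<alpha> \<theta> = A0 * ?H" by (rule sums_unique2[symmetric])
    have nl: "norm (fourier lazy \<alpha> \<theta>) < 1"
      using norm_fourier_le[OF lazy_nonneg \<alpha>(1), of \<theta>] \<alpha>(2) by linarith
    have "(\<lambda>n. fourier lazy \<alpha> \<theta> ^ n * ?H) sums (1 / (1 - fourier lazy \<alpha> \<theta>) * ?H)"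
      by (intro sums_mult2 geometric_sums nl)
    moreover have "(\<lambda>n. fourier lazy \<alpha> \<theta> ^ n * ?H) sums fourier ?\<Gamma> \<alpha> \<theta>"
      using fourier_suminf[OF kn ks kL, of \<theta>] by (simp add: K.fourier_step[OF Hn \<alpha>(1) Hsum])
    ultimately have "fourier ?\<Gamma> \<alpha> \<theta> = 1 / (1 - fourier lazy \<alpha> \<theta>) * ?H" by (rule sums_unique2[symmetric])
    also have "1 - fourier lazy \<alpha> \<theta> = (1 - ?N) / 2" by (simp add: fourier_lazy[OF g] field_simps)
    also have "1 / ((1 - ?N) / 2) = 2 * A0"
      using A0 by (metis divide_divide_eq_right mult.commute mult_1 nonzero_eq_divide_eq mult_zero_right zero_neq_one)
    finally show "fourier (\<lambda>x. 2 * ?G x) \<alpha> \<theta> = fourier ?\<Gamma> \<alpha> \<theta>"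
      using G by (simp add: fourier_cmult[of 2, simplified])
  qed
  then show "green p mu (0, s) (x, j) = 1 / 2 * (\<Sum>n. (conv lazy ^^ n) (H s j) x)"
    by (simp add: green_def P_def)
qed

text \<open>Only reachability calls for an argument: irreducibility concerns the steps of the
  process, while the kernel counts excursions. Positivity is carried over through the equality of
  Green functions.\<close>

lemma lattice_walk_lazy:
  assumes \<alpha>: "tilt_summable lazy \<alpha>" "laplace lazy \<alpha> < 1" and j: "j \<in> {1..p}"
  shows "lattice_walk lazy (H s j)"
proof
  show "H s j x \<ge> 0" for x by (rule H_nonneg[OF j])
  show "\<exists>x. H s j x > 0" by (rule H_pos[OF j])
  show "\<exists>\<delta>>0. exp_dominated (H s j) \<beta> \<delta>" if "tilt_summable lazy \<beta>" for \<beta>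
    using that H_dominated j by (simp add: lazy_summable_iff)
  show "\<exists>\<delta>>0. exp_dominated lazy \<beta> \<delta>" if "tilt_summable lazy \<beta>" for \<beta>
    using that good_open[of \<beta>] exp_dominatedI[of lazy _ \<beta>, OF lazy_nonneg] unfolding lazy_summable_iff by metis
  show "lazy 0 > 0" using N_nonneg[of 0] by (simp add: lazy_def point_def)
  show "\<exists>\<alpha>. tilt_summable lazy \<alpha> \<and> laplace lazy \<alpha> < 1" using \<alpha> by blast
  fix y
  \<comment> \<open>With target \<open>s\<close> itself the weight \<open>H s s\<close> is the unit
    mass, so \<open>green_eq\<close> compares directly with the powers of the kernel applied to
    \<open>point\<close>.\<close>
  obtain n where "0 < P n s s y" using P_reach[OF s s] by blast
  also have "P n s s y \<le> (\<Sum>n. P n s s y)"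
    using sum_le_suminf[OF green_eq(2)[OF \<alpha> s], of "{n}" y] by simp
  also have "\<dots> = 1 / 2 * (\<Sum>n. (conv lazy ^^ n) point y)"
    using green_eq(1)[OF \<alpha> s, of y] by (simp add: green_def P_def H_base)
  finally have "(\<Sum>n. (conv lazy ^^ n) point y) > 0" by simp
  moreover have "(\<Sum>n. (conv lazy ^^ n) point y) = 0" if "\<And>n. (conv lazy ^^ n) point y = 0"
    by (simp only: that suminf_zero)
  ultimately obtain n where "(conv lazy ^^ n) point y \<noteq> 0" by fastforce
  moreover have "(conv lazy ^^ n) point y \<ge> 0" by (rule K.step_nonneg) simp
  ultimately show "\<exists>n. (conv lazy ^^ n) point y > 0" by (intro exI[of _ n]) linarith
qed

end

end

section \<open>Directional limits and the drift condition\<close>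

text \<open>Round long multiples of \<open>u\<close> to the lattice; every direction, rational or
  not, is thereby a limit of lattice directions.\<close>

lemma lattice_direction:
  fixes u :: "real ^ 'd"
  assumes "norm u = 1"
  shows "\<exists>ys. filterlim (\<lambda>k. norm (vreal (ys k))) at_top sequentially \<and> (\<forall>k. ys k \<noteq> 0) \<and>
    (\<lambda>k. vreal (ys k) /\<^sub>R norm (vreal (ys k))) \<longlonglongrightarrow> u"
proof -
  define y :: "nat \<Rightarrow> int ^ 'd" where "y k = (\<chi> i. \<lfloor>real (Suc k) * u $ i\<rfloor>)" for k
  define z where "z k = vreal (y k) /\<^sub>R real (Suc k)" for k
  have z: "z \<longlonglongrightarrow> u"
  proof (rule vec_tendstoI)
    fix i
    have "(\<lambda>k. z k $ i - u $ i) \<longlonglongrightarrow> 0"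
    proof (rule Lim_null_comparison[OF always_eventually LIMSEQ_inverse_real_of_nat], rule allI)
      fix k
      have "z k $ i - u $ i = (of_int \<lfloor>real (Suc k) * u $ i\<rfloor> - real (Suc k) * u $ i) / real (Suc k)"
        by (simp add: z_def y_def field_simps)
      moreover have "\<bar>of_int \<lfloor>real (Suc k) * u $ i\<rfloor> - real (Suc k) * u $ i\<bar> \<le> 1" by linarith
      ultimately show "norm (z k $ i - u $ i) \<le> inverse (real (Suc k))"
        by (simp add: divide_inverse abs_mult mult_left_le_one_le)
    qed
    then show "(\<lambda>k. z k $ i) \<longlonglongrightarrow> u $ i" by (simp add: LIM_zero_iff)
  qed
  have nz: "(\<lambda>k. norm (z k)) \<longlonglongrightarrow> 1" using tendsto_norm[OF z] assms by simp
  have yz: "norm (vreal (y k)) = norm (z k) * real (Suc k)" for k by (simp add: z_def)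
  have lim: "filterlim (\<lambda>k. norm (vreal (y k))) at_top sequentially"
    unfolding yz
    by (rule filterlim_tendsto_pos_mult_at_top[OF nz _ filterlim_compose[OF filterlim_real_sequentially filterlim_Suc]]) simp
  have dir: "(\<lambda>k. vreal (y k) /\<^sub>R norm (vreal (y k))) \<longlonglongrightarrow> u"
  proof -
    have "(\<lambda>k. z k /\<^sub>R norm (z k)) \<longlonglongrightarrow> u /\<^sub>R 1" by (intro tendsto_intros z nz) simp
    moreover have "z k /\<^sub>R norm (z k) = vreal (y k) /\<^sub>R norm (vreal (y k))" for k by (simp add: z_def)
    ultimately show ?thesis by simp
  qed
  obtain M where M: "\<And>k. k \<ge> M \<Longrightarrow> norm (vreal (y k)) \<ge> 1"
    using lim by (auto simp: filterlim_at_top eventually_sequentially)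
  have "y (k + M) \<noteq> 0" for k using M[of "k + M"] by auto
  moreover have "filterlim (\<lambda>k. norm (vreal (y (k + M)))) at_top sequentially"
    using filterlim_compose[OF lim filterlim_add_const_nat_at_top[of M]] by simp
  ultimately show ?thesis
    using LIMSEQ_ignore_initial_segment[OF dir, of M] by (intro exI[of _ "\<lambda>k. y (k + M)"]) auto
qed

text \<open>Convergence along every sequence with converging direction contains both continuity and
  uniformity: continuity by a diagonal choice of lattice points, uniformity by compactness of the
  sphere.\<close>

lemma
  fixes f :: "int ^ 'd \<Rightarrow> real" and g :: "real ^ 'd \<Rightarrow> real"
  assumes lim: "\<And>xs u. filterlim (\<lambda>k. norm (vreal (xs k))) at_top sequentially \<Longrightarrow> (\<And>k. xs k \<noteq> 0) \<Longrightarrow>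
      (\<lambda>k. vreal (xs k) /\<^sub>R norm (vreal (xs k))) \<longlonglongrightarrow> u \<Longrightarrow> norm u = 1 \<Longrightarrow> (\<lambda>k. f (xs k)) \<longlonglongrightarrow> g u"
    and pos: "\<And>u. norm u = 1 \<Longrightarrow> g u > 0"
  shows directional_limit_continuous: "continuous_on (sphere 0 1) g"
    and directional_limit_uniform: "\<epsilon> > 0 \<Longrightarrow> \<exists>R. \<forall>x. norm (vreal x) \<ge> R \<longrightarrow>
      \<bar>f x / g (vreal x /\<^sub>R norm (vreal x)) - 1\<bar> < \<epsilon>"
proof -
  let ?dir = "\<lambda>x::int ^ 'd. vreal x /\<^sub>R norm (vreal x)"
  show cont: "continuous_on (sphere 0 1) g"
    unfolding continuous_on_sequentially comp_def
  proof (intro allI ballI impI, elim conjE)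
    fix us :: "nat \<Rightarrow> real ^ 'd" and u assume u: "u \<in> sphere 0 1" and us: "\<forall>k. us k \<in> sphere 0 1" "us \<longlonglongrightarrow> u"
    \<comment> \<open>For each \<open>us k\<close> a lattice point is chosen that is close to it in
      direction and whose value is close to \<open>g (us k)\<close>; these points form one sequence
      with direction \<open>u\<close>.\<close>
    have "\<exists>x. x \<noteq> 0 \<and> norm (vreal x) \<ge> real k \<and> dist (?dir x) (us k) < inverse (real (Suc k)) \<and> dist (f x) (g (us k)) < inverse (real (Suc k))" for k
    proof -
      have n: "norm (us k) = 1" using us(1) by simp
      obtain ys where ys: "filterlim (\<lambda>k. norm (vreal (ys k))) at_top sequentially" "\<And>k. ys k \<noteq> 0" "(\<lambda>j. ?dir (ys j)) \<longlonglongrightarrow> us k"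
        using lattice_direction[OF n] by blast
      have "eventually (\<lambda>j. norm (vreal (ys j)) \<ge> real k) sequentially" using ys(1) by (simp add: filterlim_at_top)
      moreover have "eventually (\<lambda>j. dist (?dir (ys j)) (us k) < inverse (real (Suc k))) sequentially"
        by (rule tendstoD[OF ys(3)]) simp
      moreover have "eventually (\<lambda>j. dist (f (ys j)) (g (us k)) < inverse (real (Suc k))) sequentially"
        by (rule tendstoD[OF lim[OF ys n]]) simp
      ultimately have "eventually (\<lambda>j. norm (vreal (ys j)) \<ge> real k \<and> dist (?dir (ys j)) (us k) < inverse (real (Suc k)) \<and> dist (f (ys j)) (g (us k)) < inverse (real (Suc k))) sequentially"
        by eventually_elim simp
      then obtain j where "norm (vreal (ys j)) \<ge> real k \<and> dist (?dir (ys j)) (us k) < inverse (real (Suc k)) \<and> dist (f (ys j)) (g (us k)) < inverse (real (Suc k))"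
        using eventually_happens'[OF sequentially_bot] by blast
      then show ?thesis using ys(2) by blast
    qed
    then obtain x where x: "\<And>k. x k \<noteq> 0" "\<And>k. norm (vreal (x k)) \<ge> real k"
      "\<And>k. dist (?dir (x k)) (us k) < inverse (real (Suc k))" "\<And>k. dist (f (x k)) (g (us k)) < inverse (real (Suc k))"
      by metis
    have xl: "filterlim (\<lambda>k. norm (vreal (x k))) at_top sequentially"
      by (rule filterlim_at_top_mono[OF filterlim_real_sequentially]) (use x(2) in auto)
    have "(\<lambda>k. ?dir (x k) - us k) \<longlonglongrightarrow> 0"
      by (rule Lim_null_comparison[OF always_eventually LIMSEQ_inverse_real_of_nat])
        (use x(3) in \<open>auto simp: dist_norm intro: less_imp_le\<close>)
    from tendsto_add[OF this us(2)] have "(\<lambda>k. ?dir (x k)) \<longlonglongrightarrow> u" by simp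
    then have fx: "(\<lambda>k. f (x k)) \<longlonglongrightarrow> g u" using lim[OF xl x(1)] u by simp
    have "(\<lambda>k. f (x k) - g (us k)) \<longlonglongrightarrow> 0"
      by (rule Lim_null_comparison[OF always_eventually LIMSEQ_inverse_real_of_nat])
        (use x(4) in \<open>auto simp: dist_norm intro: less_imp_le\<close>)
    from tendsto_diff[OF fx this] show "(\<lambda>k. g (us k)) \<longlonglongrightarrow> g u" by simp
  qed
  show "\<exists>R. \<forall>x. norm (vreal x) \<ge> R \<longrightarrow> \<bar>f x / g (?dir x) - 1\<bar> < \<epsilon>" if "\<epsilon> > 0"
  proof (rule ccontr)
    assume "\<not> ?thesis"
    then have "\<forall>R. \<exists>x. norm (vreal x) \<ge> R \<and> \<bar>f x / g (?dir x) - 1\<bar> \<ge> \<epsilon>" by (meson not_less)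
    \<comment> \<open>The \<open>+ 1\<close> keeps the points away from the origin, which has no
      direction.\<close>
    then have "\<forall>k::nat. \<exists>x. norm (vreal x) \<ge> real k + 1 \<and> \<bar>f x / g (?dir x) - 1\<bar> \<ge> \<epsilon>" by blast
    then obtain x where x: "\<And>k::nat. norm (vreal (x k)) \<ge> real k + 1" "\<And>k. \<bar>f (x k) / g (?dir (x k)) - 1\<bar> \<ge> \<epsilon>"
      by metis
    have x0: "x k \<noteq> 0" for k
    proof
      assume "x k = 0"
      with x(1)[of k] show False by simp
    qed
    have "\<forall>k. ?dir (x k) \<in> sphere 0 1" using x0 by simp
    then obtain u q where u: "u \<in> sphere 0 1" "strict_mono q" "((\<lambda>k. ?dir (x k)) \<circ> q) \<longlonglongrightarrow> u"
      by (rule seq_compactE[OF compact_imp_seq_compact[OF compact_sphere]])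
    have xl: "filterlim (\<lambda>k. norm (vreal (x k))) at_top sequentially"
      by (rule filterlim_at_top_mono[OF filterlim_real_sequentially]) (intro always_eventually allI order_trans[OF _ x(1)], simp)
    have "(\<lambda>k. f (x (q k))) \<longlonglongrightarrow> g u"
      using lim[of "x \<circ> q" u] filterlim_compose[OF xl filterlim_subseq[OF u(2)]] x0 u by (simp add: comp_def)
    moreover have "(\<lambda>k. g (?dir (x (q k)))) \<longlonglongrightarrow> g u"
      using cont[unfolded continuous_on_sequentially, rule_format, OF u(1), of "\<lambda>k. ?dir (x (q k))"] u(3) x0
      by (simp add: comp_def)
    ultimately have "(\<lambda>k. \<bar>f (x (q k)) / g (?dir (x (q k))) - 1\<bar>) \<longlonglongrightarrow> \<bar>g u / g u - 1\<bar>"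
      using pos[of u] u(1) by (intro tendsto_intros) auto
    then have "(\<lambda>k. \<bar>f (x (q k)) / g (?dir (x (q k))) - 1\<bar>) \<longlonglongrightarrow> 0" using pos[of u] u(1) by simp
    then have "\<epsilon> \<le> 0" by (rule LIMSEQ_le_const) (use x(2) in auto)
    with that show False by simp
  qed
qed

lemma abs_exp_minus_1_le: "\<bar>exp y - 1\<bar> \<le> \<bar>y\<bar> * exp \<bar>y\<bar>" for y :: real
proof (cases "y \<ge> 0")
  case True
  have "1 - y \<le> exp (- y)" using exp_ge_add_one_self[of "- y"] by simp
  then have "exp y * (1 - y) \<le> exp y * exp (- y)" by (intro mult_left_mono) auto
  then show ?thesis using True by (simp add: algebra_simps flip: exp_add)
next
  case False
  have "1 - exp y \<le> - y" using exp_ge_add_one_self[of y] by linarith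
  then have "\<bar>exp y - 1\<bar> \<le> \<bar>y\<bar> * 1" using False by simp
  also have "\<dots> \<le> \<bar>y\<bar> * exp \<bar>y\<bar>" by (intro mult_left_mono) auto
  finally show ?thesis .
qed

lemma norm_le_exp_norm: "norm x \<le> exp (norm x)"
  using exp_ge_add_one_self[of "norm x"] by linarith

section \<open>The stationary distribution and the effect of the drift\<close>

context markov_additive
begin

text \<open>The expected visits during one excursion form an invariant vector; normalised, it is the
  stationary distribution. Its explicit form allows the global drift to be compared with the
  derivative of the return transform.\<close>

lemma stat_dist_eq:
  assumes s: "s \<in> {1..p}" and i: "i \<in> {1..p}"
  shows "stat_dist p mu i = laplace (H s i) 0 / (\<Sum>k\<in>{1..p}. laplace (H s k) 0)"
    and "(\<Sum>k\<in>{1..p}. laplace (H s k) 0) > 0"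
proof -
  define h where "h k = laplace (H s k) 0" for k
  define Z where "Z = (\<Sum>k\<in>{1..p}. h k)"
  note g = good_0[OF s]
  have ht: "h k = (\<Sum>n. taboo p s (L 0) n k)" if "k \<in> {1..p}" for k
    unfolding h_def using laplace_H[OF s g that] .
  have hs: "h s = 1" using ht[OF s] suminf_taboo_base[of p s "L 0"] by simp
  have hn: "h k \<ge> 0" if "k \<in> {1..p}" for k unfolding h_def using H_nonneg[OF s that] by (rule laplace_nonneg)
  note sm = summable_taboo_good[OF s g]
  have stat: "(\<Sum>k\<in>{1..p}. h k * L 0 k j) = h j" if j: "j \<in> {1..p}" for j
  proof (cases "j = s")
    case True
    have "(\<Sum>k\<in>{1..p}. (\<Sum>n. taboo p s (L 0) n k) * L 0 k s) = 1"
      using sums_unique[OF suminf_first_return[OF sm]] first_return_0[OF s] by simp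
    then have "(\<Sum>k\<in>{1..p}. h k * L 0 k s) = 1"
      by (elim trans[rotated], intro sum.cong refl) (simp only: ht)
    then show ?thesis using True hs by simp
  next
    case False
    have "(\<Sum>k\<in>{1..p}. h k * L 0 k j) = (\<Sum>k\<in>{1..p}. (\<Sum>n. taboo p s (L 0) n k) * L 0 k j)"
      by (intro sum.cong refl) (simp only: ht)
    then show ?thesis
      using suminf_taboo_rec[OF sm j False] ht[OF j] by simp
  qed
  have "h s \<le> Z" unfolding Z_def using s hn by (intro member_le_sum) auto
  then have Z: "Z > 0" using hs by simp
  then show "(\<Sum>k\<in>{1..p}. laplace (H s k) 0) > 0" by (simp add: Z_def h_def)
  have "stat_dist p mu = (\<lambda>k. if k \<in> {1..p} then h k / Z else 0)"
    unfolding stat_dist_def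
  proof (rule the_equality)
    have "(\<Sum>k\<in>{1..p}. (if k \<in> {1..p} then h k / Z else 0)) = (\<Sum>k\<in>{1..p}. h k / Z)"
      by (intro sum.cong) auto
    also have "\<dots> = 1" using Z by (simp add: Z_def flip: sum_divide_distrib)
    finally have s1: "(\<Sum>k\<in>{1..p}. (if k \<in> {1..p} then h k / Z else 0)) = 1" .
    have s2: "(\<Sum>k\<in>{1..p}. (if k \<in> {1..p} then h k / Z else 0) * mod_trans mu k j) = (if j \<in> {1..p} then h j / Z else 0)"
      if j: "j \<in> {1..p}" for j
    proof -
      have "(\<Sum>k\<in>{1..p}. (if k \<in> {1..p} then h k / Z else 0) * mod_trans mu k j) = (\<Sum>k\<in>{1..p}. h k * L 0 k j) / Z"
        unfolding sum_divide_distrib by (intro sum.cong) (auto simp: mod_trans_def laplace_def)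
      then show ?thesis using stat[OF j] j by simp
    qed
    show "(\<forall>i\<in>{1..p}. (if i \<in> {1..p} then h i / Z else 0) \<ge> 0) \<and> (\<forall>i. i \<notin> {1..p} \<longrightarrow> (if i \<in> {1..p} then h i / Z else 0) = 0)
      \<and> (\<Sum>i\<in>{1..p}. (if i \<in> {1..p} then h i / Z else 0)) = 1
      \<and> (\<forall>j\<in>{1..p}. (\<Sum>i\<in>{1..p}. (if i \<in> {1..p} then h i / Z else 0) * mod_trans mu i j) = (if j \<in> {1..p} then h j / Z else 0))"
      using s1 s2 hn Z by (intro conjI ballI) auto
  next
    fix \<pi> :: "nat \<Rightarrow> real"
    assume "(\<forall>i\<in>{1..p}. \<pi> i \<ge> 0) \<and> (\<forall>i. i \<notin> {1..p} \<longrightarrow> \<pi> i = 0) \<and> (\<Sum>i\<in>{1..p}. \<pi> i) = 1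
      \<and> (\<forall>j\<in>{1..p}. (\<Sum>i\<in>{1..p}. \<pi> i * mod_trans mu i j) = \<pi> j)"
    then have \<pi>: "\<And>i. i \<notin> {1..p} \<Longrightarrow> \<pi> i = 0" "(\<Sum>i\<in>{1..p}. \<pi> i) = 1" "\<And>j. j \<in> {1..p} \<Longrightarrow> (\<Sum>i\<in>{1..p}. \<pi> i * L 0 i j) = \<pi> j"
      by (auto simp: mod_trans_def laplace_def)
    \<comment> \<open>The difference \<open>\<pi> j - \<pi> s * h j\<close> is invariant and
      vanishes at \<open>s\<close>, so \<open>stationary_vanishes\<close> applies.\<close>
    have eq: "\<pi> j = \<pi> s * h j" if j: "j \<in> {1..p}" for j
    proof -
      have "\<pi> j - \<pi> s * h j = 0"
      proof (rule L.stationary_vanishes[OF s g[unfolded good_def], where d = "\<lambda>j. \<pi> j - \<pi> s * h j"])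
        fix j assume j: "j \<in> {1..p}"
        have "(\<Sum>k\<in>{1..p}. (\<pi> k - \<pi> s * h k) * L 0 k j) = (\<Sum>k\<in>{1..p}. \<pi> k * L 0 k j) - \<pi> s * (\<Sum>k\<in>{1..p}. h k * L 0 k j)"
          by (simp add: sum_subtractf sum_distrib_left algebra_simps)
        then show "(\<Sum>k\<in>{1..p}. (\<pi> k - \<pi> s * h k) * L 0 k j) = \<pi> j - \<pi> s * h j" using \<pi>(3)[OF j] stat[OF j] by simp
      qed (use hs j in auto)
      then show ?thesis by simp
    qed
    have "1 = (\<Sum>i\<in>{1..p}. \<pi> s * h i)" using \<pi>(2) sum.cong[OF refl eq, of "{1..p}"] by simp
    then have "\<pi> s = 1 / Z" using Z by (simp add: Z_def sum_distrib_left[symmetric] field_simps)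
    then show "\<pi> = (\<lambda>k. if k \<in> {1..p} then h k / Z else 0)" using eq \<pi>(1) by (auto simp: fun_eq_iff)
  qed
  then show "stat_dist p mu i = laplace (H s i) 0 / (\<Sum>k\<in>{1..p}. laplace (H s k) 0)"
    using i by (simp add: h_def Z_def)
qed

text \<open>A one-sided derivative along a sequence is all that the drift argument uses; the
  difference quotients are dominated through \<open>abs_exp_minus_1_le\<close>.\<close>

lemma laplace_derivative_0:
  assumes ij: "i \<in> {1..p}" "j \<in> {1..p}" and \<sigma>: "\<sigma> \<longlonglongrightarrow> 0" "\<And>k. 0 < \<sigma> k" "\<And>k. \<sigma> k \<le> 1"
  shows "(\<lambda>k. (L (\<sigma> k *\<^sub>R v) i j - L 0 i j) / \<sigma> k) \<longlonglongrightarrow> v \<bullet> local_drift mu i j"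
proof -
  define q where "q k x = (exp (\<sigma> k * (v \<bullet> vreal x)) - 1) / \<sigma> k" for k and x :: "int ^ 'd"
  have eq: "(L (\<sigma> k *\<^sub>R v) i j - L 0 i j) / \<sigma> k = (\<Sum>\<^sub>\<infinity>x. (mu i j x * tilt 0 x) *\<^sub>R q k x)" for k
  proof -
    have "((\<lambda>x. (mu i j x * tilt (\<sigma> k *\<^sub>R v) x + mu i j x * tilt 0 x * (- 1)) * (1 / \<sigma> k)) has_sum
       (L (\<sigma> k *\<^sub>R v) i j + L 0 i j * (- 1)) * (1 / \<sigma> k)) UNIV"
      unfolding laplace_def
      by (intro has_sum_cmult_left has_sum_add has_sum_infsum mu_summable[OF ij, unfolded tilt_summable_def])
    from infsumI[OF this] show ?thesis by (simp add: q_def tilt_def field_simps)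
  qed
  have "(\<lambda>k. \<Sum>\<^sub>\<infinity>x. (mu i j x * tilt 0 x) *\<^sub>R q k x) \<longlonglongrightarrow> (\<Sum>\<^sub>\<infinity>x. (mu i j x * tilt 0 x) *\<^sub>R (v \<bullet> vreal x))"
  \<comment> \<open>\<open>exp_dominated_tendsto\<close> admits growth at half the margin; a margin
    of \<open>2 * (norm v + 1)\<close> leaves \<open>norm v\<close> for the exponential and 1 for
    the linear factor.\<close>
  proof (rule exp_dominated_tendsto[OF mu_nonneg mu_dominated[OF ij, of 0 "2 * (norm v + 1)"] _ tendsto_const])
    fix x :: "int ^ 'd"
    have "((\<lambda>h. exp (h * (v \<bullet> vreal x))) has_real_derivative exp (0 * (v \<bullet> vreal x)) * (v \<bullet> vreal x)) (at 0)"
      by (auto intro!: derivative_eq_intros)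
    then have "((\<lambda>h. (exp (h * (v \<bullet> vreal x)) - 1) / h) \<longlongrightarrow> v \<bullet> vreal x) (at 0)"
      by (simp add: has_field_derivative_iff)
    moreover have "filterlim \<sigma> (at 0) sequentially"
      using \<sigma> by (auto simp: filterlim_at intro!: always_eventually) (metis less_irrefl)
    ultimately show "(\<lambda>k. q k x) \<longlonglongrightarrow> v \<bullet> vreal x" unfolding q_def by (rule filterlim_compose)
  next
    have "norm (q k x) \<le> norm v * exp (2 * (norm v + 1) / 2 * norm (vreal x))" for k and x :: "int ^ 'd"
    proof -
      let ?y = "v \<bullet> vreal x" and ?n = "norm (vreal x)"
      have y: "\<bar>?y\<bar> \<le> norm v * ?n" by (rule Cauchy_Schwarz_ineq2)
      have "\<bar>exp (\<sigma> k * ?y) - 1\<bar> \<le> \<bar>\<sigma> k * ?y\<bar> * exp \<bar>\<sigma> k * ?y\<bar>" by (rule abs_exp_minus_1_le)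
      then have "norm (q k x) \<le> \<bar>?y\<bar> * exp (\<sigma> k * \<bar>?y\<bar>)"
        using \<sigma>(2)[of k] by (simp add: q_def abs_mult field_simps)
      also have "\<dots> \<le> \<bar>?y\<bar> * exp (1 * \<bar>?y\<bar>)"
        using \<sigma>(3)[of k] by (intro mult_left_mono) (auto intro: mult_left_le_one_le simp: mult_right_le_one_le mult_left_le_one_le \<sigma>(2) less_imp_le)
      also have "\<dots> \<le> (norm v * ?n) * exp (norm v * ?n)"
        using y by (intro mult_mono) auto
      also have "\<dots> \<le> (norm v * exp ?n) * exp (norm v * ?n)"
        by (intro mult_mono mult_left_mono norm_le_exp_norm) auto
      also have "\<dots> = norm v * exp (2 * (norm v + 1) / 2 * ?n)"
        by (simp add: algebra_simps flip: exp_add)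
      finally show ?thesis .
    qed
    then show "eventually (\<lambda>k. \<forall>x. norm (q k x) \<le> norm v * exp (2 * (norm v + 1) / 2 * norm (vreal x))) sequentially" by simp
  qed (simp add: add_nonneg_pos)
  also have "(\<Sum>\<^sub>\<infinity>x. (mu i j x * tilt 0 x) *\<^sub>R (v \<bullet> vreal x)) = v \<bullet> local_drift mu i j"
  proof -
    have "(\<lambda>x. mu i j x *\<^sub>R vreal x) summable_on UNIV"
    proof (rule abs_summable_summable, rule Infinite_Sum.abs_summable_on_comparison_test')
      show "(\<lambda>x. mu i j x * tilt 0 x * exp (1 * norm (vreal x))) summable_on UNIV"
        using mu_dominated[OF ij, of 0 1] by (simp add: exp_dominated_def)
      show "norm (mu i j x *\<^sub>R vreal x) \<le> mu i j x * tilt 0 x * exp (1 * norm (vreal x))" for x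
        by (simp add: mult_left_mono norm_le_exp_norm)
    qed
    from infsumI[OF has_sum_bounded_linear[OF bounded_linear_inner_right has_sum_infsum[OF this], of v]]
    show ?thesis by (simp add: local_drift_def)
  qed
  finally show ?thesis unfolding eq .
qed

text \<open>By \<open>first_return_minus_1\<close> the return transform minus 1 is first order in
  the tilt, with coefficient a positive multiple of the inner product with the global drift. Moving
  from 0 against the drift brings it below 1.\<close>

lemma drift_transient:
  assumes s: "s \<in> {1..p}" and m: "global_drift p mu \<noteq> 0"
  shows "\<exists>\<alpha>. tilt_summable (lazy s) \<alpha> \<and> laplace (lazy s) \<alpha> < 1"
proof -
  define v where "v = - global_drift p mu"
  define \<sigma> where "\<sigma> k = inverse (real (Suc k))" for k
  have "\<sigma> \<longlonglongrightarrow> 0"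
    unfolding \<sigma>_def by (rule LIMSEQ_inverse_real_of_nat)
  moreover have "0 < \<sigma> k" "\<sigma> k \<le> 1" for k
    by (auto simp: \<sigma>_def field_simps)
  ultimately have \<sigma>: "\<sigma> \<longlonglongrightarrow> 0" "\<And>k. 0 < \<sigma> k" "\<And>k. \<sigma> k \<le> 1" by blast+
  define a where "a k = \<sigma> k *\<^sub>R v" for k
  have a0: "a \<longlonglongrightarrow> 0" using tendsto_scaleR[OF \<sigma>(1) tendsto_const[of v]] by (simp add: a_def[abs_def])
  note g0 = good_0[OF s]
  define h where "h i = laplace (H s i) 0" for i
  define Z where "Z = (\<Sum>k\<in>{1..p}. h k)"
  have Z: "Z > 0" using stat_dist_eq(2)[OF s s] by (simp add: Z_def h_def)
  have lim: "(\<lambda>k. \<Sum>i\<in>{1..p}. \<Sum>j\<in>{1..p}. laplace (H s i) (a k) * ((L (a k) i j - L 0 i j) / \<sigma> k)) \<longlonglongrightarrow>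
    (\<Sum>i\<in>{1..p}. \<Sum>j\<in>{1..p}. h i * (v \<bullet> local_drift mu i j))"
  proof (intro tendsto_sum tendsto_mult)
    fix i j assume ij: "i \<in> {1..p}" "j \<in> {1..p}"
    obtain \<delta> where "\<delta> > 0" "exp_dominated (H s i) 0 \<delta>" using H_dominated[OF s g0 ij(1)] by blast
    then show "(\<lambda>k. laplace (H s i) (a k)) \<longlonglongrightarrow> h i"
      unfolding h_def by (intro tendsto_laplace[OF H_nonneg[OF s ij(1)] _ _ a0])
    show "(\<lambda>k. (L (a k) i j - L 0 i j) / \<sigma> k) \<longlonglongrightarrow> v \<bullet> local_drift mu i j"
      unfolding a_def by (rule laplace_derivative_0[OF ij \<sigma>])
  qed
  have "(\<Sum>i\<in>{1..p}. \<Sum>j\<in>{1..p}. h i * (v \<bullet> local_drift mu i j)) = Z * (v \<bullet> global_drift p mu)"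
  proof -
    have "v \<bullet> global_drift p mu = (\<Sum>i\<in>{1..p}. \<Sum>j\<in>{1..p}. stat_dist p mu i * (v \<bullet> local_drift mu i j))"
      by (simp add: global_drift_def inner_sum_right)
    also have "\<dots> = (\<Sum>i\<in>{1..p}. \<Sum>j\<in>{1..p}. h i / Z * (v \<bullet> local_drift mu i j))"
      by (intro sum.cong refl) (simp add: stat_dist_eq(1)[OF s] h_def Z_def)
    finally have "Z * (v \<bullet> global_drift p mu) = (\<Sum>i\<in>{1..p}. \<Sum>j\<in>{1..p}. Z * (h i / Z * (v \<bullet> local_drift mu i j)))"
      by (simp add: sum_distrib_left)
    also have "\<dots> = (\<Sum>i\<in>{1..p}. \<Sum>j\<in>{1..p}. h i * (v \<bullet> local_drift mu i j))"
      using Z by (intro sum.cong) auto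
    finally show ?thesis by simp
  qed
  also have "\<dots> < 0" using Z m by (simp add: v_def mult_pos_neg)
  finally have "eventually (\<lambda>k. (\<Sum>i\<in>{1..p}. \<Sum>j\<in>{1..p}. laplace (H s i) (a k) * ((L (a k) i j - L 0 i j) / \<sigma> k)) < 0) sequentially"
    by (rule order_tendstoD(2)[OF lim])
  moreover obtain \<delta> where \<delta>: "\<delta> > 0" "\<And>\<beta>. norm (\<beta> - 0) < \<delta> \<Longrightarrow> good s \<beta>" using good_open[OF s g0] by blast
  have "eventually (\<lambda>k. good s (a k)) sequentially"
    using tendstoD[OF a0 \<delta>(1)] by eventually_elim (use \<delta>(2) in \<open>simp add: dist_norm\<close>)
  ultimately have "eventually (\<lambda>k. tilt_summable (lazy s) (a k) \<and> laplace (lazy s) (a k) < 1) sequentially"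
  proof eventually_elim
    case (elim k)
    note sm = summable_taboo_good[OF s elim(2)]
    have "(\<Sum>n. first_return p s (L (a k)) n) - 1 = (\<Sum>i\<in>{1..p}. \<Sum>j\<in>{1..p}. (\<Sum>n. taboo p s (L (a k)) n i) * (L (a k) i j - L 0 i j))"
      by (rule first_return_minus_1[OF s sm row_sum])
    also have "\<dots> = (\<Sum>i\<in>{1..p}. \<Sum>j\<in>{1..p}. \<sigma> k * (laplace (H s i) (a k) * ((L (a k) i j - L 0 i j) / \<sigma> k)))"
      using \<sigma>(2)[of k] by (intro sum.cong refl) (simp add: laplace_H[OF s elim(2)])
    also have "\<dots> = \<sigma> k * (\<Sum>i\<in>{1..p}. \<Sum>j\<in>{1..p}. laplace (H s i) (a k) * ((L (a k) i j - L 0 i j) / \<sigma> k))"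
      by (simp add: sum_distrib_left)
    also have "\<dots> < 0" using elim(1) \<sigma>(2)[of k] by (intro mult_pos_neg)
    finally have "laplace (N s) (a k) < 1" using laplace_N[OF s elim(2)] by simp
    then show ?case using laplace_lazy[OF s elim(2)] elim(2) lazy_summable_iff[OF s] by simp
  qed
  then show ?thesis using eventually_happens'[OF sequentially_bot] by blast
qed

end

theorem theorem1p5:
  fixes p :: nat and mu :: "'d::finite jumps"
  assumes "is_MAP p mu"
    and "MAP_irreducible p mu"
    and "MAP_aperiodic p mu"
    and "finite_exp_moments p mu"
    and "global_drift p mu \<noteq> 0"
  shows "\<exists>(c :: real ^ 'd \<Rightarrow> real ^ 'd) (chi :: nat \<Rightarrow> nat \<Rightarrow> real ^ 'd \<Rightarrow> real) C1 C2.
           continuous_on (sphere 0 1) c \<and> C1 > 0 \<and> C2 > 0 \<and>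
           (\<forall>i\<in>{1..p}. \<forall>j\<in>{1..p}.
              continuous_on (sphere 0 1) (chi i j) \<and>
              (\<forall>u\<in>sphere 0 1. C1 \<le> chi i j u \<and> chi i j u \<le> C2) \<and>
              (\<forall>\<epsilon>>0. \<exists>R. \<forall>x::int ^ 'd. norm (vreal x) \<ge> R \<longrightarrow>
                 \<bar>green p mu (0, i) (x, j) /
                   (chi i j (vreal x /\<^sub>R norm (vreal x)) * norm (vreal x) powr (- (real CARD('d) - 1) / 2)
                    * exp (- (c (vreal x /\<^sub>R norm (vreal x)) \<bullet> vreal x))) - 1\<bar> < \<epsilon>))"
proof -
  interpret markov_additive p mu by standard fact+
  have p: "1 \<in> {1..p}" using assms(1) by (simp add: is_MAP_def)
  \<comment> \<open>Written with base state 1; \<open>summable_returns_cong\<close> shows that any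
    other state gives the same set.\<close>
  define E where "E = {\<alpha>. summable (\<lambda>n. mpow p (L \<alpha>) n 1 1)}"
  have E: "{\<alpha>. tilt_summable (lazy s) \<alpha> \<and> laplace (lazy s) \<alpha> < 1} = E" if s: "s \<in> {1..p}" for s
    unfolding E_def transient_iff[OF s, symmetric]
    using L.summable_returns_cong[OF s p] L.summable_returns_cong[OF p s] by blast
  have W: "lattice_walk (lazy i) (H i j)" if "i \<in> {1..p}" "j \<in> {1..p}" for i j
    using drift_transient[OF that(1) assms(5)] lattice_walk_lazy[OF that(1) _ _ that(2)] by blast
  have D: "lattice_walk.D (lazy i) = closure E" if "i \<in> {1..p}" for i
    using lattice_walk.D_eq_closure[OF W[OF that that]] E[OF that] by simp
  \<comment> \<open>The choice is made for base state 1. Since \<open>maximizer\<close> sees the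
    walk only through \<open>D\<close>, the same \<open>c\<close> serves every starting
    state.\<close>
  define c where "c u = (SOME c. lattice_walk.maximizer (lazy 1) u c)" for u
  have mx: "lattice_walk.maximizer (lazy i) u (c u)" if i: "i \<in> {1..p}" for i u
  proof -
    have "lattice_walk.maximizer (lazy 1) u (c u)"
      unfolding c_def by (rule someI_ex, rule lattice_walk.maximizer_exists[OF W[OF p p]])
    then show ?thesis
      unfolding lattice_walk.maximizer_def[OF W[OF p p]] lattice_walk.maximizer_def[OF W[OF i i]] D[OF p] D[OF i] .
  qed
  \<comment> \<open>The factor \<open>1 / 2\<close> is the one of \<open>green_eq\<close>, undoing
    the laziness.\<close>
  define chi where "chi i j u = 1 / 2 * (norm (lattice_walk.mean (lazy i) (c u)) powr ((real CARD('d) - 1) / 2) *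
      (\<integral>r. lattice_walk.limit_density (lazy i) (H i j) (c u) r \<partial>lborel))" for i j u
  define f where "f i j x = norm (vreal x) powr ((real CARD('d) - 1) / 2) *
      (green p mu (0, i) (x, j) * tilt (c (vreal x /\<^sub>R norm (vreal x))) x)" for i j and x :: "int ^ 'd"
  have cont_c: "continuous_on (sphere 0 1) c"
    unfolding continuous_on_sequentially comp_def
  proof (intro allI ballI impI, elim conjE)
    fix us :: "nat \<Rightarrow> real ^ 'd" and u assume "u \<in> sphere 0 1" "us \<longlonglongrightarrow> u"
    moreover from this have "u \<noteq> 0" by auto
    ultimately show "(\<lambda>k. c (us k)) \<longlonglongrightarrow> c u"
      by (intro lattice_walk.maximizer_tendsto[OF W[OF p p] _ _ mx[OF p] mx[OF p]])
  qed
  have lim: "(\<lambda>k. f i j (xs k)) \<longlonglongrightarrow> chi i j u" and pos: "chi i j u > 0"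
    if ij: "i \<in> {1..p}" "j \<in> {1..p}" and xs: "filterlim (\<lambda>k. norm (vreal (xs k))) at_top sequentially" "\<And>k. xs k \<noteq> 0"
      "(\<lambda>k. vreal (xs k) /\<^sub>R norm (vreal (xs k))) \<longlonglongrightarrow> u" "norm u = 1" for i j xs u
  proof -
    interpret lattice_walk "lazy i" "H i j" by (rule W[OF ij])
    obtain \<alpha> where \<alpha>: "tilt_summable (lazy i) \<alpha>" "laplace (lazy i) \<alpha> < 1" using drift by blast
    note gl = green_limit[OF xs mx[OF ij(1)] mx[OF ij(1)]]
    show "chi i j u > 0" using gl(2) by (simp add: chi_def)
    have "f i j (xs k) = 1 / 2 * (norm (vreal (xs k)) powr ((real CARD('d) - 1) / 2) *
       ((\<Sum>n. (conv (lazy i) ^^ n) (H i j) (xs k)) * tilt (c (vreal (xs k) /\<^sub>R norm (vreal (xs k)))) (xs k)))" for k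
      unfolding f_def green_eq(1)[OF ij(1) \<alpha> ij(2)] by simp
    then show "(\<lambda>k. f i j (xs k)) \<longlonglongrightarrow> chi i j u"
      unfolding chi_def by (simp only:) (intro tendsto_mult tendsto_const gl(1))
  qed
  \<comment> \<open>Positivity was obtained along lattice sequences;
    \<open>lattice_direction\<close> supplies one for every unit vector.\<close>
  have pos': "chi i j u > 0" if "i \<in> {1..p}" "j \<in> {1..p}" "norm u = 1" for i j u
    using lattice_direction[OF that(3)] pos[OF that(1,2) _ _ _ that(3)] by blast
  have cont: "continuous_on (sphere 0 1) (chi i j)" if ij: "i \<in> {1..p}" "j \<in> {1..p}" for i j
    by (rule directional_limit_continuous[where f = "f i j", OF lim[OF ij] pos'[OF ij]])
  have unif: "\<exists>R. \<forall>x. norm (vreal x) \<ge> R \<longrightarrow> \<bar>f i j x / chi i j (vreal x /\<^sub>R norm (vreal x)) - 1\<bar> < \<epsilon>"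
    if ij: "i \<in> {1..p}" "j \<in> {1..p}" and "\<epsilon> > 0" for i j \<epsilon>
    by (rule directional_limit_uniform[where f = "f i j", OF lim[OF ij] pos'[OF ij] that(3)])
  have "\<exists>a b. a > 0 \<and> (\<forall>u\<in>sphere 0 1. a \<le> chi i j u \<and> chi i j u \<le> b)" if ij: "i \<in> {1..p}" "j \<in> {1..p}" for i j
  proof -
    have ne: "sphere (0 :: real ^ 'd) 1 \<noteq> {}" by simp
    obtain u where "u \<in> sphere 0 1" "\<forall>v\<in>sphere 0 1. chi i j u \<le> chi i j v"
      using continuous_attains_inf[OF compact_sphere ne cont[OF ij]] by blast
    moreover obtain w where "\<forall>v\<in>sphere 0 1. chi i j v \<le> chi i j w"
      using continuous_attains_sup[OF compact_sphere ne cont[OF ij]] by blast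
    ultimately show ?thesis using pos'[OF ij, of u] by (intro exI[of _ "chi i j u"] exI[of _ "chi i j w"]) auto
  qed
  then obtain A B where AB: "\<And>i j. i \<in> {1..p} \<Longrightarrow> j \<in> {1..p} \<Longrightarrow> A i j > 0"
    "\<And>i j u. i \<in> {1..p} \<Longrightarrow> j \<in> {1..p} \<Longrightarrow> u \<in> sphere 0 1 \<Longrightarrow> A i j \<le> chi i j u \<and> chi i j u \<le> B i j"
    by metis
  define C1 where "C1 = Min ((\<lambda>(i, j). A i j) ` ({1..p} \<times> {1..p}))"
  \<comment> \<open>The inserted 1 makes \<open>C2\<close> positive at once.\<close>
  define C2 where "C2 = Max (insert 1 ((\<lambda>(i, j). B i j) ` ({1..p} \<times> {1..p})))"
  have "C1 \<in> (\<lambda>(i, j). A i j) ` ({1..p} \<times> {1..p})"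
    unfolding C1_def using p by (intro Min_in) auto
  then have C1: "C1 > 0" using AB(1) by auto
  have C1': "C1 \<le> A i j" if "i \<in> {1..p}" "j \<in> {1..p}" for i j
    unfolding C1_def using that by (intro Min_le) (auto intro!: image_eqI[where x = "(i, j)"])
  have "1 \<le> C2" unfolding C2_def by (intro Max_ge) auto
  then have C2: "C2 > 0" by simp
  have C2': "B i j \<le> C2" if "i \<in> {1..p}" "j \<in> {1..p}" for i j
    unfolding C2_def using that by (intro Max_ge) (auto intro!: image_eqI[where x = "(i, j)"])
  have eq: "green p mu (0, i) (x, j) / (k * norm (vreal x) powr (- (real CARD('d) - 1) / 2)
      * exp (- (c (vreal x /\<^sub>R norm (vreal x)) \<bullet> vreal x))) = f i j x / k" for i j k x
  proof -
    have "norm (vreal x) powr (- (real CARD('d) - 1) / 2) = inverse (norm (vreal x) powr ((real CARD('d) - 1) / 2))"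
      by (simp only: minus_divide_left[symmetric] powr_minus)
    then show ?thesis
      by (simp only: f_def tilt_def exp_minus divide_inverse inverse_mult_distrib inverse_inverse_eq mult_ac)
  qed
  show ?thesis
  proof (rule exI[of _ c], rule exI[of _ chi], rule exI[of _ C1], rule exI[of _ C2], intro conjI ballI allI impI)
    fix i j assume ij: "i \<in> {1..p}" "j \<in> {1..p}"
    show "C1 \<le> chi i j u" "chi i j u \<le> C2" if "u \<in> sphere 0 1" for u
      using AB(2)[OF ij that] C1'[OF ij] C2'[OF ij] by linarith+
    show "\<exists>R. \<forall>x::int ^ 'd. norm (vreal x) \<ge> R \<longrightarrow>
                 \<bar>green p mu (0, i) (x, j) /
                   (chi i j (vreal x /\<^sub>R norm (vreal x)) * norm (vreal x) powr (- (real CARD('d) - 1) / 2)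
                    * exp (- (c (vreal x /\<^sub>R norm (vreal x)) \<bullet> vreal x))) - 1\<bar> < \<epsilon>" if "\<epsilon> > 0" for \<epsilon>
      unfolding eq by (rule unif[OF ij that])
  qed (use cont_c C1 C2 cont in auto)
qed

end
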